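(* Let $G=G_{2,f}$ be a Šunić group acting on the binary rooted tree, with defining polynomial $f$ of degree $m$, and suppose that $G$ is non-torsion (i.e. contains an element of infinite order) and is not isomorphic to the infinite dihedral group. Then the set of maximal subgroups of $G$ is countably infinite. Exactly $2^{m+1}-1$ of the maximal subgroups have finite index in $G$, and each of these has index $2$. The maximal subgroups of infinite index in $G$ are exactly the conjugates in $G$ of the finitely generated subgroups $H(q)=\langle (ab)^q, B\rangle$, where $q$ ranges over all odd primes and $b\in B$ is the element with $\psi(b)=(a,b)$.
   Context: Let $X=\{\mathbf 0,\mathbf 1\}$ and let $T$ be the binary rooted tree with vertex set $X^*$ (finite words; $w$ is joined to $wx$ for $x\in X$). $\mathrm{Aut}\,T$ acts on the left. For $g\in\mathrm{Aut}\,T$ and a vertex $v$, $g_v\in \mathrm{Aut}\,T$ is the unique automorphism with $g(vw)=g(v)g_v(w)$ for all $w$; if $g$ fixes the first level $X$ pointwise, write $\psi(g)=(g_{\mathbf 0},g_{\mathbf 1})$. Šunić groups on the binary tree: let $f(x)=x^m+a_{m-1}x^{m-1}+\dots+a_1x+a_0\in\mathbb F_2[x]$ with $m\ge 1$, $a_0\neq 0$. Let $B\cong(\mathbb Z/2)^m$ be written multiplicatively with basis $b_0,\dots,b_{m-1}$; let $\rho\colon B\to B$ be the automorphism with $\rho(b_i)=b_{i+1}$ for $0\le i\le m-2$ and $\rho(b_{m-1})=b_0^{-a_0}b_1^{-a_1}\cdots b_{m-1}^{-a_{m-1}}$. Let $A=\langle a\rangle$ be of order 2 and $\omega\colon B\to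 A$ the homomorphism with $\omega(b_i)=1$ for $i\le m-2$ and $\omega(b_{m-1})=a$. Then $a$ acts on $T$ by swapping the first letter ($a(\mathbf 0w)=\mathbf 1w$, $a(\mathbf 1w)=\mathbf 0w$), and $x\in B$ acts recursively by fixing the first level with $\psi(x)=(\omega(x),\rho(x))$. These actions are faithful, and $G_{2,f}:=\langle A\cup B\rangle\le\mathrm{Aut}\,T$. When $G_{2,f}$ is non-torsion, there is a unique element $b\in B$ with $\psi(b)=(a,b)$ (equivalently $\omega(b)=a$, $\rho(b)=b$). *)

theory Defs
  imports
    "HOL-Algebra.Generated_Groups"
    "HOL-Computational_Algebra.Polynomial"
    "HOL-Computational_Algebra.Primes"
    "HOL-Library.Z2"
    "HOL-Library.Countable_Set"
begin

section \<open>The binary rooted tree and its automorphisms\<close>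

text \<open>The alphabet is \<^typ>\<open>bool\<close>: \<^term>\<open>False\<close> is the letter 0 and \<^term>\<open>True\<close> is the letter 1.
  The vertices are all finite words, and the root is the empty word.\<close>

type_synonym vertex = "bool list"

definition adj :: "vertex \<Rightarrow> vertex \<Rightarrow> bool" where
  "adj u v \<longleftrightarrow> (\<exists>x. v = u @ [x] \<or> u = v @ [x])"

definition tree_auts :: "(vertex \<Rightarrow> vertex) set" where
  "tree_auts = {g. bij g \<and> g [] = [] \<and> (\<forall>u v. adj (g u) (g v) \<longleftrightarrow> adj u v)}"

definition Aut_T :: "(vertex \<Rightarrow> vertex) monoid" where
  "Aut_T = \<lparr>carrier = tree_auts, monoid.mult = (\<circ>), one = id\<rparr>"

definition section_at :: "(vertex \<Rightarrow> vertex) \<Rightarrow> vertex \<Rightarrow> vertex \<Rightarrow> vertex" where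
  "section_at g v = (THE h. h \<in> tree_auts \<and> (\<forall>w. g (v @ w) = g v @ h w))"

text \<open>Only meaningful for automorphisms fixing the first level pointwise.\<close>

definition psi :: "(vertex \<Rightarrow> vertex) \<Rightarrow> (vertex \<Rightarrow> vertex) \<times> (vertex \<Rightarrow> vertex)" where
  "psi g = (section_at g [False], section_at g [True])"

section \<open>Sunic groups\<close>

text \<open>With \<open>m = degree f\<close>, an element \<open>b\<^sub>0\<^bsup>x 0\<^esup> \<cdots> b\<^bsub>m-1\<^esub>\<^bsup>x (m-1)\<^esup>\<close> of \<open>B\<close> is encoded by its
  exponent vector \<open>x\<close>, which vanishes outside \<open>{..<m}\<close>; an element \<open>a\<^bsup>e\<^esup>\<close> of \<open>A\<close> is encoded
  by the exponent \<open>e\<close>.\<close>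

definition B_vecs :: "bit poly \<Rightarrow> (nat \<Rightarrow> bit) set" where
  "B_vecs f = {x. \<forall>i\<ge>degree f. x i = 0}"

definition b_vec :: "nat \<Rightarrow> nat \<Rightarrow> bit" where
  "b_vec i = (\<lambda>j. if j = i then 1 else 0)"

definition rho_b :: "bit poly \<Rightarrow> nat \<Rightarrow> nat \<Rightarrow> bit" where
  "rho_b f i = (if i + 1 < degree f then b_vec (i + 1)
                else (\<lambda>j. if j < degree f then - coeff f j else 0))"

text \<open>The homomorphisms \<open>rho\<close> and \<open>omega\<close> are the linear extensions of their values on the basis.\<close>

definition rho :: "bit poly \<Rightarrow> (nat \<Rightarrow> bit) \<Rightarrow> nat \<Rightarrow> bit" where
  "rho f x = (\<lambda>j. \<Sum>i<degree f. x i * rho_b f i j)"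

definition omega :: "bit poly \<Rightarrow> (nat \<Rightarrow> bit) \<Rightarrow> bit" where
  "omega f x = (\<Sum>i<degree f. x i * (if i + 1 < degree f then 0 else 1))"

fun a_aut :: "vertex \<Rightarrow> vertex" where
  "a_aut [] = []"
| "a_aut (x # w) = (\<not> x) # w"

definition A_act :: "bit \<Rightarrow> vertex \<Rightarrow> vertex" where
  "A_act e = (if e = 1 then a_aut else id)"

fun B_act :: "bit poly \<Rightarrow> (nat \<Rightarrow> bit) \<Rightarrow> vertex \<Rightarrow> vertex" where
  "B_act f x [] = []"
| "B_act f x (False # w) = False # A_act (omega f x) w"
| "B_act f x (True # w) = True # B_act f (rho f x) w"

text \<open>The image of \<open>B\<close> under its (faithful) action on the tree.\<close>

definition B_auts :: "bit poly \<Rightarrow> (vertex \<Rightarrow> vertex) set" where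
  "B_auts f = B_act f ` B_vecs f"

definition Sunic :: "bit poly \<Rightarrow> (vertex \<Rightarrow> vertex) monoid" where
  "Sunic f = Aut_T \<lparr>carrier := generate Aut_T (insert a_aut (B_auts f))\<rparr>"

definition H_sub :: "bit poly \<Rightarrow> (vertex \<Rightarrow> vertex) \<Rightarrow> nat \<Rightarrow> (vertex \<Rightarrow> vertex) set" where
  "H_sub f b q = generate (Sunic f)
     (insert ((a_aut \<otimes>\<^bsub>Sunic f\<^esub> b) [^]\<^bsub>Sunic f\<^esub> q) (B_auts f))"

section \<open>General group theory\<close>

definition maximal_subgroup :: "'g set \<Rightarrow> ('g, 'c) monoid_scheme \<Rightarrow> bool" where
  "maximal_subgroup M G \<longleftrightarrow> subgroup M G \<and> M \<noteq> carrier G \<and>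
     (\<forall>K. subgroup K G \<longrightarrow> M \<subseteq> K \<longrightarrow> K = M \<or> K = carrier G)"

definition conj_set :: "('g, 'c) monoid_scheme \<Rightarrow> 'g \<Rightarrow> 'g set \<Rightarrow> 'g set" where
  "conj_set G g H = (\<lambda>h. g \<otimes>\<^bsub>G\<^esub> h \<otimes>\<^bsub>G\<^esub> inv\<^bsub>G\<^esub> g) ` H"

text \<open>The infinite dihedral group as the semidirect product of \<open>\<int>\<close> with the group of order 2
  acting by inversion; the pair \<open>(k, s)\<close> has rotation part \<open>k\<close>, and \<open>s\<close> tells whether it is a
  reflection.\<close>

definition D_inf :: "(int \<times> bool) monoid" where
  "D_inf = \<lparr>carrier = UNIV,
            monoid.mult = (\<lambda>(k, s) (l, t). (k + (if s then - l else l), s \<noteq> t)),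
            one = (0, False)\<rparr>"

section \<open>Basic facts\<close>

lemma group_D_inf: "group D_inf"
proof (rule groupI)
  fix x assume "x \<in> carrier D_inf"
  obtain k s where x: "x = (k, s)" by (cases x)
  have "(if s then k else - k, s) \<otimes>\<^bsub>D_inf\<^esub> x = \<one>\<^bsub>D_inf\<^esub>"
    by (simp add: x D_inf_def)
  then show "\<exists>y\<in>carrier D_inf. y \<otimes>\<^bsub>D_inf\<^esub> x = \<one>\<^bsub>D_inf\<^esub>"
    by (auto simp: D_inf_def)
qed (auto simp: D_inf_def)

lemma group_Aut_T: "group Aut_T"
proof (rule groupI)
  fix g assume "g \<in> carrier Aut_T"
  then have b: "bij g" and r: "g [] = []" and e: "\<And>u v. adj (g u) (g v) \<longleftrightarrow> adj u v"
    by (auto simp: Aut_T_def tree_auts_def)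
  have "inv_into UNIV g \<in> tree_auts"
    unfolding tree_auts_def
  proof (intro CollectI conjI allI)
    show "bij (inv_into UNIV g)" using b by (rule bij_imp_bij_inv)
    show "inv_into UNIV g [] = []" using b r by (metis bij_inv_eq_iff)
    show "adj (inv_into UNIV g u) (inv_into UNIV g v) \<longleftrightarrow> adj u v" for u v
      using e[of "inv_into UNIV g u" "inv_into UNIV g v"] b
      by (simp add: bij_is_surj surj_f_inv_f)
  qed
  then show "\<exists>h\<in>carrier Aut_T. h \<otimes>\<^bsub>Aut_T\<^esub> g = \<one>\<^bsub>Aut_T\<^esub>"
    using b by (auto simp: Aut_T_def bij_is_inj intro!: bexI[of _ "inv_into UNIV g"])
qed (auto simp: Aut_T_def tree_auts_def bij_comp)

lemma tree_aut_snoc: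
  assumes g: "g \<in> tree_auts"
  shows "\<exists>y. g (w @ [x]) = g w @ [y]"
proof (induction w arbitrary: x rule: rev_induct)
  case Nil
  have r: "g [] = []" using g by (simp add: tree_auts_def)
  have "adj [] [x]" by (simp add: adj_def)
  then have "adj (g []) (g [x])" using g unfolding tree_auts_def by blast
  then show ?case by (simp add: r adj_def)
next
  case (snoc z w)
  obtain y where y: "g (w @ [z]) = g w @ [y]" using snoc by blast
  have "adj (w @ [z]) (w @ [z, x])" by (simp add: adj_def)
  then have "adj (g (w @ [z])) (g (w @ [z, x]))"
    using g by (simp add: tree_auts_def)
  then obtain t where "g (w @ [z, x]) = g (w @ [z]) @ [t] \<or> g (w @ [z]) = g (w @ [z, x]) @ [t]"
    by (auto simp: adj_def)
  moreover have "g (w @ [z, x]) \<noteq> g w"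
    using g by (auto simp: tree_auts_def bij_def inj_eq)
  ultimately show ?case using y by auto
qed

lemma B_act_invol: "B_act f x (B_act f x w) = w"
proof (induction f x w rule: B_act.induct)
  case (2 f x w)
  show ?case by (cases w) (auto simp: A_act_def)
qed auto

lemma a_aut_in_Aut_T: "a_aut \<in> tree_auts"
  and B_act_in_Aut_T: "B_act f x \<in> tree_auts"
proof -
  have *: "h \<in> tree_auts"
    if i: "\<And>w. h (h w) = w" and r: "h [] = []" and s: "\<And>w y. \<exists>z. h (w @ [y]) = h w @ [z]" for h
  proof -
    have "adj (h u) (h v)" if "adj u v" for u v
      using that s by (auto simp: adj_def)
    then have "adj (h u) (h v) \<longleftrightarrow> adj u v" for u v using i by metis
    moreover have "bij h" using i by (intro o_bij[of h]) auto
    ultimately show ?thesis using r by (auto simp: tree_auts_def)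
  qed
  have a: "a_aut (a_aut w) = w" "\<exists>z. a_aut (w @ [y]) = a_aut w @ [z]" for w y
    by (cases w; simp)+
  then show "a_aut \<in> tree_auts" by (intro *) auto
  have "\<exists>z. B_act f x (w @ [y]) = B_act f x w @ [z]" for w y
  proof (induction f x w rule: B_act.induct)
    case (1 f x)
    show ?case by (cases y) (auto simp: A_act_def)
  next
    case (2 f x w)
    show ?case using a(2) by (auto simp: A_act_def)
  qed auto
  then show "B_act f x \<in> tree_auts" by (intro *) (auto simp: B_act_invol)
qed

lemma section_at_eqI:
  assumes "h \<in> tree_auts" "\<And>w. g (v @ w) = g v @ h w"
  shows "section_at g v = h"
  unfolding section_at_def using assms by (intro the_equality) (auto simp: fun_eq_iff)

lemma psi_B_act: "psi (B_act f x) = (A_act (omega f x), B_act f (rho f x))"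
proof -
  have "id \<in> tree_auts" by (simp add: tree_auts_def)
  then have "A_act e \<in> tree_auts" for e by (simp add: A_act_def a_aut_in_Aut_T)
  then show ?thesis
    unfolding psi_def
    by (auto intro!: section_at_eqI B_act_in_Aut_T) (simp_all add: A_act_def)
qed

lemma rho_b_vec:
  assumes i: "i < degree f"
  shows "rho f (b_vec i) = rho_b f i"
proof
  fix j
  have "rho f (b_vec i) j = (\<Sum>k<degree f. if k = i then rho_b f k j else 0)"
    unfolding rho_def b_vec_def by (rule sum.cong) auto
  also have "\<dots> = rho_b f i j" using i by (subst sum.delta) auto
  finally show "rho f (b_vec i) j = rho_b f i j" .
qed

lemma rho_in_B_vecs: "rho f x \<in> B_vecs f"
  by (auto simp: rho_def B_vecs_def rho_b_def b_vec_def intro!: sum.neutral)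

lemma omega_eq: "0 < degree f \<Longrightarrow> omega f x = x (degree f - 1)"
proof -
  assume d: "0 < degree f"
  have "omega f x = (\<Sum>i<degree f. if i = degree f - 1 then x i else 0)"
    unfolding omega_def by (rule sum.cong) auto
  with d show ?thesis by simp
qed

end

theory Submission
  imports Defs
begin

text \<open>Call a subgroup dense if it maps onto the abelianization \<open>A \<times> B\<close> of \<open>G\<close>. A maximal subgroup
  that is not dense has index 2, and these subgroups correspond to the nonzero elements of the dual of
  \<open>A \<times> B\<close>. The sections at \<open>1\<close> of the elements of a dense subgroup \<open>M\<close> that fix the first level
  form again a dense subgroup. Words contract under taking sections, so some iterated section subgroup
  of \<open>M\<close>, up to conjugation, contains \<open>(ab)\<^sup>k\<close> for an odd \<open>k\<close>, and for the minimal such \<open>k\<close> it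
  contains, and then equals, \<open>H(k) = \<langle>(ab)\<^sup>k, B\<rangle>\<close>. This property climbs back up the tree: if the section
  subgroup lies in a conjugate of \<open>H(k)\<close>, so does \<open>M\<close>, and if the section subgroup is \<open>G\<close>, so is \<open>M\<close>.
  The latter is a branch argument: the elements of \<open>M\<close> that act on one subtree only form a nontrivial
  normal subgroup of \<open>G\<close>, which contains a geometric copy of the normal closure of the commutators
  \<open>[d, a]\<close> with \<open>d \<in> \<rho> (ker \<omega>)\<close> at some deeper vertex; this has 2-power index, and a dense
  subgroup supplements every normal subgroup of 2-power index.\<close>

text \<open>Powers of \<open>ab\<close> carry the argument because the section of
  \<open>(ab)^(2i)\<close> at 1 is \<open>(ab)^i\<close>: once \<open>(ab)^k\<close> lies in a
  subgroup, it lies in all its section subgroups, and for odd \<open>k\<close> it also exchanges the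
  two subtrees. The obstacle is gluing: an element of \<open>H(k)\<close> and one of a conjugate of
  \<open>H(k)\<close> need not be the two sections of an element of \<open>H(k)\<close>. Only their
  dihedral parts obstruct this, because the normal closure of \<open>P = rho(ker omega)\<close> in
  \<open>H(k)\<close> occurs in \<open>H(k)\<close> on either subtree alone. In \<open>G\<close>
  this closure meets the powers of \<open>ab\<close> in those of \<open>(ab)^4\<close>. Thus
  belonging to \<open>G\<close> is a congruence modulo 4 and belonging to \<open>H(k)\<close> one
  modulo \<open>k\<close>; for odd \<open>k\<close> they combine to one modulo \<open>4k\<close>,
  which suffices. The 4 comes from a factorisation \<open>ab = u d\<close> with
  \<open>u^4 = 1\<close> and \<open>d\<close> in \<open>P\<close>; such a \<open>d\<close> outside
  the kernel of omega exists as soon as that kernel is nontrivial, and a trivial kernel is the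
  dihedral case. That \<open>G\<close> is not torsion yields \<open>b\<close>, by the same
  shortest-word argument (\<open>minimal_letters\<close>) that later finds an odd power of
  \<open>ab\<close> in a section subgroup of a dense subgroup.\<close>

declare add_uminus_conv_diff [simp del]

section \<open>Tree automorphisms as an additive group\<close>

typedef taut = tree_auts
  using a_aut_in_Aut_T by blast

setup_lifting type_definition_taut

lemma id_in_tree_auts: "id \<in> tree_auts"
  by (simp add: tree_auts_def)

lemma comp_in_tree_auts: "g \<in> tree_auts \<Longrightarrow> h \<in> tree_auts \<Longrightarrow> g \<circ> h \<in> tree_auts"
  by (simp add: tree_auts_def bij_comp)

lemma inv_in_tree_auts: "g \<in> tree_auts \<Longrightarrow> inv_into UNIV g \<in> tree_auts"
proof -
  assume g: "g \<in> tree_auts"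
  then have "g \<in> carrier Aut_T" by (simp add: Aut_T_def)
  then obtain h where h: "h \<in> carrier Aut_T" "h \<otimes>\<^bsub>Aut_T\<^esub> g = \<one>\<^bsub>Aut_T\<^esub>" "g \<otimes>\<^bsub>Aut_T\<^esub> h = \<one>\<^bsub>Aut_T\<^esub>"
    by (meson group_Aut_T group.inv_closed group.l_inv group.r_inv)
  then have "inv_into UNIV g = h" by (intro inv_unique_comp) (auto simp: Aut_T_def)
  then show ?thesis using h by (simp add: Aut_T_def)
qed

text \<open>Composition is written additively although it does not commute; in \<open>g + h\<close>
  the automorphism \<open>h\<close> acts first.\<close>

instantiation taut :: group_add
begin

lift_definition zero_taut :: taut is id by (rule id_in_tree_auts)
lift_definition plus_taut :: "taut \<Rightarrow> taut \<Rightarrow> taut" is "(\<circ>)" by (rule comp_in_tree_auts)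
lift_definition uminus_taut :: "taut \<Rightarrow> taut" is "inv_into UNIV" by (rule inv_in_tree_auts)
definition minus_taut :: "taut \<Rightarrow> taut \<Rightarrow> taut" where "(g :: taut) - h = g + - h"

instance
proof
  fix a b c :: taut
  show "a + b + c = a + (b + c)" by transfer (simp add: o_assoc)
  show "0 + a = a" "a + 0 = a" by (transfer, simp)+
  show "- a + a = 0" by transfer (simp add: tree_auts_def bij_is_inj)
  show "a + - b = a - b" by (simp add: minus_taut_def)
qed

end

lemma taut_assoc [simp]: "(g :: taut) + h + k = g + (h + k)"
  by (rule add.assoc)

lemma taut_minus_add [simp]: "- ((g :: taut) + h) = - h + - g"
  by (rule minus_add)

lemma tree_aut_length: "g \<in> tree_auts \<Longrightarrow> length (g w) = length w"
proof (induction w rule: rev_induct)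
  case Nil
  then show ?case by (simp add: tree_auts_def)
next
  case (snoc x w)
  then show ?case using tree_aut_snoc[OF snoc.prems, of w x] by auto
qed

lemma tree_aut_Cons: "g \<in> tree_auts \<Longrightarrow> g (c # w) = hd (g [c]) # tl (g (c # w))"
proof (induction w rule: rev_induct)
  case Nil
  then show ?case using tree_aut_length[of g "[c]"] by (cases "g [c]") auto
next
  case (snoc x w)
  then show ?case using tree_aut_snoc[OF snoc.prems, of "c # w" x]
    by (metis Cons_eq_appendI hd_append2 list.collapse list.distinct(1) list.sel(1))
qed

lemma tree_aut_hd: "g \<in> tree_auts \<Longrightarrow> hd (g [c]) = (c \<noteq> (g [False] = [True]))"
proof -
  assume g: "g \<in> tree_auts"
  obtain u v where u: "g [False] = [u]" and v: "g [True] = [v]"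
    using tree_aut_length[OF g, of "[False]"] tree_aut_length[OF g, of "[True]"]
    by (auto simp: length_Suc_conv)
  have "g [False] \<noteq> g [True]" using g by (auto simp: tree_auts_def bij_def inj_eq)
  then show ?thesis using u v by (cases c) auto
qed

lift_definition active :: "taut \<Rightarrow> bool" is "\<lambda>g. g [False] = [True]" .

text \<open>Sections are taken of active automorphisms as well, by dropping the first letter of the
  image. Hence the product rule \<open>sec_add\<close> needs no stabiliser.\<close>

lift_definition sec :: "bool \<Rightarrow> taut \<Rightarrow> taut" is "\<lambda>c g w. tl (g (c # w))"
proof -
  fix c and g :: "vertex \<Rightarrow> vertex"
  assume g: "g \<in> tree_auts"
  define h where "h w = tl (g (c # w))" for w
  define d where "d = hd (g [c])"
  have e: "g (c # w) = d # h w" for w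
    using tree_aut_Cons[OF g, of c w] by (simp only: h_def d_def)
  have ij: "inj g" and sj: "surj g" and ad: "\<And>u v. adj (g u) (g v) = adj u v"
    using g by (auto simp: tree_auts_def bij_def)
  have "inj h"
  proof (rule injI)
    fix u v assume "h u = h v"
    then have "g (c # u) = g (c # v)" by (simp only: e)
    then show "u = v" using ij by (auto dest: injD)
  qed
  moreover have "\<exists>w. h w = u" for u
  proof -
    obtain v where v: "g v = d # u" using sj by (metis surjD)
    then obtain c' w where w: "v = c' # w"
      using tree_aut_length[OF g, of v] by (cases v) auto
    have "hd (g [c']) = d" using v tree_aut_Cons[OF g, of c' w] unfolding w by (metis list.inject)
    \<comment> \<open>The first letter of the image determines the first letter of the argument,
      whether or not \<open>g\<close> is active.\<close>
    then have "c' = c" using tree_aut_hd[OF g, of c] tree_aut_hd[OF g, of c'] unfolding d_def by metis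
    then show ?thesis using v w by (intro exI[of _ w]) (simp add: e)
  qed
  then have "surj h" unfolding surj_def by metis
  moreover have "h [] = []" using tree_aut_length[OF g, of "[c]"] unfolding e by simp
  moreover have "adj (h u) (h v) \<longleftrightarrow> adj u v" for u v
  proof -
    have c: "adj (x # u) (x # v) \<longleftrightarrow> adj u v" for x and u v :: vertex by (auto simp: adj_def)
    have "adj (h u) (h v) \<longleftrightarrow> adj (d # h u) (d # h v)" by (rule c[symmetric])
    also have "\<dots> \<longleftrightarrow> adj u v" unfolding e[symmetric] ad by (rule c)
    finally show ?thesis .
  qed
  ultimately have "h \<in> tree_auts" by (simp add: tree_auts_def bij_def)
  then show "(\<lambda>w. tl (g (c # w))) \<in> tree_auts" unfolding h_def .
qed

text \<open>On automorphisms this becomes \<open>pr\<close>, the inverse of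
  \<open>psi\<close>.\<close>

fun pair_fun :: "(vertex \<Rightarrow> vertex) \<Rightarrow> (vertex \<Rightarrow> vertex) \<Rightarrow> vertex \<Rightarrow> vertex" where
  "pair_fun u v [] = []"
| "pair_fun u v (c # w) = c # (if c then v w else u w)"

lemma pair_fun_in_tree_auts:
  assumes u: "u \<in> tree_auts" and v: "v \<in> tree_auts"
  shows "pair_fun u v \<in> tree_auts"
proof -
  have iu: "u (inv_into UNIV u x) = x" "inv_into UNIV u (u x) = x" for x
    using u by (simp_all add: tree_auts_def bij_is_inj bij_is_surj surj_f_inv_f)
  have iv: "v (inv_into UNIV v x) = x" "inv_into UNIV v (v x) = x" for x
    using v by (simp_all add: tree_auts_def bij_is_inj bij_is_surj surj_f_inv_f)
  let ?k = "pair_fun (inv_into UNIV u) (inv_into UNIV v)"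
  have "?k (pair_fun u v x) = x" "pair_fun u v (?k x) = x" for x
    by (cases x; simp add: iu iv)+
  then have "bij (pair_fun u v)" by (intro o_bij[of ?k]) (simp_all add: fun_eq_iff)
  moreover have "adj (pair_fun u v x) (pair_fun u v y) \<longleftrightarrow> adj x y" for x y
  proof -
    have a1: "adj (w # s) (z # t) \<longleftrightarrow> w = z \<and> adj s t" for w z and s t :: vertex
      by (auto simp: adj_def)
    have a2: "adj (w # s) [] \<longleftrightarrow> s = []" "adj [] (w # s) \<longleftrightarrow> s = []" for w and s :: vertex
      by (simp_all add: adj_def)
    have nu: "u s = [] \<longleftrightarrow> s = []" for s using tree_aut_length[OF u, of s] by (metis length_0_conv)
    have nv: "v s = [] \<longleftrightarrow> s = []" for s using tree_aut_length[OF v, of s] by (metis length_0_conv)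
    have uu: "adj (u s) (u t) \<longleftrightarrow> adj s t" for s t using u by (simp add: tree_auts_def)
    have vv: "adj (v s) (v t) \<longleftrightarrow> adj s t" for s t using v by (simp add: tree_auts_def)
    show ?thesis
      by (cases x; cases y; simp add: a1 a2 nu nv uu vv)
  qed
  ultimately show ?thesis by (simp add: tree_auts_def)
qed

lift_definition pr :: "taut \<Rightarrow> taut \<Rightarrow> taut" is pair_fun
  by (rule pair_fun_in_tree_auts)

lift_definition aT :: taut is a_aut by (rule a_aut_in_Aut_T)

lemma Rep_Cons: "Rep_taut g (c # w) = (c \<noteq> active g) # Rep_taut (sec c g) w"
  unfolding active.rep_eq sec.rep_eq
  using tree_aut_Cons[OF Rep_taut, of g c w] unfolding tree_aut_hd[OF Rep_taut, of g c] .

lemma Rep_Nil [simp]: "Rep_taut g [] = []"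
  using Rep_taut[of g] by (simp add: tree_auts_def)

text \<open>Identities between explicit elements are reduced by this rule to a comparison on the
  first level and of both sections.\<close>

lemma taut_eqI:
  assumes "active g = active h" "sec False g = sec False h" "sec True g = sec True h"
  shows "g = h"
proof -
  have "Rep_taut g w = Rep_taut h w" for w
  proof (cases w)
    case (Cons c u)
    have "sec c g = sec c h" using assms by (cases c) simp_all
    then show ?thesis unfolding Cons Rep_Cons using assms(1) by simp
  qed simp
  then show ?thesis by (simp add: Rep_taut_inject[symmetric] fun_eq_iff)
qed

lemma Rep_add: "Rep_taut (g + h) w = Rep_taut g (Rep_taut h w)"
  by transfer simp

lemma active_add [simp]: "active (g + h) \<longleftrightarrow> active g \<noteq> active h"
  using Rep_add[of g h "[False]"] by (auto simp: Rep_Cons)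

lemma sec_add [simp]: "sec c (g + h) = sec (c \<noteq> active h) g + sec c h"
proof -
  have "Rep_taut (sec c (g + h)) w = Rep_taut (sec (c \<noteq> active h) g + sec c h) w" for w
    using Rep_add[of g h "c # w"] by (simp add: Rep_Cons Rep_add)
  then show ?thesis by (simp add: Rep_taut_inject[symmetric] fun_eq_iff)
qed

lemma active_0 [simp]: "\<not> active 0" by transfer simp

lemma sec_0 [simp]: "sec c 0 = 0" by transfer (simp add: fun_eq_iff)

lemma active_minus [simp]: "active (- g) = active g"
  using active_add[of "- g" g] by simp

lemma sec_minus [simp]: "sec c (- g) = - sec (c \<noteq> active g) g"
proof -
  have "sec (c \<noteq> active g) g + sec c (- g) = 0"
    using sec_add[of c g "- g"] by simp
  then show ?thesis by (rule minus_unique[symmetric])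
qed

lemma active_pr [simp]: "\<not> active (pr u v)" by transfer simp

lemma sec_pr [simp]: "sec c (pr u v) = (if c then v else u)"
  by transfer (auto simp: fun_eq_iff)

lemma active_a [simp]: "active aT" by transfer simp

lemma sec_a [simp]: "sec c aT = 0" by transfer (auto simp: fun_eq_iff)

lemma a_a [simp]: "aT + aT = 0" "aT + (aT + g) = g"
proof -
  show "aT + aT = 0" by (rule taut_eqI) simp_all
  then show "aT + (aT + g) = g" by (simp flip: taut_assoc)
qed

lemma minus_a [simp]: "- aT = aT"
  by (rule minus_unique) simp

lemma a_neq_0 [simp]: "aT \<noteq> 0" "0 \<noteq> aT" using active_a active_0 by metis+

lemma pr_0_0 [simp]: "pr 0 0 = 0" by (rule taut_eqI) simp_all

lemma pr_add: "pr u v + pr u' v' = pr (u + u') (v + v')"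
  by (rule taut_eqI) simp_all

lemma minus_pr: "- pr u v = pr (- u) (- v)"
  by (rule taut_eqI) simp_all

lemma pr_eta: "\<not> active g \<Longrightarrow> pr (sec False g) (sec True g) = g"
  by (rule taut_eqI) simp_all

text \<open>A coinduction principle: a set of inactive automorphisms closed under sections never
  changes a letter, at any depth.\<close>

lemma taut_eq_0I:
  assumes "\<And>g. g \<in> X \<Longrightarrow> \<not> active g" "\<And>g c. g \<in> X \<Longrightarrow> sec c g \<in> X" and "g \<in> X"
  shows "g = 0"
proof -
  have "Rep_taut g w = w" if "g \<in> X" for w
    using that by (induction w arbitrary: g) (auto simp: Rep_Cons assms)
  then show ?thesis using \<open>g \<in> X\<close>
    by (simp add: Rep_taut_inject[symmetric] fun_eq_iff zero_taut.rep_eq)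
qed

section \<open>Subgroups\<close>

definition sgp :: "taut set \<Rightarrow> bool" where
  "sgp K \<longleftrightarrow> 0 \<in> K \<and> (\<forall>g\<in>K. \<forall>h\<in>K. g + h \<in> K) \<and> (\<forall>g\<in>K. - g \<in> K)"

lemma sgpI:
  assumes "0 \<in> K" "\<And>g h. g \<in> K \<Longrightarrow> h \<in> K \<Longrightarrow> g + h \<in> K" "\<And>g. g \<in> K \<Longrightarrow> - g \<in> K"
  shows "sgp K"
  using assms by (simp add: sgp_def)

lemma sgp_0: "sgp K \<Longrightarrow> 0 \<in> K"
  and sgp_add: "sgp K \<Longrightarrow> g \<in> K \<Longrightarrow> h \<in> K \<Longrightarrow> g + h \<in> K"
  and sgp_minus: "sgp K \<Longrightarrow> g \<in> K \<Longrightarrow> - g \<in> K"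
  by (simp_all add: sgp_def)

lemma sgp_minus_iff: "sgp K \<Longrightarrow> - g \<in> K \<longleftrightarrow> g \<in> K"
  by (metis minus_minus sgp_minus)

lemma sgp_add_left: "sgp K \<Longrightarrow> g \<in> K \<Longrightarrow> g + h \<in> K \<longleftrightarrow> h \<in> K"
  by (metis minus_add_cancel sgp_add sgp_minus)

lemma sgp_add_right: "sgp K \<Longrightarrow> h \<in> K \<Longrightarrow> g + h \<in> K \<longleftrightarrow> g \<in> K"
  by (metis add.right_neutral add.right_inverse taut_assoc sgp_add sgp_minus)

definition conjs :: "taut \<Rightarrow> taut set \<Rightarrow> taut set" where
  "conjs g K = (\<lambda>k. g + k + - g) ` K"

lemma mem_conjs: "x \<in> conjs g K \<longleftrightarrow> - g + x + g \<in> K"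
proof
  assume "- g + x + g \<in> K"
  then have "g + (- g + x + g) + - g \<in> conjs g K" unfolding conjs_def by (rule imageI)
  then show "x \<in> conjs g K" by simp
qed (auto simp: conjs_def)

lemma conjs_conjs: "conjs g (conjs h K) = conjs (g + h) K"
  by (auto simp: mem_conjs set_eq_iff)

lemma conjs_0 [simp]: "conjs 0 K = K"
  by (auto simp: mem_conjs)

lemma conjs_mono: "K \<subseteq> L \<Longrightarrow> conjs g K \<subseteq> conjs g L"
  by (auto simp: mem_conjs)

lemma conjs_subset_iff: "conjs g K \<subseteq> L \<longleftrightarrow> K \<subseteq> conjs (- g) L"
  using conjs_mono[of "conjs g K" L "- g"] conjs_mono[of K "conjs (- g) L" g]
  by (auto simp: conjs_conjs)

lemma sgp_conjs: "sgp K \<Longrightarrow> sgp (conjs g K)"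
proof (rule sgpI)
  assume K: "sgp K"
  show "0 \<in> conjs g K" using sgp_0[OF K] by (simp add: mem_conjs)
  show "x + y \<in> conjs g K" if "x \<in> conjs g K" "y \<in> conjs g K" for x y
    using sgp_add[OF K, of "- g + x + g" "- g + y + g"] that by (simp add: mem_conjs)
  show "- x \<in> conjs g K" if "x \<in> conjs g K" for x
    using sgp_minus[OF K, of "- g + x + g"] that by (simp add: mem_conjs)
qed

lemma conjs_self: "sgp K \<Longrightarrow> g \<in> K \<Longrightarrow> conjs g K = K"
  by (auto simp: mem_conjs sgp_add_left sgp_add_right sgp_minus_iff)

definition sec1 :: "taut set \<Rightarrow> taut set" where
  "sec1 K = {sec True g | g. g \<in> K \<and> \<not> active g}"

lemma sec1I: "g \<in> K \<Longrightarrow> \<not> active g \<Longrightarrow> sec True g \<in> sec1 K"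
  by (auto simp: sec1_def)

lemma sec1_mono: "K \<subseteq> L \<Longrightarrow> sec1 K \<subseteq> sec1 L"
  by (auto simp: sec1_def)

lemma sgp_sec1: "sgp K \<Longrightarrow> sgp (sec1 K)"
proof (rule sgpI)
  assume K: "sgp K"
  show "0 \<in> sec1 K" using sec1I[OF sgp_0[OF K]] by simp
  show "g + h \<in> sec1 K" if "g \<in> sec1 K" "h \<in> sec1 K" for g h
  proof -
    from that obtain g' h' where "g' \<in> K" "\<not> active g'" "h' \<in> K" "\<not> active h'"
      "g = sec True g'" "h = sec True h'" by (auto simp: sec1_def)
    then show ?thesis using sec1I[of "g' + h'" K] sgp_add[OF K] by simp
  qed
  show "- g \<in> sec1 K" if "g \<in> sec1 K" for g
  proof -
    from that obtain g' where "g' \<in> K" "\<not> active g'" "g = sec True g'" by (auto simp: sec1_def)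
    then show ?thesis using sec1I[of "- g'" K] sgp_minus[OF K] by simp
  qed
qed

text \<open>Conjugation by an active element of \<open>K\<close> exchanges the subtrees. Because of
  this it suffices to follow the sections at 1.\<close>

lemma sec0_in_sec1:
  assumes K: "sgp K" and t: "t \<in> K" "active t" and g: "g \<in> K" "\<not> active g"
  shows "- sec True t + sec False g + sec True t \<in> sec1 K"
  using sec1I[of "- t + g + t" K] sgp_add[OF K] sgp_minus[OF K] t g by simp

section \<open>The group generated by \<open>a\<close> and \<open>B\<close>\<close>

text \<open>A word is read as a product, with \<^const>\<open>None\<close> standing for a fixed involution \<open>s\<close>
  (not only for \<^const>\<open>aT\<close>: the subgroups \<open>H(q)\<close> are obtained from other choices of \<open>s\<close>).\<close>

type_synonym word = "taut option list"

primrec ev :: "taut \<Rightarrow> word \<Rightarrow> taut" where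
  "ev s [] = 0"
| "ev s (l # w) = (case l of None \<Rightarrow> s | Some x \<Rightarrow> x) + ev s w"

definition nA :: "word \<Rightarrow> nat" where "nA w = length (filter (\<lambda>l. l = None) w)"
definition nV :: "word \<Rightarrow> nat" where "nV w = length (filter (\<lambda>l. l \<noteq> None) w)"

lemma nA_simps [simp]: "nA [] = 0" "nA (None # w) = Suc (nA w)" "nA (Some x # w) = nA w"
  "nA (w @ w') = nA w + nA w'"
  by (simp_all add: nA_def)

lemma nV_simps [simp]: "nV [] = 0" "nV (None # w) = nV w" "nV (Some x # w) = Suc (nV w)"
  "nV (w @ w') = nV w + nV w'"
  by (simp_all add: nV_def)

lemma ev_append [simp]: "ev s (w @ w') = ev s w + ev s w'"
  by (induction w) simp_all

definition om :: "taut \<Rightarrow> bool" where "om x \<longleftrightarrow> active (sec False x)"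

text \<open>The rightmost letter acts first, so the leading letter is read after \<open>w\<close>
  has flipped \<open>c\<close> as often as \<open>s\<close> occurs in \<open>w\<close>. Read at 1, a
  letter of \<open>B\<close> passes to its image under rho; read at 0, to its value under
  omega.\<close>

primrec wsec :: "bool \<Rightarrow> word \<Rightarrow> word" where
  "wsec c [] = []"
| "wsec c (l # w) = (case l of None \<Rightarrow> [] | Some x \<Rightarrow>
     if c \<noteq> odd (nA w) then [Some (sec True x)] else if om x then [None] else []) @ wsec c w"

text \<open>Contraction: each letter of \<open>B\<close> leaves at most one letter in the section.
  The number of letters of \<open>B\<close> drops unless the section contains no \<open>s\<close> at
  all.\<close>

lemma nV_nA_wsec: "nV (wsec c w) + nA (wsec c w) \<le> nV w"
proof (induction w)
  case (Cons l w)
  then show ?case by (cases l) auto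
qed simp

lemma nV_wsec_split: "nV (wsec False w) + nV (wsec True w) = nV w"
proof (induction w)
  case (Cons l w)
  then show ?case by (cases l) auto
qed simp

lemma nA_wsec_split:
  "nA (wsec False w) + nA (wsec True w) = length (filter (\<lambda>l. \<exists>x. l = Some x \<and> om x) w)"
proof (induction w)
  case (Cons l w)
  then show ?case by (cases l) auto
qed simp

lemma Some_in_wsec:
  "Some y \<in> set (wsec False w) \<union> set (wsec True w) \<longleftrightarrow> (\<exists>x. Some x \<in> set w \<and> y = sec True x)"
proof (induction w)
  case (Cons l w)
  then show ?case by (cases l) (auto split: if_splits)
qed simp

definition rpow :: "nat \<Rightarrow> taut \<Rightarrow> taut" where "rpow j = (sec True ^^ j)"

lemma rpow_0 [simp]: "rpow 0 x = x" by (simp add: rpow_def)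

lemma rpow_Suc: "rpow (Suc j) x = rpow j (sec True x)" by (simp add: rpow_def funpow_swap1)

lemma rpow_Suc': "rpow (Suc j) x = sec True (rpow j x)" by (simp add: rpow_def)

text \<open>The number of active vertices on level \<open>j\<close> modulo 2. These homomorphisms for \<open>j > 0\<close> will
  determine the component \<open>vec g\<close> in \<open>B\<close> of the abelianization of an element \<open>g\<close>.\<close>

primrec al :: "nat \<Rightarrow> taut \<Rightarrow> bool" where
  "al 0 g = active g"
| "al (Suc j) g = (al j (sec False g) \<noteq> al j (sec True g))"

lemma al_0 [simp]: "\<not> al j 0" by (induction j) simp_all

lemma al_add [simp]: "al j (g + h) \<longleftrightarrow> al j g \<noteq> al j h"
proof (induction j arbitrary: g h)
  case (Suc j)
  then show ?case by (cases "active h") auto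
qed simp

lemma al_minus [simp]: "al j (- g) \<longleftrightarrow> al j g"
  using al_add[of j "- g" g] by simp

lemma al_Suc_a [simp]: "\<not> al (Suc j) aT" by simp

declare al.simps(2) [simp del]

text \<open>The properties through which the polynomial enters. The condition
  \<open>rho_inj_0\<close> reflects that the constant coefficient is nonzero; faithfulness is
  implicit, since the elements of \<open>B\<close> are automorphisms.\<close>

locale sunic_group =
  fixes B :: "taut set"
  assumes finite_B: "finite B"
    and zero_B [simp]: "0 \<in> B"
    and add_B: "x \<in> B \<Longrightarrow> y \<in> B \<Longrightarrow> x + y \<in> B"
    and invol_B: "x \<in> B \<Longrightarrow> x + x = 0"
    and inactive_B: "x \<in> B \<Longrightarrow> \<not> active x"
    and rho_B: "x \<in> B \<Longrightarrow> sec True x \<in> B"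
    and om_cases: "x \<in> B \<Longrightarrow> sec False x = 0 \<or> sec False x = aT"
    and rho_inj_0: "x \<in> B \<Longrightarrow> sec True x = 0 \<Longrightarrow> x = 0"
    and B_nontrivial: "\<exists>x\<in>B. x \<noteq> 0"
begin

lemma minus_B [simp]: "x \<in> B \<Longrightarrow> - x = x"
  by (rule minus_unique) (rule invol_B)

lemma add_comm_B: "x \<in> B \<Longrightarrow> y \<in> B \<Longrightarrow> x + y = y + x"
  by (metis add_B minus_B taut_minus_add)

lemma cancel_B [simp]: "x \<in> B \<Longrightarrow> x + (x + g) = g"
  by (metis minus_B minus_add_cancel)

lemma sec_False_B: "x \<in> B \<Longrightarrow> sec False x = (if om x then aT else 0)"
  using om_cases[of x] by (auto simp: om_def)

lemma om_add: "x \<in> B \<Longrightarrow> y \<in> B \<Longrightarrow> om (x + y) \<longleftrightarrow> om x \<noteq> om y"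
  by (simp add: om_def inactive_B)

lemma sec_True_add_B: "x \<in> B \<Longrightarrow> y \<in> B \<Longrightarrow> sec True (x + y) = sec True x + sec True y"
  by (simp add: inactive_B)

lemma rpow_in_B [simp]: "x \<in> B \<Longrightarrow> rpow j x \<in> B"
  by (induction j) (auto simp: rpow_Suc' rho_B)

lemma rpow_add: "x \<in> B \<Longrightarrow> y \<in> B \<Longrightarrow> rpow j (x + y) = rpow j x + rpow j y"
  by (induction j) (simp_all add: rpow_Suc' inactive_B)

lemma rpow_zero [simp]: "rpow j 0 = 0"
  by (induction j) (simp_all add: rpow_Suc')

lemma inj_sec_True_B: "inj_on (sec True) B"
proof (rule inj_onI)
  fix x y assume xy: "x \<in> B" "y \<in> B" "sec True x = sec True y"
  then have "sec True (x + y) = 0" by (metis sec_True_add_B rho_B invol_B)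
  then have "x + y = 0" using xy rho_inj_0 add_B by blast
  then show "x = y" using xy by (metis cancel_B add.right_neutral)
qed

lemma sec_True_image_B: "sec True ` B = B"
  by (rule endo_inj_surj) (auto simp: finite_B rho_B inj_sec_True_B)

lemma rpow_image_B: "rpow j ` B = B"
proof (induction j)
  case (Suc j)
  have "rpow (Suc j) ` B = sec True ` rpow j ` B" by (auto simp: rpow_Suc')
  then show ?case using Suc sec_True_image_B by simp
qed (simp add: image_def)

text \<open>If omega vanishes along the rho-orbit of \<open>x\<close>, then all sections of
  \<open>x\<close> are trivial or belong to that orbit, and no element of the orbit is active. So an
  element of \<open>B\<close> is determined by omega on its orbit.\<close>

lemma eq_0_if_not_om:
  assumes "x \<in> B" "\<And>j. \<not> om (rpow j x)"
  shows "x = 0"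
proof (rule taut_eq_0I[where X = "insert 0 {x \<in> B. \<forall>j. \<not> om (rpow j x)}"])
  fix g c assume g: "g \<in> insert 0 {x \<in> B. \<forall>j. \<not> om (rpow j x)}"
  then show "\<not> active g" by (auto simp: inactive_B)
  show "sec c g \<in> insert 0 {x \<in> B. \<forall>j. \<not> om (rpow j x)}"
  proof (cases "g = 0")
    case False
    with g have g: "g \<in> B" "\<And>j. \<not> om (rpow j g)" by auto
    then have "sec False g = 0" using g(2)[of 0] by (simp add: sec_False_B)
    moreover have "\<not> om (rpow j (sec True g))" for j using g(2)[of "Suc j"] by (simp add: rpow_Suc)
    ultimately show ?thesis using g by (cases c) (auto simp: rho_B)
  qed simp
qed (use assms in auto)

text \<open>Below the first level, \<open>x\<close> acts through its rho-image at 1 and through 0 or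
  \<open>a\<close> at 0; the latter is inactive on all levels but its top one.\<close>

lemma al_B: "x \<in> B \<Longrightarrow> al (Suc j) x \<longleftrightarrow> om (rpow j x)"
proof (induction j arbitrary: x)
  case 0
  then show ?case by (simp add: al.simps om_def inactive_B rho_B)
next
  case (Suc j)
  have "\<not> al (Suc j) (sec False x)" using om_cases[OF Suc.prems] al_Suc_a[of j] by fastforce
  then have "al (Suc (Suc j)) x \<longleftrightarrow> al (Suc j) (sec True x)"
    by (subst al.simps(2)) (simp only: simp_thms)
  also have "\<dots> \<longleftrightarrow> om (rpow j (sec True x))" using Suc rho_B by blast
  finally show ?case by (simp only: rpow_Suc)
qed

lemma B_eqI:
  assumes "x \<in> B" "y \<in> B" "\<And>j. al (Suc j) x = al (Suc j) y"
  shows "x = y"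
proof -
  have "\<not> om (rpow j (x + y))" for j
    using al_B[OF add_B[OF assms(1,2)], of j] assms(3)[of j] al_add[of "Suc j" x y] by blast
  then have "x + y = 0" using eq_0_if_not_om add_B assms by blast
  then show ?thesis using assms by (metis cancel_B add.right_neutral)
qed

definition valid :: "word \<Rightarrow> bool" where "valid w \<longleftrightarrow> (\<forall>x. Some x \<in> set w \<longrightarrow> x \<in> B)"

lemma valid_simps [simp]: "valid []" "valid (None # w) = valid w"
  "valid (Some x # w) \<longleftrightarrow> x \<in> B \<and> valid w" "valid (u @ w) \<longleftrightarrow> valid u \<and> valid w"
  "valid (rev w) = valid w"
  by (auto simp: valid_def)

lemma valid_wsec: "valid w \<Longrightarrow> valid (wsec c w)"
proof (induction w)
  case (Cons l w)
  then show ?case by (cases l) (auto simp: rho_B)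
qed simp

definition gen :: "taut \<Rightarrow> taut set" where "gen s = {ev s w | w. valid w}"

lemma ev_in_gen: "valid w \<Longrightarrow> ev s w \<in> gen s"
  by (auto simp: gen_def)

lemma gen_induct [consumes 1, case_names zero s B]:
  assumes "g \<in> gen s" "P 0" "\<And>g. g \<in> gen s \<Longrightarrow> P g \<Longrightarrow> P (s + g)"
    "\<And>x g. x \<in> B \<Longrightarrow> g \<in> gen s \<Longrightarrow> P g \<Longrightarrow> P (x + g)"
  shows "P g"
proof -
  have "P (ev s w)" if "valid w" for w
    using that
  proof (induction w)
    case (Cons l w)
    then show ?case using assms(3,4) ev_in_gen by (cases l) auto
  qed (simp add: assms)
  then show ?thesis using assms(1) by (auto simp: gen_def)
qed

lemma s_in_gen: "s \<in> gen s" using ev_in_gen[of "[None]" s] by simp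

lemma B_in_gen: "x \<in> B \<Longrightarrow> x \<in> gen s" using ev_in_gen[of "[Some x]" s] by simp

lemma gen_add: "g \<in> gen s \<Longrightarrow> h \<in> gen s \<Longrightarrow> g + h \<in> gen s"
  by (auto simp: gen_def) (metis ev_append valid_simps(4))

lemma ev_rev:
  assumes "s + s = 0" "valid w"
  shows "- ev s w = ev s (rev w)"
  using \<open>valid w\<close>
proof (induction w)
  case (Cons l w)
  then show ?case using minus_unique[OF assms(1)] by (cases l) auto
qed simp

lemma sgp_gen: "s + s = 0 \<Longrightarrow> sgp (gen s)"
proof (rule sgpI)
  assume s: "s + s = 0"
  show "0 \<in> gen s" using ev_in_gen[of "[]" s] by simp
  show "- g \<in> gen s" if "g \<in> gen s" for g
    using that ev_rev[OF s] ev_in_gen[of "rev _" s] by (auto simp: gen_def)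
qed (rule gen_add)

lemma gen_subset: "sgp K \<Longrightarrow> s \<in> K \<Longrightarrow> B \<subseteq> K \<Longrightarrow> gen s \<subseteq> K"
proof
  fix g assume K: "sgp K" "s \<in> K" "B \<subseteq> K" and "g \<in> gen s"
  from this(4) show "g \<in> K" by (induction rule: gen_induct) (use K in \<open>auto simp: sgp_add sgp_0\<close>)
qed

section \<open>The group and its abelianization\<close>

abbreviation G :: "taut set" where "G \<equiv> gen aT"

lemma sgp_G: "sgp G" by (rule sgp_gen) simp

lemmas G_add = sgp_add[OF sgp_G] and G_minus = sgp_minus[OF sgp_G] and G_0 = sgp_0[OF sgp_G]
  and G_a = s_in_gen[of aT] and G_B = B_in_gen[where s = aT]

lemma sec_B_in_G: "x \<in> B \<Longrightarrow> sec c x \<in> G"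
  by (cases c) (auto simp: sec_False_B G_a G_0 G_B rho_B)

lemma sec_in_G: "g \<in> G \<Longrightarrow> sec c g \<in> G"
proof (induction arbitrary: c rule: gen_induct)
  case (B x g)
  then show ?case by (simp add: G_add sec_B_in_G)
qed (simp_all add: G_0)

lemma sec1_subset_G: "K \<subseteq> G \<Longrightarrow> sec1 K \<subseteq> G"
  by (auto simp: sec1_def intro: sec_in_G)

text \<open>The homomorphisms \<open>al\<close> do not refer to a word, so this component of the
  class is independent of the choice of a word by construction.\<close>

definition vec :: "taut \<Rightarrow> taut" where
  "vec g = (THE x. x \<in> B \<and> (\<forall>j. al (Suc j) x = al (Suc j) g))"

lemma vec_eqI: "x \<in> B \<Longrightarrow> (\<And>j. al (Suc j) x = al (Suc j) g) \<Longrightarrow> vec g = x"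
  unfolding vec_def by (rule the_equality) (auto intro!: B_eqI)

lemma vec_props:
  assumes "g \<in> G"
  shows "vec g \<in> B \<and> (\<forall>j. al (Suc j) (vec g) = al (Suc j) g)"
proof -
  from assms have "\<exists>x. x \<in> B \<and> (\<forall>j. al (Suc j) x = al (Suc j) g)"
  proof (induction rule: gen_induct)
    case zero
    then show ?case by (metis zero_B)
  next
    case (s g)
    then obtain x where x: "x \<in> B" "\<And>j. al (Suc j) x = al (Suc j) g" by metis
    have "al (Suc j) x = al (Suc j) (aT + g)" for j
      using x(2)[of j] al_add[of "Suc j" aT g] al_Suc_a by blast
    then show ?case using x(1) by blast
  next
    case (B y g)
    then obtain x where x: "x \<in> B" "\<And>j. al (Suc j) x = al (Suc j) g" by metis
    then have "al (Suc j) (y + x) = al (Suc j) (y + g)" for j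
      using al_add[of "Suc j" y x] al_add[of "Suc j" y g] by blast
    then show ?case using add_B[OF B.hyps(1) x(1)] by blast
  qed
  then obtain x where x: "x \<in> B" "\<And>j. al (Suc j) x = al (Suc j) g" by metis
  then show ?thesis using vec_eqI[of x g] by blast
qed

lemma vec_in_B: "g \<in> G \<Longrightarrow> vec g \<in> B" using vec_props by blast

lemma vec_add: "g \<in> G \<Longrightarrow> h \<in> G \<Longrightarrow> vec (g + h) = vec g + vec h"
proof (rule vec_eqI)
  assume gh: "g \<in> G" "h \<in> G"
  show "vec g + vec h \<in> B" using gh by (simp add: add_B vec_in_B)
  show "al (Suc j) (vec g + vec h) = al (Suc j) (g + h)" for j
    using vec_props[OF gh(1)] vec_props[OF gh(2)] al_add[of "Suc j"] by blast
qed

lemma vec_B [simp]: "x \<in> B \<Longrightarrow> vec x = x" by (rule vec_eqI) auto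

lemma vec_a [simp]: "vec aT = 0"
  by (rule vec_eqI) simp_all

lemma vec_0 [simp]: "vec 0 = 0" by simp

lemma vec_minus: "g \<in> G \<Longrightarrow> vec (- g) = vec g"
proof -
  assume g: "g \<in> G"
  then have "vec (- g) + vec g = 0" using vec_add[OF G_minus[OF g] g] by simp
  then have "vec (- g) = - vec g" by (simp add: eq_neg_iff_add_eq_0)
  then show ?thesis using g by (simp add: vec_in_B)
qed

lemma vec_conj: "g \<in> G \<Longrightarrow> h \<in> G \<Longrightarrow> vec (g + h + - g) = vec h"
  using add_comm_B[of "vec h" "vec g"] by (simp add: vec_add vec_minus G_add G_minus vec_in_B)

text \<open>The classes of the two sections of \<open>g\<close>: \<open>y\<^sub>c\<close> is the sum of the letters
  of a word for \<open>g\<close> which are read in the state \<open>True\<close> when the word is applied to \<open>c\<close>.\<close>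

lemma sec_class:
  assumes "g \<in> G"
  obtains y0 y1 where "y0 \<in> B" "y1 \<in> B" "y0 + y1 = vec g"
    "vec (sec False g) = sec True y0" "vec (sec True g) = sec True y1"
    "active (sec False g) = om y1" "active (sec True g) = om y0"
proof -
  from assms have "\<exists>y0\<in>B. \<exists>y1\<in>B. y0 + y1 = vec g \<and>
    vec (sec False g) = sec True y0 \<and> vec (sec True g) = sec True y1 \<and>
    active (sec False g) = om y1 \<and> active (sec True g) = om y0"
  proof (induction rule: gen_induct)
    case zero
    then show ?case by (intro bexI[of _ 0]) (auto simp: om_def)
  next
    case (s g)
    then show ?case by (simp add: vec_add G_a vec_in_B)
  next
    case (B x g)
    then obtain y0 y1 where y: "y0 \<in> B" "y1 \<in> B" "y0 + y1 = vec g"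
      "vec (sec False g) = sec True y0" "vec (sec True g) = sec True y1"
      "active (sec False g) = om y1" "active (sec True g) = om y0" by blast
    have v: "vec (x + g) = x + vec g" using B by (simp add: vec_add G_B)
    have sg: "sec True g \<in> G" "sec False g \<in> G" using B sec_in_G by auto
    have x0: "vec (sec False x) = 0" "active (sec False x) = om x"
      using B by (simp add: sec_False_B, simp add: om_def)
    have x1: "vec (sec True x) = sec True x" "\<not> active (sec True x)"
      using B by (auto simp: rho_B inactive_B)
    have sx: "sec c x \<in> G" for c using B sec_B_in_G by auto
    show ?case
    proof (cases "active g")
      case True
      have "(x + y0) + y1 = vec (x + g)" using y v by simp
      moreover have "vec (sec False (x + g)) = sec True (x + y0)"
        using True y B sg sx x1 by (simp add: vec_add sec_True_add_B inactive_B)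
      moreover have "vec (sec True (x + g)) = sec True y1"
        using True y B sg sx x0 by (simp add: vec_add)
      moreover have "active (sec False (x + g)) = om y1" "active (sec True (x + g)) = om (x + y0)"
        using True y B x0 x1 by (auto simp: om_add)
      ultimately show ?thesis using y B add_B by blast
    next
      case False
      have "y0 + (x + y1) = vec (x + g)" using y v B
        by (metis add_comm_B add.assoc)
      moreover have "vec (sec True (x + g)) = sec True (x + y1)"
        using False y B sg sx x1 by (simp add: vec_add sec_True_add_B inactive_B)
      moreover have "vec (sec False (x + g)) = sec True y0"
        using False y B sg sx x0 by (simp add: vec_add)
      moreover have "active (sec True (x + g)) = om y0" "active (sec False (x + g)) = om (x + y1)"
        using False y B x0 x1 by (auto simp: om_add)
      ultimately show ?thesis using y B add_B by blast
    qed
  qed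
  then show ?thesis using that by blast
qed

lemma vec_sec_sum: "g \<in> G \<Longrightarrow> vec (sec False g) + vec (sec True g) = sec True (vec g)"
  by (metis sec_class sec_True_add_B)

section \<open>Dense subgroups and their section subgroups\<close>

definition dense :: "taut set \<Rightarrow> bool" where
  "dense K \<longleftrightarrow> sgp K \<and> K \<subseteq> G \<and> (\<forall>e. \<forall>x\<in>B. \<exists>g\<in>K. active g = e \<and> vec g = x)"

lemma dense_mono: "dense K \<Longrightarrow> K \<subseteq> L \<Longrightarrow> sgp L \<Longrightarrow> L \<subseteq> G \<Longrightarrow> dense L"
  by (auto simp: dense_def) (meson subsetD)

lemma denseI:
  assumes "sgp K" "K \<subseteq> G" "s \<in> K" "active s" "vec s = 0" "B \<subseteq> K"
  shows "dense K"
  unfolding dense_def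
proof (intro conjI allI ballI)
  fix e x assume x: "x \<in> B"
  show "\<exists>g\<in>K. active g = e \<and> vec g = x"
  proof (cases e)
    case True
    have "s + x \<in> K" "active (s + x)" "vec (s + x) = x"
      using assms x by (auto simp: sgp_add inactive_B vec_add G_B)
    then show ?thesis using True by blast
  next
    case False
    then show ?thesis using assms x by (metis inactive_B subsetD vec_B)
  qed
qed (use assms in auto)

lemma dense_G: "dense G"
  by (rule denseI[of _ aT]) (auto simp: sgp_G G_a G_B)

lemma dense_conjs: "dense K \<Longrightarrow> g \<in> G \<Longrightarrow> dense (conjs g K)"
  unfolding dense_def
proof (intro conjI allI ballI, goal_cases)
  case 1
  then show ?case by (simp add: sgp_conjs)
next
  case 2
  then show ?case by (auto simp: conjs_def intro!: G_add G_minus)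
next
  case (3 e x)
  then obtain h where h: "h \<in> K" "active h = e" "vec h = x" by blast
  then have "g + h + - g \<in> conjs g K" unfolding conjs_def by blast
  moreover have "active (g + h + - g) = e" using h(2) by auto
  moreover have "vec (g + h + - g) = x" using h 3 vec_conj[of g h] by auto
  ultimately show ?case by blast
qed

text \<open>The pairs \<open>(y0, y1)\<close> of \<open>sec_class\<close> realised by inactive elements of a dense subgroup exhaust
  \<open>B \<times> B\<close>: they form a subgroup which is invariant under the swap and
  projects onto \<open>B\<close> under addition.\<close>

lemma dense_pairs:
  assumes K: "dense K" and y: "y0 \<in> B" "y1 \<in> B"
  obtains g where "g \<in> K" "\<not> active g" "vec (sec False g) = sec True y0"
    "vec (sec True g) = sec True y1" "active (sec False g) = om y1" "active (sec True g) = om y0"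
proof -
  have sK: "sgp K" and KG: "K \<subseteq> G" using K by (auto simp: dense_def)
  define R where "R u v \<longleftrightarrow> (\<exists>g\<in>K. \<not> active g \<and> vec (sec False g) = sec True u \<and>
    vec (sec True g) = sec True v \<and> active (sec False g) = om v \<and> active (sec True g) = om u)" for u v
  have add: "R (u + u') (v + v')" if "R u v" "R u' v'" "u \<in> B" "u' \<in> B" "v \<in> B" "v' \<in> B" for u v u' v'
  proof -
    from that obtain g h where g: "g \<in> K" "\<not> active g" "vec (sec False g) = sec True u"
      "vec (sec True g) = sec True v" "active (sec False g) = om v" "active (sec True g) = om u"
      and h: "h \<in> K" "\<not> active h" "vec (sec False h) = sec True u'"
      "vec (sec True h) = sec True v'" "active (sec False h) = om v'" "active (sec True h) = om u'"
      unfolding R_def by blast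
    have "g \<in> G" "h \<in> G" using g h KG by auto
    then show ?thesis unfolding R_def using g h that sgp_add[OF sK g(1) h(1)]
      by (intro bexI[of _ "g + h"]) (simp_all add: vec_add sec_in_G inactive_B om_add)
  qed
  have swap: "R v u" if "R u v" for u v
  proof -
    from that obtain g where g: "g \<in> K" "\<not> active g" "vec (sec False g) = sec True u"
      "vec (sec True g) = sec True v" "active (sec False g) = om v" "active (sec True g) = om u"
      unfolding R_def by blast
    obtain t where t: "t \<in> K" "active t" using K unfolding dense_def by (metis zero_B)
    let ?h = "t + g + - t"
    have "g \<in> G" "t \<in> G" using g t KG by auto
    then have G: "sec c g \<in> G" "sec c t \<in> G" for c by (simp_all add: sec_in_G)
    have "?h \<in> K" "\<not> active ?h" using g t sK by (auto simp: sgp_add sgp_minus)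
    moreover have "sec False ?h = sec True t + sec True g + - sec True t"
      "sec True ?h = sec False t + sec False g + - sec False t" using g t by auto
    ultimately show ?thesis unfolding R_def using g G vec_conj by (intro bexI[of _ ?h]) auto
  qed
  have sum: "\<exists>u\<in>B. \<exists>v\<in>B. R u v \<and> u + v = x" if "x \<in> B" for x
  proof -
    obtain g where g: "g \<in> K" "\<not> active g" "vec g = x" using K \<open>x \<in> B\<close> unfolding dense_def by metis
    with KG have "g \<in> G" by auto
    from sec_class[OF this] g show ?thesis unfolding R_def by metis
  qed
  \<comment> \<open>Adding \<open>R u v\<close> and its swap gives \<open>R x x\<close> for
    \<open>x = u + v\<close>. Adding \<open>R v v\<close> to \<open>R u v\<close> then cancels the
    second entry, since \<open>v + v = 0\<close>.\<close>
  have diag: "R x x" if x: "x \<in> B" for x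
  proof -
    obtain u v where uv: "u \<in> B" "v \<in> B" "R u v" "u + v = x" using sum[OF x] by metis
    then have "R (u + v) (v + u)" using add swap by blast
    then show ?thesis using uv add_comm_B by metis
  qed
  have left: "R x 0" if x: "x \<in> B" for x
  proof -
    obtain u v where uv: "u \<in> B" "v \<in> B" "R u v" "u + v = x" using sum[OF x] by metis
    then have "R (u + v) (v + v)" using add diag by blast
    then show ?thesis using uv by (simp add: invol_B)
  qed
  have "R (y0 + 0) (0 + y1)" using add[OF left[OF y(1)] swap[OF left[OF y(2)]]] y by simp
  then have "R y0 y1" by simp
  then show ?thesis using that unfolding R_def by blast
qed

text \<open>By \<open>sec_class\<close>, the class in \<open>B\<close> of the section at 1 is
  governed by \<open>y1\<close> and its activity by \<open>y0\<close>, and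
  \<open>dense_pairs\<close> lets both be chosen independently.\<close>

lemma dense_sec1: "dense K \<Longrightarrow> dense (sec1 K)"
  unfolding dense_def[of "sec1 K"]
proof (intro conjI allI ballI)
  assume K: "dense K"
  then show "sgp (sec1 K)" "sec1 K \<subseteq> G" by (auto simp: dense_def sgp_sec1 sec1_subset_G[THEN subsetD])
  fix e x assume "x \<in> B"
  then obtain y1 where y1: "y1 \<in> B" "x = sec True y1" using sec_True_image_B by blast
  obtain x0 where "x0 \<in> B" "om x0" using B_nontrivial eq_0_if_not_om rpow_in_B by metis
  moreover have "\<not> om 0" by (simp add: om_def)
  ultimately obtain y0 where "y0 \<in> B" "om y0 = e" by (cases e) (use zero_B in blast)+
  with dense_pairs[OF K _ y1(1)] y1 show "\<exists>g\<in>sec1 K. active g = e \<and> vec g = x"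
    by (metis sec1I)
qed

end

section \<open>Minimal words\<close>

text \<open>Any two letters of \<open>B\<close> are separated by an \<open>s\<close>, so the letters
  can exceed the occurrences of \<open>s\<close> by one only, and then the word begins with a
  letter.\<close>

lemma word_without_adjacent_letters:
  assumes "\<And>u x y v. w \<noteq> u @ Some x # Some y # v"
  shows "nV w \<le> nA w + (if w \<noteq> [] \<and> hd w \<noteq> None then 1 else 0)"
  using assms
proof (induction w)
  case (Cons l w)
  have "w \<noteq> u @ Some x # Some y # v" for u x y v
    using Cons.prems[of "l # u"] by simp
  note IH = Cons.IH[OF this]
  show ?case
  proof (cases l)
    case None
    then show ?thesis using IH by (auto split: if_splits)
  next
    case (Some x)
    have "w = [] \<or> hd w = None"
      using Cons.prems[of "[]" x] Some by (cases w; cases "hd w") auto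
    then show ?thesis using IH Some by (auto split: if_splits)
  qed
qed simp

lemma nA_rev [simp]: "nA (rev w) = nA w" and nV_rev [simp]: "nV (rev w) = nV w"
  by (simp_all add: nA_def nV_def rev_filter[symmetric])

text \<open>A word with more letters from \<open>B\<close> than occurrences of \<open>s\<close> can be shortened cyclically.\<close>

lemma cyclic_merge_cases:
  assumes "nA w < nV w"
  obtains u x y v where "w = u @ Some x # Some y # v"
  | x where "w = [Some x]"
  | x u y where "w = Some x # u @ [Some y]"
proof (cases "\<exists>u x y v. w = u @ Some x # Some y # v")
  case True
  then show ?thesis using that(1) by blast
next
  case False
  then have "nV w \<le> nA w + (if w \<noteq> [] \<and> hd w \<noteq> None then 1 else 0)"
    by (intro word_without_adjacent_letters) blast
  then obtain x w' where w: "w = Some x # w'" using assms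
    by (cases w; cases "hd w") (auto split: if_splits)
  \<comment> \<open>The reversed word has no adjacent letters either, so the same bound shows that
    \<open>w\<close> also ends with a letter.\<close>
  have "rev w \<noteq> u @ Some x # Some y # v" for u x y v
  proof
    assume "rev w = u @ Some x # Some y # v"
    then have "w = rev (u @ Some x # Some y # v)" by (metis rev_rev_ident)
    then have "w = rev v @ Some y # Some x # rev u" by simp
    then show False using False by blast
  qed
  from word_without_adjacent_letters[OF this] have "rev w \<noteq> []" "hd (rev w) \<noteq> None"
    using assms by (auto split: if_splits)
  then have l: "w \<noteq> []" "last w \<noteq> None" by (simp_all add: hd_rev)
  show ?thesis
  proof (cases "w' = []")
    case True
    then show ?thesis using that(2) w by blast
  next
    case False
    then have "w = Some x # butlast w' @ [last w']" using w by simp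
    moreover obtain y where "last w' = Some y" using l w False by auto
    ultimately show ?thesis using that(3) by metis
  qed
qed

lemma nV_0_iff: "nV w = 0 \<longleftrightarrow> (\<forall>l\<in>set w. l = None)"
  by (auto simp: nV_def filter_empty_conv)

lemma ev_replicate_None:
  assumes "s + s = 0" "nV w = 0"
  shows "ev s w = 0 \<or> ev s w = s"
  using assms(2)
proof (induction w)
  case (Cons l w)
  then show ?case using assms(1) by (cases l) auto
qed simp

text \<open>Used to turn a comparison of letter counts into a statement about every single
  letter.\<close>

lemma filter_length_le_imp:
  assumes "\<And>l. Q l \<Longrightarrow> P l" "length (filter P w) \<le> length (filter Q w)" "l \<in> set w" "P l"
  shows "Q l"
  using assms(2-4)
proof (induction w)
  case (Cons k w)
  have "length (filter Q w) \<le> length (filter P w)" for w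
    by (induction w) (use assms(1) in auto)
  from this[of w] show ?case using Cons assms(1) by (auto split: if_splits)
qed simp

context sunic_group
begin

lemma ev_in_B: "valid w \<Longrightarrow> nA w = 0 \<Longrightarrow> ev s w \<in> B"
proof (induction w)
  case (Cons l w)
  then show ?case by (cases l) (auto simp: add_B)
qed simp

lemma active_ev: "active s \<Longrightarrow> valid w \<Longrightarrow> active (ev s w) = odd (nA w)"
proof (induction w)
  case (Cons l w)
  then show ?case by (cases l) (auto simp: inactive_B)
qed simp

lemma sec_ev_a: "valid w \<Longrightarrow> sec c (ev aT w) = ev aT (wsec c w)"
proof (induction w)
  case (Cons l w)
  have v: "valid w" using Cons.prems by (cases l) auto
  show ?case
  proof (cases l)
    case (Some x)
    then have x: "x \<in> B" using Cons.prems by simp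
    show ?thesis using Some Cons.IH[OF v] x active_ev[OF active_a v]
      by (cases "c \<noteq> odd (nA w)") (simp_all add: sec_False_B)
  qed (use Cons.IH[OF v] in simp)
qed simp

text \<open>Take a word for an element of \<open>C\<close> with the least number of letters of
  \<open>B\<close>. Cyclic merging would shorten it if it had more letters than occurrences of
  \<open>a\<close>. If its element were inactive, a section in \<open>C\<close> would keep all
  letters and contain no \<open>a\<close>, hence lie in \<open>B\<close>. So the element is active,
  and \<open>sq w\<close>, a word for the section of its square, again has the least number of
  letters. The occurrences of \<open>a\<close> in \<open>sq w\<close> count the letters of
  \<open>w\<close> outside the kernel of omega; as they are at least as many as the letters, every
  letter is outside the kernel. Since the letters of \<open>sq w\<close> are the rho-images of those
  of \<open>w\<close>, iteration covers whole orbits.\<close>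

lemma minimal_letters:
  assumes CG: "C \<subseteq> G" and ne: "C \<noteq> {}"
    and cj: "\<And>g h. g \<in> C \<Longrightarrow> h \<in> G \<Longrightarrow> - h + g + h \<in> C"
    and nB: "\<And>x. x \<in> B \<Longrightarrow> x \<notin> C" and na: "aT \<notin> C"
    and ina: "\<And>g. g \<in> C \<Longrightarrow> \<not> active g \<Longrightarrow> \<exists>c. sec c g \<in> C"
    and act: "\<And>g. g \<in> C \<Longrightarrow> active g \<Longrightarrow> sec False g + sec True g \<in> C"
  obtains w x where "valid w" "ev aT w \<in> C" "Some x \<in> set w"
    "\<And>x j. Some x \<in> set w \<Longrightarrow> om (rpow j x)"
proof -
  define P where "P n \<longleftrightarrow> (\<exists>w. valid w \<and> ev aT w \<in> C \<and> nV w = n)" for n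
  obtain g where "g \<in> C" using ne by blast
  then have "\<exists>n. P n" using CG by (auto simp: P_def gen_def)
  define n where "n = (LEAST n. P n)"
  have Pn: "P n" unfolding n_def using \<open>\<exists>n. P n\<close> by (rule LeastI_ex)
  have min: "n \<le> nV w" if "valid w" "ev aT w \<in> C" for w
    unfolding n_def by (rule Least_le) (use that in \<open>auto simp: P_def\<close>)
  have bal: "nV w \<le> nA w" if w: "valid w" "ev aT w \<in> C" "nV w = n" for w
  proof (rule ccontr)
    assume "\<not> nV w \<le> nA w"
    then have "nA w < nV w" by simp
    then show False
    proof (cases rule: cyclic_merge_cases)
      case (1 u x y v)
      then have "valid (u @ Some (x + y) # v)" "ev aT (u @ Some (x + y) # v) \<in> C"
        using w by (auto simp: add_B)
      from min[OF this] show False using 1 w by simp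
    next
      case (2 x)
      then show False using w nB by simp
    next
      case (3 x u y)
      have "- x + ev aT w + x \<in> C" using w 3 by (intro cj) (auto simp: G_B)
      then have "valid (u @ [Some (y + x)])" "ev aT (u @ [Some (y + x)]) \<in> C"
        using w 3 by (auto simp: add_B)
      from min[OF this] show False using 3 w by simp
    qed
  qed
  have acv: "active (ev aT w)" if w: "valid w" "ev aT w \<in> C" "nV w = n" for w
  proof (rule ccontr)
    assume "\<not> active (ev aT w)"
    with ina w obtain c where c: "ev aT (wsec c w) \<in> C" by (metis sec_ev_a)
    with min valid_wsec w have "n \<le> nV (wsec c w)" by blast
    then have "nA (wsec c w) = 0" using nV_nA_wsec[of c w] w by simp
    then show False using c nB ev_in_B valid_wsec w by metis
  qed
  define sq where "sq w = wsec False w @ wsec True w" for w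
  have sq: "valid (sq w)" "ev aT (sq w) \<in> C" "nV (sq w) = n" if w: "valid w" "ev aT w \<in> C" "nV w = n" for w
    using w act[OF w(2) acv[OF w]] nV_wsec_split[of w] by (auto simp: sq_def valid_wsec sec_ev_a)
  have letters: "om (rpow j x)" if w: "valid w" "ev aT w \<in> C" "nV w = n" "Some x \<in> set w" for w x j
    using w
  proof (induction j arbitrary: w x)
    case 0
    have "nV w \<le> nA (sq w)" using bal[OF sq[OF 0(1-3)]] sq[OF 0(1-3)] 0 by simp
    then have "length (filter (\<lambda>l. l \<noteq> None) w) \<le> length (filter (\<lambda>l. \<exists>x. l = Some x \<and> om x) w)"
      using nA_wsec_split[of w] by (simp add: sq_def nV_def)
    from filter_length_le_imp[OF _ this 0(4)] show ?case by auto
  next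
    case (Suc j)
    have "Some (sec True x) \<in> set (sq w)"
      using Some_in_wsec[of "sec True x" w] Suc.prems by (auto simp: sq_def)
    from Suc.IH[OF sq[OF Suc.prems(1-3)] this] show ?case by (simp add: rpow_Suc)
  qed
  obtain w where w: "valid w" "ev aT w \<in> C" "nV w = n" using Pn by (auto simp: P_def)
  have "nV w \<noteq> 0"
  proof
    assume "nV w = 0"
    then have "ev aT w = 0 \<or> ev aT w = aT" by (intro ev_replicate_None) auto
    then show False using w nB[OF zero_B] na by auto
  qed
  then obtain x where "Some x \<in> set w" by (auto simp: nV_0_iff)
  then show ?thesis using that[OF w(1,2)] letters[OF w] by blast
qed

end

section \<open>Integer multiples\<close>

definition zmul :: "int \<Rightarrow> taut \<Rightarrow> taut" where
  "zmul i g = (if 0 \<le> i then ((+) g ^^ nat i) 0 else - ((+) g ^^ nat (- i)) 0)"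

lemma zmul_0 [simp]: "zmul 0 g = 0" by (simp add: zmul_def)

lemma zmul_Suc: "zmul (i + 1) g = g + zmul i g"
proof (cases "0 \<le> i")
  case True
  then have "nat (i + 1) = Suc (nat i)" by simp
  then show ?thesis using True by (simp add: zmul_def)
next
  case False
  define n where "n = nat (- (i + 1))"
  have c: "((+) g ^^ n) 0 + g = g + ((+) g ^^ n) 0" by (induction n) simp_all
  have n: "nat (- i) = Suc n" using False by (simp add: n_def)
  have "zmul i g = - (((+) g ^^ n) 0 + g)" using False n c by (simp add: zmul_def del: taut_minus_add)
  then have "g + zmul i g = - ((+) g ^^ n) 0" by simp
  also have "\<dots> = zmul (i + 1) g"
    using False by (cases "i = - 1") (auto simp: zmul_def n_def)
  finally show ?thesis by simp
qed

lemma zmul_add: "zmul (i + j) g = zmul i g + zmul j g"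
proof (induction i rule: int_induct[where k = 0])
  case (step1 i)
  then show ?case using zmul_Suc[of "i + j" g] zmul_Suc[of i g] by (simp add: algebra_simps)
next
  case (step2 i)
  have "g + zmul (i - 1 + j) g = zmul (i + j) g" using zmul_Suc[of "i - 1 + j" g] by simp
  also have "\<dots> = g + (zmul (i - 1) g + zmul j g)" using step2 zmul_Suc[of "i - 1" g] by simp
  finally show ?case by simp
qed simp

lemma zmul_1 [simp]: "zmul 1 g = g" using zmul_Suc[of 0 g] by simp

lemma zmul_minus: "zmul (- i) g = - zmul i g"
  using zmul_add[of "- i" i g] by (simp add: minus_unique eq_neg_iff_add_eq_0)

lemma zmul_mult: "zmul (i * j) g = zmul i (zmul j g)"
proof (induction i rule: int_induct[where k = 0])
  case (step1 i)
  then show ?case using zmul_add[of j "i * j" g] zmul_Suc[of i "zmul j g"] by (simp add: algebra_simps)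
next
  case (step2 i)
  have "zmul j g + zmul ((i - 1) * j) g = zmul (i * j) g"
    using zmul_add[of j "(i - 1) * j" g] by (simp add: algebra_simps)
  also have "\<dots> = zmul j g + zmul (i - 1) (zmul j g)" using step2 zmul_Suc[of "i - 1" "zmul j g"] by simp
  finally show ?case by simp
qed simp

lemma zmul_in_sgp: "sgp K \<Longrightarrow> g \<in> K \<Longrightarrow> zmul i g \<in> K"
proof (induction i rule: int_induct[where k = 0])
  case (step1 i)
  then show ?case by (simp add: zmul_Suc sgp_add)
next
  case (step2 i)
  then show ?case using zmul_Suc[of "i - 1" g] by (metis diff_add_cancel sgp_add_left)
qed (simp add: sgp_0)

lemma zmul_conj: "zmul i (h + g + - h) = h + zmul i g + - h"
proof (induction i rule: int_induct[where k = 0])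
  case (step1 i)
  then show ?case by (simp add: zmul_Suc)
next
  case (step2 i)
  have "h + g + - h + zmul (i - 1) (h + g + - h) = zmul i (h + g + - h)"
    using zmul_Suc[of "i - 1" "h + g + - h"] by simp
  also have "\<dots> = h + g + - h + (h + zmul (i - 1) g + - h)"
    using step2 zmul_Suc[of "i - 1" g] by simp
  finally show ?case by (metis add_left_cancel taut_assoc)
qed simp

section \<open>Elements of infinite order\<close>

definition torsion :: "taut \<Rightarrow> bool" where
  "torsion g \<longleftrightarrow> (\<exists>n>0. zmul n g = 0)"

lemma torsion_conj: "torsion (h + g + - h) \<longleftrightarrow> torsion g"
proof -
  have "h + x + - h = 0 \<longleftrightarrow> x = 0" for x
    by (metis add.right_neutral add_0_left add.right_inverse minus_add_cancel taut_assoc)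
  then show ?thesis unfolding torsion_def zmul_conj by simp
qed

lemma torsion_involution: "g + g = 0 \<Longrightarrow> torsion g"
  unfolding torsion_def using zmul_Suc[of 1 g] by (intro exI[of _ 2]) simp

lemma torsion_double: "torsion (g + g) \<Longrightarrow> torsion g"
proof -
  assume "torsion (g + g)"
  then obtain n where "n > 0" "zmul n (g + g) = 0" by (auto simp: torsion_def)
  moreover have "g + g = zmul 2 g" using zmul_Suc[of 1 g] by simp
  ultimately have "zmul (n * 2) g = 0" by (simp add: zmul_mult)
  with \<open>n > 0\<close> show ?thesis unfolding torsion_def by (intro exI[of _ "n * 2"]) simp
qed

lemma zmul_pr: "zmul i (pr u v) = pr (zmul i u) (zmul i v)"
proof (induction i rule: int_induct[where k = 0])
  case (step1 i)
  then show ?case by (simp add: zmul_Suc pr_add)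
next
  case (step2 i)
  have "pr u v + zmul (i - 1) (pr u v) = pr u v + pr (zmul (i - 1) u) (zmul (i - 1) v)"
    using zmul_Suc[of "i - 1" "pr u v"] zmul_Suc[of "i - 1" u] zmul_Suc[of "i - 1" v] step2
    by (simp add: pr_add)
  then show ?case by simp
qed simp

lemma torsion_pr: "torsion u \<Longrightarrow> torsion v \<Longrightarrow> torsion (pr u v)"
proof -
  assume "torsion u" "torsion v"
  then obtain i j where ij: "i > 0" "zmul i u = 0" "j > 0" "zmul j v = 0" by (auto simp: torsion_def)
  have z: "zmul n 0 = 0" for n using zmul_in_sgp[of "{0}" 0 n] by (simp add: sgp_def)
  have "zmul (i * j) (pr u v) = 0"
    using ij z zmul_mult[of j i u] zmul_mult[of i j v] by (simp add: zmul_pr mult.commute)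
  then show ?thesis using ij unfolding torsion_def by (intro exI[of _ "i * j"]) simp
qed

context sunic_group
begin

text \<open>Repeatedly squaring and passing to sections, a shortest element of infinite order must
  have letters which are invariant under \<^term>\<open>sec True\<close>.\<close>

lemma fixed_element_if_not_torsion:
  assumes "g \<in> G" "\<not> torsion g"
  obtains b where "b \<in> B" "om b" "sec True b = b"
proof -
  define C where "C = {g \<in> G. \<not> torsion g}"
  obtain w x where w: "valid w" "ev aT w \<in> C" "Some x \<in> set w" "\<And>x j. Some x \<in> set w \<Longrightarrow> om (rpow j x)"
  proof (rule minimal_letters[of C])
    show "- h + g + h \<in> C" if "g \<in> C" "h \<in> G" for g h
      using that torsion_conj[of "- h" g] by (simp add: C_def G_add G_minus)
    show "x \<notin> C" if "x \<in> B" for x using torsion_involution invol_B that by (auto simp: C_def)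
    show "aT \<notin> C" using torsion_involution[of aT] by (auto simp: C_def)
    show "\<exists>c. sec c g \<in> C" if "g \<in> C" "\<not> active g" for g
      using torsion_pr[of "sec False g" "sec True g"] pr_eta[of g] that sec_in_G by (auto simp: C_def)
    show "sec False g + sec True g \<in> C" if "g \<in> C" "active g" for g
    proof -
      let ?u = "sec False g + sec True g" and ?v = "sec True g + sec False g"
      \<comment> \<open>The square has the sections \<open>?v\<close> and \<open>?u\<close>, which
        are conjugate to each other.\<close>
      have tt: "torsion (g + g)" if "torsion ?u"
      proof -
        have "torsion ?v" using that torsion_conj[of "sec True g" ?u] by simp
        then have "torsion (pr ?v ?u)" using that torsion_pr by blast
        moreover have "g + g = pr ?v ?u" by (rule taut_eqI) (use \<open>active g\<close> in auto)
        ultimately show ?thesis by simp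
      qed
      have "\<not> torsion g" using that by (simp add: C_def)
      then have "\<not> torsion ?u" using torsion_double[OF tt] by blast
      moreover have "?u \<in> G" using that by (intro G_add sec_in_G) (auto simp: C_def)
      ultimately show ?thesis by (simp add: C_def)
    qed
    show "C \<subseteq> G" "C \<noteq> {}" using assms by (auto simp: C_def)
  qed (rule that; assumption)
  have x: "x \<in> B" using w by (auto simp: valid_def)
  \<comment> \<open>Omega is nonzero along the whole orbit of \<open>x\<close>, hence also along
    that of its rho-image, so it vanishes along the orbit of their sum.\<close>
  have "\<not> om (rpow j (x + sec True x))" for j
  proof -
    have "om (rpow j x)" "om (rpow j (sec True x))"
      using w(4)[OF w(3), of j] w(4)[OF w(3), of "Suc j"] by (auto simp: rpow_Suc)
    then show ?thesis using x by (simp add: rpow_add rho_B om_add)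
  qed
  then have "x + sec True x = 0" using eq_0_if_not_om add_B rho_B x by blast
  then have "sec True x = x" using x by (metis cancel_B add.right_neutral)
  moreover have "om x" using w(4)[OF w(3), of 0] by simp
  ultimately show ?thesis using that x by blast
qed

end

section \<open>The dihedral subgroup and the subgroups \<open>H(k)\<close>\<close>

locale sunic_b = sunic_group +
  fixes b :: taut
  assumes b_B [simp]: "b \<in> B" and om_b: "om b" and rho_b: "sec True b = b"
begin

lemma sec_b [simp]: "sec True b = b" "sec False b = aT"
  using rho_b om_b by (simp_all add: sec_False_B)

lemma active_b [simp]: "\<not> active b" by (simp add: inactive_B)

lemma b_b [simp]: "b + b = 0" by (simp add: invol_B)

lemma b_neq_0 [simp]: "b \<noteq> 0" using sec_b(2) by force

definition rot :: "int \<Rightarrow> taut" where "rot i = zmul i (aT + b)"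

lemma rot_0 [simp]: "rot 0 = 0" by (simp add: rot_def)

lemma rot_1: "rot 1 = aT + b" by (simp add: rot_def)

lemma rot_rot [simp]: "rot i + rot j = rot (i + j)" "rot i + (rot j + g) = rot (i + j) + g"
proof -
  show "rot i + rot j = rot (i + j)" by (simp add: rot_def zmul_add)
  then show "rot i + (rot j + g) = rot (i + j) + g" by (metis taut_assoc)
qed

lemma minus_rot [simp]: "- rot i = rot (- i)" by (simp add: rot_def zmul_minus)

lemma b_rot [simp]: "b + rot i = rot (- i) + b" "b + (rot i + g) = rot (- i) + (b + g)"
proof -
  have e: "b + (aT + b) + b = - (aT + b)" by simp
  have "b + rot i + b = rot (- i)"
  proof -
    have "b + zmul i (aT + b) + - b = zmul i (b + (aT + b) + - b)" by (rule zmul_conj[symmetric])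
    also have "b + (aT + b) + - b = - (aT + b)" using e by simp
    also have "zmul i (- (aT + b)) = zmul (- i) (aT + b)"
      using zmul_mult[of i "- 1" "aT + b"] zmul_minus[of 1 "aT + b"] by simp
    finally show ?thesis by (simp add: rot_def)
  qed
  then show "b + rot i = rot (- i) + b"
    by (metis add.right_neutral b_b taut_assoc)
  then show "b + (rot i + g) = rot (- i) + (b + g)" by (metis taut_assoc)
qed

lemma a_eq: "aT = rot 1 + b" by (simp add: rot_1)

lemma active_rot [simp]: "active (rot i) = odd i"
proof (induction i rule: int_induct[where k = 0])
  case (step1 i)
  have "rot (i + 1) = rot i + rot 1" by simp
  then show ?case using step1 by (simp add: rot_1 del: rot_rot)
next
  case (step2 i)
  have "active (rot i) = (active (rot (i - 1)) \<noteq> active (rot 1))"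
    using active_add[of "rot (i - 1)" "rot 1"] by simp
  moreover have "active (rot 1)" by (simp add: rot_1)
  ultimately show ?case using step2 by simp
qed simp

text \<open>The square of \<open>ab\<close> has the sections \<open>ba\<close> and
  \<open>ab\<close>. So sections at 1 halve even indices, and the section of
  \<open>rot (2 * k)\<close> recovers \<open>rot k\<close>.\<close>

lemma sec_rot_even [simp]: "sec True (rot (2 * i)) = rot i" "sec False (rot (2 * i)) = rot (- i)"
proof -
  have "rot 2 = rot 1 + rot 1" by simp
  also have "\<dots> = aT + (b + (aT + b))" by (simp only: rot_1 taut_assoc)
  finally have r2: "rot 2 = aT + (b + (aT + b))" .
  have "rot (- 1) = - rot 1" by simp
  also have "\<dots> = b + aT" by (simp only: rot_1 taut_minus_add minus_a minus_B[OF b_B])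
  finally have "rot (- 1) = b + aT" .
  then have "rot 2 = pr (rot (- 1)) (rot 1)"
    unfolding r2 rot_1 by (auto intro: taut_eqI[of "aT + (b + (aT + b))"])
  moreover have "rot (2 * i) = zmul i (rot 2)" by (simp add: rot_def zmul_mult mult.commute)
  ultimately have "rot (2 * i) = pr (zmul i (rot (- 1))) (zmul i (rot 1))" by (simp add: zmul_pr)
  moreover have "zmul i (rot (- 1)) = rot (- i)" "zmul i (rot 1) = rot i"
    using zmul_mult[of i "- 1" "aT + b"] by (simp_all add: rot_def)
  ultimately show "sec True (rot (2 * i)) = rot i" "sec False (rot (2 * i)) = rot (- i)" by simp_all
qed

lemma sec_rot_minus_even [simp]: "sec True (rot (- (2 * i))) = rot (- i)"
  "sec False (rot (- (2 * i))) = rot i"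
  using sec_rot_even[of "- i"] by simp_all

lemma sec_rot_odd: "sec True (rot (2 * i + 1)) = rot (- i) + b"
  "sec False (rot (2 * i + 1)) = rot (i + 1) + b"
proof -
  have r: "rot (2 * i + 1) = rot (2 * i) + rot 1" by simp
  show "sec True (rot (2 * i + 1)) = rot (- i) + b"
    unfolding r sec_add by (simp add: rot_1)
  have "sec False (rot (2 * i + 1)) = rot i + aT"
    unfolding r sec_add by (simp add: rot_1)
  then show "sec False (rot (2 * i + 1)) = rot (i + 1) + b" by (simp add: a_eq)
qed

text \<open>Descent: a trivial rotation is inactive, so its index is even, and its section at 1 is
  the rotation by half the index.\<close>

lemma rot_eq_0_iff [simp]: "rot i = 0 \<longleftrightarrow> i = 0"
proof
  show "i = 0" if "rot i = 0"
    using that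
  proof (induction "nat \<bar>i\<bar>" arbitrary: i rule: less_induct)
    case less
    have "even i" using less.prems active_rot[of i] by simp
    then obtain j where j: "i = 2 * j" by blast
    then have "rot j = 0" using less.prems sec_rot_even(1)[of j] by simp
    then show ?case using less.hyps[of j] j by (cases "j = 0") (auto simp: abs_mult)
  qed
qed simp

lemma rot_eq_iff [simp]: "rot i = rot j \<longleftrightarrow> i = j"
proof
  assume "rot i = rot j"
  then have "rot (i + - j) = 0" by (metis add.right_inverse minus_rot rot_rot(1))
  then show "i = j" by simp
qed simp

lemma rot_in_sgp: "sgp K \<Longrightarrow> rot i \<in> K \<Longrightarrow> rot (i * j) \<in> K"
  using zmul_in_sgp[of K "rot i" j] by (simp add: rot_def zmul_mult[symmetric] mult.commute)

lemma rot_in_G [simp]: "rot i \<in> G"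
  using rot_in_sgp[OF sgp_G, of 1 i] G_add[OF G_a G_B[OF b_B]] by (simp add: rot_1)

lemma b_in_G [simp]: "b \<in> G" by (simp add: G_B)

lemma vec_rot: "vec (rot i) = (if odd i then b else 0)"
proof -
  have 1: "vec (rot 1) = b" by (simp add: rot_1 vec_add G_a)
  have 2: "vec (rot (2 * j)) = 0" for j
  proof -
    have "rot (2 * j) = rot j + rot j" by simp
    then show ?thesis using vec_add[of "rot j" "rot j"] vec_in_B[of "rot j"]
      by (simp add: invol_B del: rot_rot)
  qed
  show ?thesis
  proof (cases "odd i")
    case True
    then obtain j where "i = 2 * j + 1" by (elim oddE)
    then have "rot i = rot (2 * j) + rot 1" by simp
    then show ?thesis using 1 2[of j] vec_add[of "rot (2 * j)" "rot 1"] True by simp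
  next
    case False
    then obtain j where "i = 2 * j" by blast
    then show ?thesis using 2 by simp
  qed
qed

text \<open>Equality would force \<open>i\<close> and \<open>j\<close> to have the same parity
  because of \<open>active\<close>, and then the classes \<open>vec\<close> differ by
  \<open>b\<close>.\<close>

lemma rot_neq_rot_b [simp]: "rot i \<noteq> rot j + b" "rot j + b \<noteq> rot i"
proof -
  have "rot i \<noteq> rot j + b"
  proof
    assume e: "rot i = rot j + b"
    have "active (rot i) = active (rot j + b)" by (simp only: e)
    then have "odd i = odd j" by simp
    moreover have "vec (rot i) = vec (rot j) + b" using e by (simp add: vec_add)
    ultimately show False by (auto simp: vec_rot split: if_splits)
  qed
  then show "rot i \<noteq> rot j + b" "rot j + b \<noteq> rot i" by metis+
qed

text \<open>The subgroup generated by \<open>(ab)^k\<close> and \<open>b\<close>, given by the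
  normal forms of its elements so that membership becomes a divisibility.\<close>

definition D :: "int \<Rightarrow> taut set" where
  "D k = {rot (k * i) | i. True} \<union> {rot (k * i) + b | i. True}"

lemma rot_in_D: "rot i \<in> D k \<longleftrightarrow> k dvd i"
  by (auto simp: D_def)

lemma rot_b_in_D: "rot i + b \<in> D k \<longleftrightarrow> k dvd i"
  by (auto simp: D_def dest: add_right_imp_eq)

lemma D_cases:
  assumes "g \<in> D k"
  obtains i where "k dvd i" "g = rot i" | i where "k dvd i" "g = rot i + b"
proof -
  from assms obtain i where "g = rot (k * i) \<or> g = rot (k * i) + b" unfolding D_def by blast
  then show ?thesis using that[of "k * i"] by auto
qed

lemma sgp_D: "sgp (D k)"
proof (rule sgpI)
  show "0 \<in> D k" using rot_in_D[of 0 k] by simp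
  show "g + h \<in> D k" if "g \<in> D k" "h \<in> D k" for g h
    using that(1)
  proof (cases rule: D_cases)
    case (1 i)
    from that(2) show ?thesis
      by (cases rule: D_cases) (use 1 in \<open>auto simp: rot_in_D rot_b_in_D\<close>)
  next
    case (2 i)
    from that(2) show ?thesis
      by (cases rule: D_cases) (use 2 in \<open>auto simp: rot_in_D rot_b_in_D\<close>)
  qed
  show "- g \<in> D k" if "g \<in> D k" for g
    using that by (cases rule: D_cases) (auto simp: rot_in_D rot_b_in_D)
qed

lemma a_in_D1: "aT \<in> D 1" and b_in_D: "b \<in> D k" and rot_in_D1: "rot i \<in> D 1"
  using rot_b_in_D[of 0 k] by (auto simp: a_eq rot_in_D rot_b_in_D)

lemma D_subset_G: "D k \<subseteq> G" by (auto elim!: D_cases intro: G_add)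

lemma sec_in_D1: "g \<in> D 1 \<Longrightarrow> sec c g \<in> D 1"
proof -
  have r: "sec c (rot i) \<in> D 1" for c i
  proof (cases "even i")
    case True
    then show ?thesis by (elim evenE) (cases c; simp add: rot_in_D)
  next
    case False
    then show ?thesis by (elim oddE) (cases c; simp add: sec_rot_odd rot_b_in_D)
  qed
  assume "g \<in> D 1"
  then show ?thesis
  proof (cases rule: D_cases)
    case (2 i)
    then show ?thesis using r by (cases c) (auto simp: b_in_D a_in_D1 sgp_add[OF sgp_D])
  qed (use r in simp)
qed

lemma B_Int_D:
  assumes "x \<in> B" "x \<in> D 1"
  shows "x = 0 \<or> x = b"
  using assms(2)
proof (cases rule: D_cases)
  case (1 i)
  then have "even i" using assms inactive_B by fastforce
  then have "vec x = 0" using 1 by (simp add: vec_rot)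
  then show ?thesis using assms by simp
next
  case (2 i)
  then have "even i" using assms inactive_B by fastforce
  then have "vec x = b" using 2 by (simp add: vec_rot vec_add)
  then show ?thesis using assms by simp
qed

text \<open>As a generator of \<open>H k\<close>, the involution \<open>(ab)^k b\<close> replaces
  \<open>(ab)^k\<close>, so words need no inverses. For \<open>k = 1\<close> it is \<open>a\<close>,
  which makes \<open>G\<close> the case \<open>H 1\<close>.\<close>

definition sref :: "int \<Rightarrow> taut" where "sref k = rot k + b"

definition H :: "int \<Rightarrow> taut set" where "H k = gen (sref k)"

lemma sref_sref: "sref k + sref k = 0" by (simp add: sref_def)

lemma sref_1: "sref 1 = aT" by (simp add: sref_def a_eq)

lemma H_1: "H 1 = G" by (simp add: H_def sref_1)

lemma sgp_H: "sgp (H k)" by (simp add: H_def sgp_gen sref_sref)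

lemma B_subset_H: "B \<subseteq> H k" by (auto simp: H_def B_in_gen)

lemma sref_in_H: "sref k \<in> H k" by (simp add: H_def s_in_gen)

lemma rot_in_H: "k dvd i \<Longrightarrow> rot i \<in> H k"
proof -
  have "sref k + b \<in> H k" by (intro sgp_add[OF sgp_H] sref_in_H subsetD[OF B_subset_H] b_B)
  then have "rot k \<in> H k" by (simp add: sref_def)
  then show "k dvd i \<Longrightarrow> rot i \<in> H k" using rot_in_sgp[OF sgp_H] by (elim dvdE) simp
qed

lemma D_subset_H: "D k \<subseteq> H k"
  by (auto elim!: D_cases intro!: rot_in_H sgp_add[OF sgp_H] subsetD[OF B_subset_H b_B])

lemma H_subset: "sgp K \<Longrightarrow> rot k \<in> K \<Longrightarrow> B \<subseteq> K \<Longrightarrow> H k \<subseteq> K"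
  unfolding H_def using subsetD[OF _ b_B, of K] by (intro gen_subset) (auto simp: sref_def sgp_add)

lemma H_mono: "j dvd k \<Longrightarrow> H k \<subseteq> H j"
  by (rule H_subset) (auto simp: sgp_H rot_in_H B_subset_H)

lemma H_subset_G: "H k \<subseteq> G"
  using H_mono[of 1 k] by (simp add: H_1)

lemma dense_H: "odd k \<Longrightarrow> dense (H k)"
  by (rule denseI[of _ "sref k"])
    (auto simp: sgp_H sref_in_H B_subset_H H_subset_G[THEN subsetD], auto simp: sref_def vec_add vec_rot)

text \<open>The sections of the elements of \<open>H(k)\<close> at 0 have to be conjugated by a rotation.\<close>

definition kap :: "int \<Rightarrow> bool \<Rightarrow> taut" where
  "kap k c = (if c then 0 else rot (- (k div 2)))"

text \<open>For \<open>k = 2 * i + 1\<close> the sections at 0 and 1 are \<open>rot i\<close> and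
  \<open>rot (- i)\<close>. Written as differences of \<open>kap\<close>, they telescope along a
  word in \<open>sec_ev\<close>.\<close>

lemma sec_sref: "odd k \<Longrightarrow> sec c (sref k) = kap k (\<not> c) + - kap k c"
proof (elim oddE)
  fix i assume k: "k = 2 * i + 1"
  show ?thesis unfolding k sref_def
    by (cases c) (simp_all add: kap_def sec_rot_odd, simp add: a_eq)
qed

lemma active_sref [simp]: "active (sref k) = odd k"
  by (simp add: sref_def)

lemma kap_sref: "odd k \<Longrightarrow> kap k False + sref k + - kap k False = aT"
  by (elim oddE) (simp add: kap_def sref_def a_eq)

lemma sec_ev:
  assumes k: "odd k" and w: "valid w"
  shows "sec c (ev (sref k) w) = kap k (c \<noteq> odd (nA w)) + ev (sref k) (wsec c w) + - kap k c"
  using w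
proof (induction w)
  case (Cons l w)
  have v: "valid w" using Cons.prems by (cases l) auto
  have a: "active (ev (sref k) w) = odd (nA w)" using v k by (simp add: active_ev)
  show ?case
  proof (cases l)
    case None
    then show ?thesis using Cons.IH[OF v] a sec_sref[OF k] by simp
  next
    case (Some x)
    then have x: "x \<in> B" using Cons.prems by simp
    \<comment> \<open>A letter outside the kernel of omega, read at 0, contributes \<open>a\<close>,
      and this is \<open>sref k\<close> conjugated by \<open>kap k False\<close>.\<close>
    have kx: "kap k False + (sref k + g) = aT + (kap k False + g)" for g
      using kap_sref[OF k] by (metis add_left_cancel minus_add_cancel taut_assoc)
    have kT: "kap k True = 0" by (simp add: kap_def)
    show ?thesis
    proof (cases "c \<noteq> odd (nA w)")
      case True
      then show ?thesis using Some Cons.IH[OF v] a x kT by simp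
    next
      case False
      then show ?thesis using Some Cons.IH[OF v] a x kx by (auto simp: sec_False_B)
    qed
  qed
qed simp

lemma sec_in_H:
  assumes k: "odd k" and h: "h \<in> H k" "\<not> active h"
  shows "sec True h \<in> H k" "- kap k False + sec False h + kap k False \<in> H k"
proof -
  obtain w where w: "h = ev (sref k) w" "valid w" using h by (auto simp: H_def gen_def)
  then have a: "even (nA w)" using h k active_ev[of "sref k" w] by simp
  have s: "sec c h = kap k c + ev (sref k) (wsec c w) + - kap k c" for c
    using sec_ev[OF k w(2), of c] w(1) a by simp
  have "ev (sref k) (wsec c w) \<in> H k" for c
    using valid_wsec[OF w(2)] by (auto simp: H_def gen_def)
  then show "sec True h \<in> H k" "- kap k False + sec False h + kap k False \<in> H k"
    using s by (simp_all add: kap_def del: minus_rot)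
qed

text \<open>The generators are sections of elements of \<open>H k\<close>: \<open>rot k\<close>
  comes from \<open>rot (2 * k)\<close>, and rho maps \<open>B\<close> onto itself.\<close>

lemma sec1_H: "odd k \<Longrightarrow> sec1 (H k) = H k"
proof
  assume k: "odd k"
  show "sec1 (H k) \<subseteq> H k" using sec_in_H[OF k] by (auto simp: sec1_def)
  show "H k \<subseteq> sec1 (H k)"
  proof (rule H_subset)
    show "sgp (sec1 (H k))" by (simp add: sgp_sec1 sgp_H)
    show "rot k \<in> sec1 (H k)" using sec1I[OF rot_in_H, of k "2 * k"] by simp
    show "B \<subseteq> sec1 (H k)"
    proof
      fix x assume "x \<in> B"
      then obtain y where "y \<in> B" "x = sec True y" using sec_True_image_B by blast
      then show "x \<in> sec1 (H k)" using sec1I[of y "H k"] B_subset_H inactive_B by auto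
    qed
  qed
qed

text \<open>Sections at 1 strictly shorten words until only a letter remains.\<close>

lemma H_Int_D1:
  assumes k: "odd k" and "valid w" "ev (sref k) w \<in> D 1"
  shows "ev (sref k) w \<in> D k"
  using assms(2,3)
proof (induction "nV w" arbitrary: w rule: less_induct)
  case less
  have even: "ev (sref k) w \<in> D k"
    if w: "valid w" "ev (sref k) w \<in> D 1" "\<not> active (ev (sref k) w)"
      and IH: "\<And>w'. nV w' < nV w \<Longrightarrow> valid w' \<Longrightarrow> ev (sref k) w' \<in> D 1 \<Longrightarrow> ev (sref k) w' \<in> D k"
    for w
  proof -
    let ?g = "ev (sref k) w" and ?u = "wsec True w"
    have "even (nA w)" using w k active_ev[of "sref k" w] by simp
    then have s: "sec True ?g = ev (sref k) ?u" using sec_ev[OF k w(1), of True] by (simp add: kap_def)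
    have u: "ev (sref k) ?u \<in> D 1" using sec_in_D1[OF w(2), of True] s by simp
    have "ev (sref k) ?u \<in> D k"
    proof (cases "nA ?u = 0")
      case True
      then have "ev (sref k) ?u = 0 \<or> ev (sref k) ?u = b"
        using B_Int_D ev_in_B valid_wsec w(1) u by blast
      then show ?thesis using sgp_0[OF sgp_D] b_in_D by auto
    next
      case False
      then show ?thesis using IH[of ?u] nV_nA_wsec[of True w] valid_wsec[OF w(1)] u by simp
    qed
    then have Dk: "sec True ?g \<in> D k" using s by simp
    from w(2) show ?thesis
    proof (cases rule: D_cases)
      case (1 i)
      then have "even i" using w(3) by simp
      then obtain j where "i = 2 * j" by blast
      then show ?thesis using 1 Dk by (auto simp: rot_in_D)
    next
      case (2 i)
      then have "even i" using w(3) by simp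
      then obtain j where "i = 2 * j" by blast
      then show ?thesis using 2 Dk by (auto simp: rot_b_in_D)
    qed
  qed
  show ?case
  proof (cases "active (ev (sref k) w)")
    case False
    then show ?thesis using even[OF less.prems] less.hyps by blast
  next
    case True
    have r: "sref k \<in> D k" "sref k \<in> D 1" by (simp_all add: sref_def rot_b_in_D)
    \<comment> \<open>Prepending \<open>sref k\<close> makes the element inactive and adds no letter
      of \<open>B\<close>, so the measure of the induction is unchanged.\<close>
    have "ev (sref k) (None # w) \<in> D k"
    proof (rule even)
      show "valid (None # w)" using less.prems by simp
      show "ev (sref k) (None # w) \<in> D 1" using sgp_add[OF sgp_D r(2) less.prems(2)] by simp
      show "\<not> active (ev (sref k) (None # w))" using True k by simp
      show "ev (sref k) w' \<in> D k" if "nV w' < nV (None # w)" "valid w'" "ev (sref k) w' \<in> D 1" for w'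
        using less.hyps[of w'] that by simp
    qed
    then have "sref k + ev (sref k) w \<in> D k" by simp
    then show ?thesis using sgp_add_left[OF sgp_D r(1)] by simp
  qed
qed

lemma rot_in_H_iff: "odd k \<Longrightarrow> rot i \<in> H k \<longleftrightarrow> k dvd i"
proof
  assume k: "odd k" and "rot i \<in> H k"
  then obtain w where w: "valid w" "rot i = ev (sref k) w" by (auto simp: H_def gen_def)
  then show "k dvd i" using H_Int_D1[OF k w(1)] rot_in_D1[of i] rot_in_D by metis
qed (rule rot_in_H)

lemma H_neq_G: "odd k \<Longrightarrow> \<not> is_unit k \<Longrightarrow> H k \<noteq> G"
  using rot_in_H_iff[of k 1] rot_in_G[of 1] by blast

lemma H_lift_True:
  assumes "odd k" "g \<in> H k"
  obtains h where "h \<in> H k" "\<not> active h" "sec True h = g"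
proof -
  have "g \<in> sec1 (H k)" using assms sec1_H by simp
  then show ?thesis using that unfolding sec1_def by blast
qed

end

section \<open>Normal closures\<close>

text \<open>Inverses of \<open>X\<close> are not adjoined; \<open>sgp_ncl\<close> supplies them when
  \<open>X\<close> is closed under inversion.\<close>

inductive_set ncl :: "taut set \<Rightarrow> taut set \<Rightarrow> taut set" for L X where
  zero: "0 \<in> ncl L X"
| step: "x \<in> X \<Longrightarrow> g \<in> L \<Longrightarrow> h \<in> ncl L X \<Longrightarrow> (g + x + - g) + h \<in> ncl L X"

lemma ncl_add: "g \<in> ncl L X \<Longrightarrow> h \<in> ncl L X \<Longrightarrow> g + h \<in> ncl L X"
proof (induction rule: ncl.induct)
  case (step x g k)
  then show ?case using ncl.step[OF step.hyps(1,2), of "k + h"] by simp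
qed simp

lemma ncl_gen: "x \<in> X \<Longrightarrow> g \<in> L \<Longrightarrow> g + x + - g \<in> ncl L X"
  using ncl.step[OF _ _ ncl.zero] by fastforce

lemma ncl_base: "0 \<in> L \<Longrightarrow> x \<in> X \<Longrightarrow> x \<in> ncl L X"
  using ncl_gen[of x X 0 L] by simp

lemma sgp_ncl:
  assumes "\<And>x. x \<in> X \<Longrightarrow> - x \<in> X"
  shows "sgp (ncl L X)"
proof (rule sgpI)
  show "- g \<in> ncl L X" if "g \<in> ncl L X" for g
    using that
  proof (induction rule: ncl.induct)
    case (step x g h)
    have "- h + (g + - x + - g) \<in> ncl L X"
      using ncl_add[OF step.IH ncl_gen] step assms by blast
    then show ?case by simp
  qed (simp add: ncl.zero)
qed (auto simp: ncl.zero ncl_add)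

lemma ncl_conj:
  assumes "sgp L" "l \<in> L" "n \<in> ncl L X"
  shows "l + n + - l \<in> ncl L X"
  using assms(3)
proof (induction rule: ncl.induct)
  case (step x g h)
  have "(l + g + x + - (l + g)) + (l + h + - l) \<in> ncl L X"
    using ncl.step[OF step.hyps(1) sgp_add[OF assms(1,2) step.hyps(2)] step.IH] by simp
  then show ?case by simp
qed (simp add: ncl.zero)

lemma ncl_conj':
  assumes "sgp L" "l \<in> L" "n \<in> ncl L X"
  shows "- l + (n + l) \<in> ncl L X"
  using ncl_conj[OF assms(1) sgp_minus[OF assms(1,2)] assms(3)] by simp

lemma ncl_subset:
  assumes "sgp K" "\<And>x g. x \<in> X \<Longrightarrow> g \<in> L \<Longrightarrow> g + x + - g \<in> K"
  shows "ncl L X \<subseteq> K"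
proof
  fix n assume "n \<in> ncl L X"
  then show "n \<in> K"
  proof (induction rule: ncl.induct)
    case (step x g h)
    then show ?case using sgp_add[OF assms(1) assms(2)] by blast
  qed (simp add: sgp_0 assms(1))
qed

text \<open>If the fourth power of \<open>u\<close> is trivial, this writes the fourth power of
  \<open>u + d\<close> as a product of conjugates of \<open>d\<close>.\<close>

lemma four_conjugates:
  "(u + d) + (u + d) + (u + d) + (u + d) = (u + d + - u) + (u + u + d + - (u + u)) +
     (u + u + u + d + - (u + u + u)) + (u + u + u + u) + (d :: taut)"
  by simp

section \<open>Recognising \<open>H(k)\<close> by sections\<close>

text \<open>The condition says that \<open>B\<close> is larger than \<open>{0, b}\<close>; in the
  excluded case the group is dihedral (\<open>Sunic_D_inf\<close>).\<close>

locale sunic_big = sunic_b +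
  assumes ker_om: "\<exists>x\<in>B. x \<noteq> 0 \<and> \<not> om x"
begin

definition Ker :: "taut set" where "Ker = {x \<in> B. \<not> om x}"
text \<open>Elements of \<open>Ker\<close> act on the right subtree only, and \<open>P\<close>
  consists of their actions there. It is a complement of the subgroup generated by \<open>b\<close>
  in \<open>B\<close> (\<open>P_cases\<close>, \<open>b_notin_P\<close>).\<close>

definition P :: "taut set" where "P = sec True ` Ker"

lemma Ker_B: "x \<in> Ker \<Longrightarrow> x \<in> B" by (simp add: Ker_def)

lemma Ker_pr: "c \<in> Ker \<Longrightarrow> pr 0 (sec True c) = c"
  using pr_eta[of c] by (simp add: Ker_def inactive_B sec_False_B)

lemma Ker_add: "x \<in> Ker \<Longrightarrow> y \<in> Ker \<Longrightarrow> x + y \<in> Ker"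
  by (auto simp: Ker_def add_B om_add)

lemma Ker_cases: "x \<in> B \<Longrightarrow> x \<in> Ker \<or> x + b \<in> Ker"
  by (auto simp: Ker_def add_B om_add om_b)

lemma P_B: "x \<in> P \<Longrightarrow> x \<in> B" by (auto simp: P_def Ker_def rho_B)

lemma zero_P: "0 \<in> P" unfolding P_def Ker_def om_def by (intro image_eqI[of _ _ 0]) auto

lemma P_add: "x \<in> P \<Longrightarrow> y \<in> P \<Longrightarrow> x + y \<in> P"
proof -
  assume "x \<in> P" "y \<in> P"
  then obtain c d where "c \<in> Ker" "x = sec True c" "d \<in> Ker" "y = sec True d" by (auto simp: P_def)
  then show ?thesis unfolding P_def
    by (intro image_eqI[of _ _ "c + d"]) (simp_all add: Ker_B Ker_add inactive_B)
qed

text \<open>Since rho is injective and fixes \<open>b\<close>, the only preimage of \<open>b\<close>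
  is \<open>b\<close> itself, which is not in the kernel of omega.\<close>

lemma b_notin_P: "b \<notin> P"
proof
  assume "b \<in> P"
  then obtain c where c: "c \<in> Ker" "b = sec True c" by (auto simp: P_def)
  have "sec True c = sec True b" using c(2) by (metis rho_b)
  then have "c = b" using c(1) by (metis inj_onD inj_sec_True_B Ker_B b_B)
  then show False using c om_b by (simp add: Ker_def)
qed

lemma b_notin_sec_P: "b \<notin> sec True ` P"
proof
  assume "b \<in> sec True ` P"
  then obtain c where c: "c \<in> P" "b = sec True c" by auto
  have "sec True c = sec True b" using c(2) by (metis rho_b)
  then have "c = b" using c(1) by (metis inj_onD inj_sec_True_B P_B b_B)
  then show False using c b_notin_P by simp
qed

lemma P_cases: "x \<in> B \<Longrightarrow> x \<in> P \<or> x + b \<in> P"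
proof -
  assume "x \<in> B"
  then obtain y where y: "y \<in> B" "x = sec True y" using sec_True_image_B by blast
  from Ker_cases[OF y(1)] show ?thesis
  proof
    assume "y + b \<in> Ker"
    then have "sec True (y + b) \<in> P" unfolding P_def by (rule imageI)
    then show ?thesis using y by simp
  qed (use y in \<open>simp add: P_def\<close>)
qed

text \<open>Otherwise rho would map the kernel of omega into itself, and by faithfulness that kernel
  would be trivial.\<close>

lemma ex_P_om: obtains d where "d \<in> P" "om d"
proof -
  have "\<exists>d\<in>P. om d"
  proof (rule ccontr)
    assume *: "\<not> (\<exists>d\<in>P. om d)"
    obtain x where x: "x \<in> B" "x \<noteq> 0" "\<not> om x" using ker_om by blast
    have "rpow j x \<in> Ker" for j
    proof (induction j)
      case (Suc j)
      then have "sec True (rpow j x) \<in> P" by (simp add: P_def)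
      then show ?case using * P_B by (auto simp: Ker_def rpow_Suc')
    qed (use x in \<open>simp add: Ker_def\<close>)
    then show False using eq_0_if_not_om[OF x(1)] x(2) by (simp add: Ker_def)
  qed
  then show ?thesis using that by blast
qed

text \<open>Modulo this subgroup only \<open>D k\<close> remains of \<open>H k\<close>
  (\<open>D_Np_decomp\<close>). For \<open>k = 1\<close> the quotient is dihedral of order 8, by
  \<open>rot_in_Np_1\<close> and \<open>rot_b_notin_Np_1\<close>.\<close>

definition Np :: "int \<Rightarrow> taut set" where "Np k = ncl (H k) P"

lemma sgp_Np: "sgp (Np k)"
  unfolding Np_def by (rule sgp_ncl) (simp add: P_B)

lemma Np_subset_H: "Np k \<subseteq> H k"
  unfolding Np_def
  by (rule ncl_subset[OF sgp_H]) (metis sgp_add sgp_minus sgp_H B_subset_H P_B subsetD)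

lemma Np_conj: "g \<in> H k \<Longrightarrow> n \<in> Np k \<Longrightarrow> g + n + - g \<in> Np k"
  and Np_conj': "g \<in> H k \<Longrightarrow> n \<in> Np k \<Longrightarrow> - g + (n + g) \<in> Np k"
  unfolding Np_def using ncl_conj[OF sgp_H] ncl_conj'[OF sgp_H] by blast+

lemma P_subset_Np: "P \<subseteq> Np k"
  unfolding Np_def using ncl_base[OF sgp_0[OF sgp_H]] by blast

text \<open>The generators are copies on the right subtree of elements of \<open>P\<close>, namely
  the elements of \<open>Ker\<close>; conjugators are lifted by \<open>H_lift_True\<close>.
  Conjugation by \<open>sref k\<close> gives the copy on the left.\<close>

lemma pr_Np_in_H:
  assumes k: "odd k" and n: "n \<in> Np k"
  shows "pr 0 n \<in> H k" "pr (kap k False + n + - kap k False) 0 \<in> H k"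
proof -
  show 0: "pr 0 n \<in> H k"
    using n unfolding Np_def
  proof (induction rule: ncl.induct)
    case (step x g h)
    obtain c where c: "c \<in> Ker" "x = sec True c" using step by (auto simp: P_def)
    obtain g' where g': "g' \<in> H k" "\<not> active g'" "sec True g' = g" using H_lift_True[OF k step(2)] .
    have "pr 0 (g + x + - g) = g' + c + - g'"
      using g' c Ker_pr[OF c(1)] by (intro taut_eqI[of "pr _ _"]) (auto simp: Ker_def inactive_B sec_False_B)
    also have "\<dots> \<in> H k" using g' c Ker_B B_subset_H
      by (intro sgp_add[OF sgp_H] sgp_minus[OF sgp_H]) auto
    finally have "pr 0 (g + x + - g) + pr 0 h \<in> H k" using sgp_add[OF sgp_H] step.IH by blast
    then show ?case by (simp add: pr_add)
  qed (simp add: sgp_0[OF sgp_H])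
  have "sref k + pr 0 n + - sref k = pr (kap k False + n + - kap k False) 0"
    using k by (intro taut_eqI[of "_ + _"]) (simp_all add: sec_sref, simp_all add: kap_def)
  moreover have "sref k + pr 0 n + - sref k \<in> H k"
    using 0 by (intro sgp_add[OF sgp_H] sgp_minus[OF sgp_H] sref_in_H)
  ultimately show "pr (kap k False + n + - kap k False) 0 \<in> H k" by simp
qed

text \<open>\<open>P\<close> and \<open>b\<close> generate \<open>B\<close>, and a letter of
  \<open>P\<close> moves to the right past an element of \<open>D k\<close> at the price of a
  conjugation.\<close>

lemma D_Np_decomp:
  assumes "h \<in> H k"
  obtains d n where "d \<in> D k" "n \<in> Np k" "h = d + n"
proof -
  from assms have "\<exists>d\<in>D k. \<exists>n\<in>Np k. h = d + n"
    unfolding H_def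
  proof (induction rule: gen_induct)
    case zero
    then show ?case using sgp_0[OF sgp_D] sgp_0[OF sgp_Np] by force
  next
    case (s g)
    then obtain d n where d: "d \<in> D k" "n \<in> Np k" "g = d + n" by blast
    have "sref k + d \<in> D k" using d by (intro sgp_add[OF sgp_D]) (simp_all add: sref_def rot_b_in_D)
    then show ?case using d by (metis taut_assoc)
  next
    case (B x g)
    then obtain d n where d: "d \<in> D k" "n \<in> Np k" "g = d + n" by blast
    have *: "\<exists>e\<in>D k. \<exists>m\<in>Np k. p + (d' + n) = e + m" if "p \<in> P" "d' \<in> D k" for p d'
    proof -
      have "d' \<in> H k" using that D_subset_H by auto
      then have "- d' + (p + d') \<in> Np k" using that P_subset_Np by (intro Np_conj') auto
      then have "(- d' + (p + d')) + n \<in> Np k" using d sgp_add[OF sgp_Np] by blast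
      moreover have "p + (d' + n) = d' + ((- d' + (p + d')) + n)" by simp
      ultimately show ?thesis using that(2) by blast
    qed
    from P_cases[OF B(1)] show ?case
    proof
      assume "x + b \<in> P"
      moreover have "b + d \<in> D k" using d b_in_D by (intro sgp_add[OF sgp_D]) auto
      moreover have "x + g = (x + b) + ((b + d) + n)" using d by simp
      ultimately show ?thesis using * by metis
    qed (use * d in auto)
  qed
  then show ?thesis using that by blast
qed

text \<open>Choose \<open>d\<close> in \<open>P\<close> outside the kernel of omega and put
  \<open>e = d + b\<close>, which lies in the kernel. Then \<open>rot k = u + d\<close> for
  \<open>u = sref k + e\<close>. The square of \<open>u\<close> is an involution or trivial on each
  subtree, so the fourth power of \<open>u\<close> vanishes and \<open>four_conjugates\<close>
  applies.\<close>

lemma rot_4_in_Np: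
  assumes k: "odd k"
  shows "rot (4 * k * j) \<in> Np k"
proof -
  obtain d where d: "d \<in> P" "om d" by (rule ex_P_om)
  define e where "e = d + b"
  have dB: "d \<in> B" using d P_B by simp
  then have e: "e \<in> Ker" "e \<in> B" using d by (auto simp: e_def Ker_def add_B om_add om_b)
  define u where "u = sref k + e"
  define X where "X = kap k False + sec True e + - kap k False"
  have "sec True e + sec True e = 0" using e by (simp add: rho_B invol_B)
  then have XX: "X + X = 0" by (simp add: X_def) (metis add_0_left taut_assoc add.right_inverse)
  have "sref k + e + - sref k = pr X 0"
    using k e Ker_pr[OF e(1)] by (intro taut_eqI[of "_ + _"])
      (auto simp: sec_sref inactive_B sec_False_B Ker_def X_def, simp_all add: kap_def)
  moreover have "- sref k = sref k" by (rule minus_unique) (rule sref_sref)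
  ultimately have "u + u = pr X 0 + e" by (simp add: u_def flip: taut_assoc)
  also have "\<dots> = pr X (sec True e)" using Ker_pr[OF e(1)] by (metis add.right_neutral add_0_left pr_add)
  finally have "u + u + u + u = 0"
    using XX \<open>sec True e + sec True e = 0\<close> by (metis pr_add pr_0_0 taut_assoc)
  then have z: "u + (u + (u + (u + d))) = d" by (metis add_0_left taut_assoc)
  have "e + d = b" using dB add_comm_B[OF b_B dB] by (simp add: e_def)
  then have "rot k = u + d" by (simp add: u_def sref_def)
  then have "rot (4 * k) = (u + d) + (u + d) + (u + d) + (u + d)"
    using rot_rot(1)[of k k] rot_rot(1)[of "2 * k" "2 * k"] by simp
  moreover have "(u + d + - u) + (u + u + d + - (u + u)) + (u + u + u + d + - (u + u + u)) + (u + u + u + u) + d \<in> Np k"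
  proof -
    have uH: "u \<in> H k" using e B_subset_H sref_in_H by (auto simp: u_def intro!: sgp_add[OF sgp_H])
    then have uH2: "u + u \<in> H k" "u + u + u \<in> H k" using sgp_add[OF sgp_H] by blast+
    have dN: "d \<in> Np k" using d P_subset_Np by blast
    have "(u + d + - u) + (u + u + d + - (u + u)) + (u + u + u + d + - (u + u + u)) + 0 + d \<in> Np k"
      by (rule sgp_add[OF sgp_Np sgp_add[OF sgp_Np sgp_add[OF sgp_Np sgp_add[OF sgp_Np
        Np_conj[OF uH dN] Np_conj[OF uH2(1) dN]] Np_conj[OF uH2(2) dN]] sgp_0[OF sgp_Np]] dN])
    then show ?thesis using \<open>u + u + u + u = 0\<close> by (simp only:)
  qed
  ultimately have "rot (4 * k) \<in> Np k" using four_conjugates[of u d] by simp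
  then show ?thesis using rot_in_sgp[OF sgp_Np] by blast
qed

text \<open>Conjugates of elements of \<open>P\<close> have these three properties, and products
  keep them. As \<open>b\<close> lies neither in \<open>P\<close> nor in its rho-image, they exclude
  the reflections and the rotations whose index is not divisible by 4.\<close>

lemma Np_1_class:
  assumes "n \<in> Np 1"
  shows "\<not> active n \<and> vec n \<in> P \<and> vec (sec True n) \<in> sec True ` P"
  using assms unfolding Np_def H_1
proof (induction rule: ncl.induct)
  case zero
  then show ?case using zero_P by (auto intro: image_eqI[of _ _ 0])
next
  case (step x g h)
  have x: "x \<in> B" "x \<in> G" using step P_B G_B by auto
  have hG: "h \<in> G" using step(3) Np_subset_H[of 1] by (auto simp: Np_def H_1)
  define u where "u = g + x + - g"
  have uG: "u \<in> G" unfolding u_def using step x by (intro G_add G_minus)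
  have "vec u = x" unfolding u_def using vec_conj[OF step(2) x(2)] x by simp
  moreover have "vec (sec True u) \<in> sec True ` P"
  proof -
    let ?c = "True \<noteq> active g"
    have "sec True u = sec ?c g + sec ?c x + - sec ?c g" using x by (simp add: u_def inactive_B)
    moreover have "vec (sec ?c g + sec ?c x + - sec ?c g) = vec (sec ?c x)"
      using step(2) x by (intro vec_conj sec_in_G)
    moreover have "vec (sec c x) \<in> sec True ` P" for c
    proof (cases c)
      case True
      then show ?thesis using x step(1) by (simp add: rho_B)
    next
      case False
      then show ?thesis using x zero_P by (auto simp: sec_False_B intro: image_eqI[of _ _ 0])
    qed
    ultimately show ?thesis by simp
  qed
  moreover have "u + v \<in> sec True ` P" if "u \<in> sec True ` P" "v \<in> sec True ` P" for u v
  proof -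
    from that obtain p q where "p \<in> P" "u = sec True p" "q \<in> P" "v = sec True q" by auto
    then show ?thesis using P_B by (intro image_eqI[of _ _ "p + q"]) (auto simp: inactive_B P_add)
  qed
  moreover have "\<not> active u" using x by (auto simp: u_def inactive_B)
  ultimately show ?case using step.IH P_add step(1) uG hG unfolding u_def[symmetric]
    by (simp add: vec_add sec_in_G)
qed

lemma rot_in_Np_1: "rot j \<in> Np 1 \<longleftrightarrow> 4 dvd j"
proof
  assume j: "rot j \<in> Np 1"
  then have "even j" using Np_1_class by fastforce
  then obtain i where i: "j = 2 * i" by blast
  then have "vec (rot i) \<in> sec True ` P" using Np_1_class[OF j] by simp
  then have "even i" using b_notin_sec_P by (auto simp: vec_rot split: if_splits)
  then show "4 dvd j" using i by auto
next
  assume "4 dvd j"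
  then show "rot j \<in> Np 1" using rot_4_in_Np[of 1] by (elim dvdE) auto
qed

lemma rot_b_notin_Np_1: "rot j + b \<notin> Np 1"
proof
  assume j: "rot j + b \<in> Np 1"
  then have "even j" using Np_1_class by fastforce
  then have "vec (rot j + b) = b" by (simp add: vec_add vec_rot)
  then show False using Np_1_class[OF j] b_notin_P by simp
qed

text \<open>Like \<open>D_Np_decomp\<close>, but with \<open>Ker\<close> in place of
  \<open>P\<close>: \<open>Ker\<close> and \<open>b\<close> generate \<open>B\<close>, and both
  sections of an element of \<open>Ker\<close> lie in \<open>Np 1\<close>.\<close>

lemma D_pr_decomp:
  assumes "g \<in> G"
  obtains d n0 n1 where "d \<in> D 1" "n0 \<in> Np 1" "n1 \<in> Np 1" "g = d + pr n0 n1"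
proof -
  from assms have "\<exists>d\<in>D 1. \<exists>n0\<in>Np 1. \<exists>n1\<in>Np 1. g = d + pr n0 n1"
  proof (induction rule: gen_induct)
    case zero
    then show ?case using sgp_0[OF sgp_D] sgp_0[OF sgp_Np] by (metis add_0_left pr_0_0)
  next
    case (s g)
    then show ?case using sgp_add[OF sgp_D a_in_D1] by (metis taut_assoc)
  next
    case (B x g)
    then obtain d n0 n1 where d: "d \<in> D 1" "n0 \<in> Np 1" "n1 \<in> Np 1" "g = d + pr n0 n1" by blast
    have *: "\<exists>d\<in>D 1. \<exists>m0\<in>Np 1. \<exists>m1\<in>Np 1. c + (d' + pr n0 n1) = d + pr m0 m1"
      if "c \<in> Ker" "d' \<in> D 1" for c d'
    proof -
      let ?u = "- d' + (c + d')"
      have "d' \<in> G" using that D_subset_G by auto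
      have "sec i c \<in> Np 1" for i
        using that P_subset_Np[of 1] sgp_0[OF sgp_Np, of 1]
        by (cases i) (auto simp: Ker_def P_def sec_False_B)
      moreover have "sec i d' \<in> H 1" for i using \<open>d' \<in> G\<close> by (simp add: H_1 sec_in_G)
      ultimately have "sec i ?u \<in> Np 1" for i
        using that Np_conj'[of "sec i d'" 1 "sec (i \<noteq> active d') c"]
        by (cases i; cases "active d'") (simp_all add: Ker_def inactive_B)
      moreover have "\<not> active ?u" using that by (auto simp: Ker_def inactive_B)
      ultimately obtain m0 m1 where "m0 \<in> Np 1" "m1 \<in> Np 1" "?u = pr m0 m1" by (metis pr_eta)
      then have "c + (d' + pr n0 n1) = d' + pr (m0 + n0) (m1 + n1)"
        by (metis minus_add_cancel add_minus_cancel pr_add taut_assoc)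
      then show ?thesis using that d \<open>m0 \<in> Np 1\<close> \<open>m1 \<in> Np 1\<close> sgp_add[OF sgp_Np] by blast
    qed
    from Ker_cases[OF B(1)] show ?case
    proof
      assume "x + b \<in> Ker"
      moreover have "b + d \<in> D 1" using d b_in_D by (intro sgp_add[OF sgp_D]) auto
      moreover have "x + g = (x + b) + ((b + d) + pr n0 n1)" using d by simp
      ultimately show ?thesis using * by metis
    qed (use * d in auto)
  qed
  then show ?thesis using that by blast
qed

text \<open>Pick \<open>h\<close> in \<open>H k\<close> with the same right section as
  \<open>g\<close>; the left sections then differ by some \<open>rot z\<close>. The assumptions on
  the sections make \<open>z\<close> divisible by \<open>k\<close>, and the decomposition of
  \<open>g\<close> in \<open>G\<close> makes it divisible by 4. As \<open>k\<close> is odd,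
  \<open>4 * k\<close> divides \<open>z\<close>, so the copy of \<open>rot z\<close> on the left
  subtree lies in \<open>H k\<close>.\<close>

lemma in_H_if_sections_in_D:
  assumes k: "odd k" and g: "g \<in> G" "\<not> active g"
    and s1: "sec True g \<in> D k" and s0: "- kap k False + sec False g + kap k False \<in> D k"
  shows "g \<in> H k"
proof -
  define i where "i = k div 2"
  have ki: "k = 2 * i + 1" using k by (auto simp: i_def)
  have kap: "kap k False = rot (- i)" by (simp add: kap_def i_def)
  obtain d n0 n1 where d: "d \<in> D 1" "n0 \<in> Np 1" "n1 \<in> Np 1" "g = d + pr n0 n1"
    using D_pr_decomp[OF g(1)] .
  then have ad: "\<not> active d" using g by auto
  have n1: "n1 = - sec True d + sec True g" and n0: "n0 = - sec False d + sec False g"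
    using d by simp_all
  have fin: "g \<in> H k" if h: "h \<in> H k" "\<not> active h" "sec True h = sec True g"
    "sec False g = sec False h + rot z" "k dvd z" "4 dvd z" for h z
  proof -
    have "coprime k 4" using k coprime_power_right_iff[of k 2 2] by (simp add: coprime_right_2_iff_odd)
    then have "4 * k dvd z" using that by (metis divides_mult mult.commute)
    then have "rot z \<in> Np k" using rot_4_in_Np[OF k] by (elim dvdE) simp
    then have "pr (rot z) 0 \<in> H k" using pr_Np_in_H(2)[OF k, of "rot z"] by (simp add: kap)
    moreover have "g = h + pr (rot z) 0" using h g by (intro taut_eqI[of g]) auto
    ultimately show ?thesis using h sgp_add[OF sgp_H] by simp
  qed
  from s1 obtain u where u: "k dvd u" "sec True g = rot u \<or> sec True g = rot u + b"
    by (auto elim: D_cases)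
  from s0 obtain v where v: "k dvd v"
    "- kap k False + sec False g + kap k False = rot v \<or> - kap k False + sec False g + kap k False = rot v + b"
    by (auto elim: D_cases)
  have v': "sec False g = rot v \<or> sec False g = rot (v - 2 * i) + b"
  proof -
    have *: "sec False g = rot (- i) + (- rot (- i) + sec False g + rot (- i)) + rot i" by simp
    from v(2) show ?thesis
    proof
      assume "- kap k False + sec False g + kap k False = rot v"
      then show ?thesis using * by (simp add: kap)
    next
      assume "- kap k False + sec False g + kap k False = rot v + b"
      then have "sec False g = rot (- i) + (rot v + b) + rot i" using * by (simp only: kap)
      then show ?thesis by simp
    qed
  qed
  from d(1) show ?thesis
  proof (cases rule: D_cases)
    case (1 l)
    then have "even l" using ad by simp
    then obtain j where j: "d = rot (2 * j)" using 1 by blast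
    have s: "sec True d = rot j" "sec False d = rot (- j)" using j by simp_all
    from u(2) have u': "sec True g = rot u"
    proof
      assume "sec True g = rot u + b"
      then have "n1 = rot (u - j) + b" using n1 s by simp
      then show ?thesis using d rot_b_notin_Np_1 by simp
    qed
    from v' have v'': "sec False g = rot v"
    proof
      assume "sec False g = rot (v - 2 * i) + b"
      then have "n0 = rot (v - 2 * i + j) + b" using n0 s by (simp add: algebra_simps)
      then show ?thesis using d rot_b_notin_Np_1 by simp
    qed
    have "n1 = rot (u - j)" "n0 = rot (v + j)" using n1 n0 u' v'' s by (simp_all add: algebra_simps)
    then have "4 dvd u - j" "4 dvd v + j" using d rot_in_Np_1 by auto
    then have "4 dvd u + v" by presburger
    then show ?thesis using u v u' v'' by (intro fin[of "rot (2 * u)" "u + v"]) (auto intro: rot_in_H)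
  next
    case (2 l)
    then have "even l" using ad by simp
    then obtain j where j: "d = rot (2 * j) + b" using 2 by blast
    have s: "sec True d = rot j + b" "sec False d = rot (1 - j) + b" using j by (simp_all add: a_eq)
    from u(2) have u': "sec True g = rot u + b"
    proof
      assume "sec True g = rot u"
      then have "n1 = rot (j - u) + b" using n1 s by (simp add: algebra_simps)
      then show ?thesis using d rot_b_notin_Np_1 by simp
    qed
    from v' have v'': "sec False g = rot (v - 2 * i) + b"
    proof
      assume "sec False g = rot v"
      then have "n0 = rot (1 - j - v) + b" using n0 s by (simp add: algebra_simps)
      then show ?thesis using d rot_b_notin_Np_1 by simp
    qed
    have "n1 = rot (j - u)" "n0 = rot (1 - j - (v - 2 * i))"
      using n1 n0 u' v'' s by (simp_all add: algebra_simps)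
    then have "4 dvd j - u" "4 dvd 1 - j - (v - 2 * i)" using d rot_in_Np_1 by auto
    \<comment> \<open>In \<open>k = 2 * i + 1\<close> the 1 stems from the section
      \<open>a = rot 1 + b\<close> of \<open>b\<close> at 0, and \<open>2 * i\<close> from undoing
      the conjugation by \<open>kap k False\<close>.\<close>
    then have "4 dvd k - (u + v)" using ki by presburger
    have "k dvd k - (u + v)" using u v by auto
    have "rot (2 * u) \<in> H k" using u by (intro rot_in_H) simp
    then have "rot (2 * u) + b \<in> H k" by (rule sgp_add[OF sgp_H _ subsetD[OF B_subset_H b_B]])
    have hs: "sec True (rot (2 * u) + b) = rot u + b" "sec False (rot (2 * u) + b) = rot (1 - u) + b"
      by (simp_all add: a_eq)
    show ?thesis
    proof (rule fin)
      show "rot (2 * u) + b \<in> H k" "4 dvd k - (u + v)" "k dvd k - (u + v)" by fact+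
      show "sec True (rot (2 * u) + b) = sec True g" unfolding u' hs ..
      show "sec False g = sec False (rot (2 * u) + b) + rot (k - (u + v))"
        unfolding v'' hs using ki by (simp add: algebra_simps)
    qed simp
  qed
qed

text \<open>The components of the sections in \<open>Np k\<close> are removed by multiplying with an
  element of \<open>H k\<close> supplied by \<open>pr_Np_in_H\<close>; only dihedral sections are
  left.\<close>

lemma in_H_if_sections_in_H:
  assumes k: "odd k" and g: "g \<in> G" "\<not> active g"
    and s1: "sec True g \<in> H k" and s0: "- kap k False + sec False g + kap k False \<in> H k"
  shows "g \<in> H k"
proof -
  obtain d1 n1 where d1: "d1 \<in> D k" "n1 \<in> Np k" "sec True g = d1 + n1" using D_Np_decomp[OF s1] .
  obtain d0 n0 where d0: "d0 \<in> D k" "n0 \<in> Np k" "- kap k False + sec False g + kap k False = d0 + n0"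
    using D_Np_decomp[OF s0] .
  let ?p = "kap k False"
  define q where "q = pr 0 (- n1) + pr (?p + - n0 + - ?p) 0"
  have q: "q \<in> H k"
    unfolding q_def using d0 d1 by (intro sgp_add[OF sgp_H] pr_Np_in_H[OF k] sgp_minus[OF sgp_Np])
  have qs: "\<not> active q" "sec True q = - n1" "sec False q = ?p + - n0 + - ?p"
    by (simp_all add: q_def)
  have "sec False g = ?p + (d0 + n0) + - ?p" unfolding d0(3)[symmetric] by simp
  then have "g + q \<in> H k"
    using d1 d0 g qs G_add[OF g(1) subsetD[OF H_subset_G q]]
    by (intro in_H_if_sections_in_D[OF k]) simp_all
  then show ?thesis using sgp_add_right[OF sgp_H q] by simp
qed

section \<open>Climbing up the tree\<close>

text \<open>An odd \<open>k\<close> is invertible modulo 4, and \<open>Np 1\<close> contains the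
  rotations with index divisible by 4. The witness uses that the square of \<open>k\<close> is 1
  modulo 4.\<close>

lemma Np_H_decomp:
  assumes k: "odd k" and g: "g \<in> G"
  obtains n h where "n \<in> Np 1" "h \<in> H k" "g = n + h"
proof -
  obtain d n where d: "d \<in> D 1" "n \<in> Np 1" "g = d + n" using D_Np_decomp[of g 1] g H_1 by auto
  have dG: "d \<in> H 1" using d D_subset_G H_1 by auto
  have r: "\<exists>n\<in>Np 1. \<exists>h\<in>H k. rot i = n + h" for i
  proof (intro bexI)
    have "4 dvd i - k * (k * i)"
    proof -
      obtain j where "k = 2 * j + 1" using k by (elim oddE)
      then have "i - k * (k * i) = 4 * (- j * i - j * j * i)" by (simp add: algebra_simps)
      then show ?thesis by simp
    qed
    then show "rot (i - k * (k * i)) \<in> Np 1" by (simp add: rot_in_Np_1)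
    show "rot (k * (k * i)) \<in> H k" by (rule rot_in_H) simp
  qed simp
  have "\<exists>n\<in>Np 1. \<exists>h\<in>H k. d = n + h"
    using d(1)
  proof (cases rule: D_cases)
    case (2 i)
    obtain n h where "n \<in> Np 1" "h \<in> H k" "rot i = n + h" using r by blast
    then show ?thesis using 2 sgp_add[OF sgp_H, of h k b] B_subset_H b_B
      by (metis subsetD taut_assoc)
  qed (use r in simp)
  then obtain n' h where h: "n' \<in> Np 1" "h \<in> H k" "d = n' + h" by blast
  have "g = ((d + n + - d) + n') + h" using d h by simp
  moreover have "(d + n + - d) + n' \<in> Np 1" using d dG h by (intro sgp_add[OF sgp_Np] Np_conj)
  ultimately show ?thesis using that h by blast
qed

text \<open>Conjugating by \<open>c\<close> puts the right sections into \<open>H k\<close> itself.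
  A further conjugation by \<open>pr n' 0\<close> leaves the right sections of inactive elements
  alone and adjusts an active element \<open>t\<close> so that its right section lies in
  \<open>?p + H k\<close>. Then the left sections are in the position required by
  \<open>in_H_if_sections_in_H\<close>.\<close>

lemma subset_conjs_H_if_sec1:
  assumes M: "dense M" and k: "odd k" and g: "g \<in> G" and s: "sec1 M \<subseteq> conjs g (H k)"
  obtains g' where "g' \<in> G" "M \<subseteq> conjs g' (H k)"
proof -
  have "- g \<in> H 1" using g by (simp add: H_1 G_minus)
  then obtain c where c: "c \<in> G" "\<not> active c" "sec True c = - g"
    using H_lift_True[of 1] H_1 by auto
  obtain t where t: "t \<in> conjs c M" "active t"
    using dense_conjs[OF M c(1)] zero_B unfolding dense_def by metis
  have "t \<in> G" using t dense_conjs[OF M c(1)] by (auto simp: dense_def)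
  let ?p = "kap k False"
  have pG: "?p \<in> G" by (simp add: kap_def)
  obtain n h where nh: "n \<in> Np 1" "h \<in> H k" "- ?p + sec True t = n + h"
    using Np_H_decomp[OF k G_add[OF G_minus[OF pG] sec_in_G[OF \<open>t \<in> G\<close>]]] .
  define n' where "n' = - (?p + n + - ?p)"
  have n': "n' \<in> Np 1" unfolding n'_def
    using nh pG by (intro sgp_minus[OF sgp_Np] Np_conj) (simp_all add: H_1)
  have c2: "pr n' 0 \<in> G" using pr_Np_in_H(2)[of 1, OF _ n'] by (simp add: kap_def H_1)
  define c' where "c' = pr n' 0 + c"
  have c'G: "c' \<in> G" unfolding c'_def using c c2 by (intro G_add)
  define L where "L = conjs c' M"
  have L: "sgp L" "L \<subseteq> G" using dense_conjs[OF M c'G] by (auto simp: dense_def L_def)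
  have L1: "sec True x \<in> H k" if "x \<in> L" "\<not> active x" for x
  proof -
    have m: "- c' + x + c' \<in> M" using that by (simp add: L_def mem_conjs)
    moreover have "\<not> active (- c' + x + c')" using that by auto
    ultimately have "sec True (- c' + x + c') \<in> conjs g (H k)" using s sec1I by blast
    moreover have "sec True (- c' + x + c') = g + sec True x + - g"
      using that c by (simp add: c'_def)
    ultimately have "g + sec True x + - g \<in> conjs g (H k)" by (simp only:)
    then show ?thesis by (simp add: mem_conjs)
  qed
  define t' where "t' = pr n' 0 + t + - pr n' 0"
  have t': "t' \<in> L" "active t'"
    using t by (auto simp: L_def t'_def c'_def mem_conjs)
  have "sec True t = ?p + (n + h)" using nh(3) by (metis add_minus_cancel)
  then have t1: "sec True t' = ?p + h" using t by (simp add: t'_def n'_def)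
  have inact: "x \<in> H k" if x: "x \<in> L" "\<not> active x" for x
  proof (rule in_H_if_sections_in_H[OF k])
    have "- t' + x + t' \<in> L" using x t' L by (intro sgp_add sgp_minus)
    moreover have "\<not> active (- t' + x + t')" using x by auto
    moreover have "sec True (- t' + x + t') = - h + (- ?p + sec False x + ?p) + h"
      using t' t1 x by simp
    ultimately have "- h + (- ?p + sec False x + ?p) + h \<in> H k" using L1 by metis
    then show "- ?p + sec False x + ?p \<in> H k"
      using sgp_add_left[OF sgp_H sgp_minus[OF sgp_H nh(2)]] sgp_add_right[OF sgp_H nh(2)] by blast
  qed (use x L L1 in auto)
  have "sref k + t' \<in> H k"
  proof (rule in_H_if_sections_in_H[OF k])
    show "sref k + t' \<in> G" using t' L H_subset_G[of k] sref_in_H by (intro G_add) auto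
    show "\<not> active (sref k + t')" using t' k by simp
    show "sec True (sref k + t') \<in> H k"
      using t' t1 nh by (simp add: sec_sref[OF k], simp add: kap_def)
    \<comment> \<open>The square of \<open>t'\<close> is inactive and its right section is the
      product of both sections of \<open>t'\<close>; this controls the left one.\<close>
    have "sec True (t' + t') \<in> H k" using t' L by (intro L1 sgp_add) auto
    then have "sec False t' + ?p + h \<in> H k" using t' t1 by simp
    then have "sec False t' + ?p \<in> H k" using sgp_add_right[OF sgp_H nh(2)] by metis
    then show "- ?p + sec False (sref k + t') + ?p \<in> H k"
      using t' by (simp add: sec_sref[OF k], simp add: kap_def)
  qed
  then have tH: "t' \<in> H k" using sgp_add_left[OF sgp_H sref_in_H] by simp
  have "L \<subseteq> H k"
  proof
    fix x assume x: "x \<in> L"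
    show "x \<in> H k"
    proof (cases "active x")
      case True
      then have "- t' + x \<in> H k" using x t' L by (intro inact sgp_add sgp_minus) auto
      then show ?thesis using sgp_add_left[OF sgp_H sgp_minus[OF sgp_H tH]] by simp
    qed (use inact x in blast)
  qed
  then have "M \<subseteq> conjs (- c') (H k)" by (simp add: L_def conjs_subset_iff)
  then show ?thesis using that c'G G_minus by blast
qed

end

section \<open>Contraction of dense subgroups\<close>

definition secn :: "nat \<Rightarrow> taut set \<Rightarrow> taut set" where "secn j = (sec1 ^^ j)"

lemma secn_0 [simp]: "secn 0 K = K" by (simp add: secn_def)

lemma secn_Suc: "secn (Suc j) K = secn j (sec1 K)" by (simp add: secn_def funpow_swap1)

lemma secn_Suc': "secn (Suc j) K = sec1 (secn j K)" by (simp add: secn_def)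

context sunic_b
begin

text \<open>A reflection is a rotation times \<open>b\<close>. The factors \<open>b\<close> are
  absorbed into \<open>x\<close>, as \<open>B\<close> is abelian.\<close>

lemma D1_letter_normal_form:
  assumes "e \<in> D 1" "e' \<in> D 1" "x \<in> B"
  obtains i i' y where "y = x \<or> y = x + b" "e + x + e' = rot i + y + rot i'"
proof -
  have *: "\<exists>i' y. (y = x \<or> y = x + b) \<and> x + e' = y + rot i'" if "x \<in> B" for x
    using assms(2)
  proof (cases rule: D_cases)
    case (2 i)
    then have "e' = b + rot (- i)" by simp
    then show ?thesis by (metis taut_assoc)
  qed auto
  from assms(1) show ?thesis
  proof (cases rule: D_cases)
    case (1 i)
    then show ?thesis using *[OF assms(3)] that by (metis taut_assoc)
  next
    case (2 i)
    have xb: "b + x = x + b" using assms(3) by (simp add: add_comm_B)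
    obtain i' y where y: "y = x + b \<or> y = x + b + b" "(x + b) + e' = y + rot i'"
      using *[OF add_B[OF assms(3) b_B]] by blast
    have "e + x + e' = rot i + ((x + b) + e')" using 2 xb by (metis taut_assoc)
    then have "e + x + e' = rot i + y + rot i'" using y by simp
    then show ?thesis using that y by auto
  qed
qed

lemma conj_D1_rot:
  assumes "e \<in> D 1"
  obtains "- e + (rot s + e) = rot s" | "- e + (rot s + e) = rot (- s)"
  using assms by (cases rule: D_cases) (auto simp: algebra_simps)

lemma conj_D1_rot_b:
  assumes "e \<in> D 1"
  obtains s' where "- e + (rot s + b + e) = rot s' + b"
  using assms by (cases rule: D_cases) auto

text \<open>The minimality of \<open>k\<close>, in a form that passes to section subgroups.\<close>

definition Div :: "int \<Rightarrow> taut set \<Rightarrow> bool" where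
  "Div k K \<longleftrightarrow> (\<forall>j s. rot s \<in> secn j K \<longrightarrow> k dvd s)"

lemma Div_sec1: "Div k K \<Longrightarrow> Div k (sec1 K)"
  unfolding Div_def by (metis secn_Suc)

lemma DivD: "Div k K \<Longrightarrow> rot s \<in> K \<Longrightarrow> k dvd s"
  unfolding Div_def by (metis secn_0)

lemma rot_in_sec1:
  assumes "sgp K" "rot k \<in> K"
  shows "rot k \<in> sec1 K"
  using sec1I[of "rot (2 * k)" K] rot_in_sgp[OF assms, of 2] by (simp add: mult.commute[of k 2])

lemma rot_in_secn: "sgp K \<Longrightarrow> rot k \<in> K \<Longrightarrow> rot k \<in> secn j K \<and> sgp (secn j K)"
  by (induction j arbitrary: K) (simp_all add: secn_Suc sgp_sec1 rot_in_sec1)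

lemma secn_subset_G: "K \<subseteq> G \<Longrightarrow> secn j K \<subseteq> G"
  by (induction j arbitrary: K) (simp_all add: secn_Suc sec1_subset_G)

lemma B_in_sec1: "x \<in> B \<Longrightarrow> x \<in> K \<Longrightarrow> sec True x \<in> sec1 K"
  by (simp add: sec1I inactive_B)

text \<open>For odd \<open>k\<close> the rotation \<open>rot k\<close> is the active element for
  \<open>sec0_in_sec1\<close>. Its section lies in \<open>D 1\<close>, so products of a word with
  factors from \<open>D 1\<close> keep their form.\<close>

lemma conj_sec_False_in_sec1:
  assumes "sgp K" "odd k" "rot k \<in> K"
  obtains e where "e \<in> D 1" "\<And>g. g \<in> K \<Longrightarrow> \<not> active g \<Longrightarrow> - e + (sec False g + e) \<in> sec1 K"
  using that[of "sec True (rot k)"] sec_in_D1[OF rot_in_D1] sec0_in_sec1[OF assms(1,3)] assms by simp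

lemma rot_if_sec_False:
  assumes K: "sgp K" "odd k" "rot k \<in> K" "Div k K"
    and g: "g \<in> K" "\<not> active g" "sec False g = rot s"
  shows "k dvd s"
proof -
  obtain e where e: "e \<in> D 1" "\<And>g. g \<in> K \<Longrightarrow> \<not> active g \<Longrightarrow> - e + (sec False g + e) \<in> sec1 K"
    using conj_sec_False_in_sec1[OF K(1-3)] by blast
  have "- e + (rot s + e) \<in> sec1 K" using e(2)[OF g(1,2)] g(3) by simp
  with conj_D1_rot[OF e(1), of s] have "rot s \<in> sec1 K \<or> rot (- s) \<in> sec1 K" by metis
  then show ?thesis using DivD[OF Div_sec1[OF K(4)]] by fastforce
qed

lemma even_shift:
  assumes "odd (k :: int)"
  obtains e where "even (i + k * e)"
  using assms that[of "if even i then 0 else 1"] by (cases "even i") auto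

lemma not_om_ex: "x \<in> B \<Longrightarrow> x \<noteq> b \<Longrightarrow> \<exists>j. \<not> om (rpow j x)"
proof (rule ccontr)
  assume x: "x \<in> B" "x \<noteq> b" and n: "\<not> (\<exists>j. \<not> om (rpow j x))"
  have "rpow j b = b" for j by (induction j) (simp_all add: rpow_Suc)
  then have "\<not> om (rpow j (x + b))" for j using n x om_b by (simp add: rpow_add om_add)
  then have "x + b = 0" using x eq_0_if_not_om add_B by simp
  then show False using x by (metis cancel_B add.right_neutral)
qed

lemma odd_dvd_two_mult: "odd (k :: int) \<Longrightarrow> k dvd 2 * z \<longleftrightarrow> k dvd z"
  by (simp add: coprime_dvd_mult_right_iff)

text \<open>Multiplying by multiples of \<open>rot k\<close> makes both indices even, so that
  sections halve them; for odd \<open>k\<close> neither change affects divisibility by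
  \<open>k\<close>.\<close>

lemma letter_even:
  assumes K: "sgp K" "odd k" "rot k \<in> K" and g: "rot i + (x + rot i') \<in> K"
  obtains u u' where "rot (2 * u) + (x + rot (2 * u')) \<in> K" "k dvd i + i' \<longleftrightarrow> k dvd u + u'"
proof -
  obtain e e' where "even (i + k * e)" "even (i' + k * e')" using even_shift[OF \<open>odd k\<close>] by metis
  then obtain u u' where u: "i + k * e = 2 * u" "i' + k * e' = 2 * u'" by (elim evenE)
  have "rot (k * e) + (rot i + (x + rot i')) + rot (k * e') \<in> K"
    by (rule sgp_add[OF K(1) sgp_add[OF K(1) rot_in_sgp[OF K(1,3)] g] rot_in_sgp[OF K(1,3)]])
  moreover have "k * e + i = 2 * u" "i' + k * e' = 2 * u'" using u by simp_all
  ultimately have "rot (2 * u) + (x + rot (2 * u')) \<in> K" by (simp only: rot_rot taut_assoc)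
  moreover have "k dvd i + i' \<longleftrightarrow> k dvd u + u'"
  proof -
    have "i + i' + k * (e + e') = 2 * (u + u')" using u by (simp add: algebra_simps)
    then have "k dvd i + i' \<longleftrightarrow> k dvd 2 * (u + u')" by (metis dvd_add_left_iff dvd_triv_left)
    then show ?thesis unfolding odd_dvd_two_mult[OF \<open>odd k\<close>] .
  qed
  ultimately show ?thesis using that by blast
qed

text \<open>As \<open>x\<close> differs from \<open>b\<close>, omega vanishes somewhere on its
  orbit. Sections at 1 lead to that point, where the section at 0 loses the letter and is a
  rotation, to which \<open>Div\<close> applies.\<close>

lemma rot_letter_rot:
  assumes K: "sgp K" "odd k" "rot k \<in> K" "Div k K"
    and x: "x \<in> B" "x \<noteq> b" and g: "rot i + (x + rot i') \<in> K"
  shows "k dvd i + i'"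
proof -
  obtain j where "\<not> om (rpow j x)" using not_om_ex[OF x] by blast
  then show ?thesis using K x(1) g
  proof (induction j arbitrary: K x i i')
    case (0 K x i i')
    obtain u u' where u: "rot (2 * u) + (x + rot (2 * u')) \<in> K" "k dvd i + i' \<longleftrightarrow> k dvd u + u'"
      using letter_even[OF 0(2-4,7)] .
    have "sec False (rot (2 * u) + (x + rot (2 * u'))) = rot (- u - u')"
      using 0 by (simp add: inactive_B sec_False_B)
    then have "k dvd - u - u'" using 0 by (intro rot_if_sec_False[OF 0(2-5) u(1)]) (simp_all add: inactive_B)
    moreover have "- u - u' = - (u + u')" by simp
    ultimately show ?case using u(2) by (metis dvd_minus_iff)
  next
    case (Suc j K x i i')
    obtain u u' where u: "rot (2 * u) + (x + rot (2 * u')) \<in> K" "k dvd i + i' \<longleftrightarrow> k dvd u + u'"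
      using letter_even[OF Suc(3-5,8)] .
    have "rot u + (sec True x + rot u') \<in> sec1 K"
      using sec1I[OF u(1)] Suc by (simp add: inactive_B)
    then have "k dvd u + u'" using Suc.prems
      by (intro Suc.IH[of "sec True x" "sec1 K"]) (simp_all add: rpow_Suc sgp_sec1 rot_in_sec1 Div_sec1 rho_B)
    then show ?case using u(2) by simp
  qed
qed

lemma conj_letter_even:
  assumes K: "sgp K" "odd k" "rot k \<in> K" and g: "rot i + (x + rot (- i)) \<in> K"
  obtains u where "rot (2 * u) + (x + rot (2 * (- u))) \<in> K" "k dvd i \<longleftrightarrow> k dvd u"
proof -
  obtain e where "even (i + k * e)" using even_shift[OF \<open>odd k\<close>] by metis
  then obtain u where u: "i + k * e = 2 * u" by (elim evenE)
  have "rot (k * e) + (rot i + (x + rot (- i))) + rot (k * (- e)) \<in> K"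
    by (rule sgp_add[OF K(1) sgp_add[OF K(1) rot_in_sgp[OF K(1,3)] g] rot_in_sgp[OF K(1,3)]])
  moreover have "k * e + i = 2 * u" "- i + k * (- e) = 2 * (- u)" using u by simp_all
  ultimately have "rot (2 * u) + (x + rot (2 * (- u))) \<in> K" by (simp only: rot_rot taut_assoc)
  moreover have "k dvd i \<longleftrightarrow> k dvd 2 * u" unfolding u[symmetric] by (simp add: dvd_add_left_iff)
  ultimately show ?thesis using that unfolding odd_dvd_two_mult[OF \<open>odd k\<close>] by blast
qed

text \<open>Here the descent stops where omega is nonzero. The section at 0 then is a conjugate of
  \<open>a\<close>, and the extra factor \<open>b\<close>, with section \<open>a\<close>, turns it
  into \<open>rot (- (2 * u))\<close>.\<close>

lemma conj_letter:
  assumes K: "sgp K" "odd k" "rot k \<in> K" "Div k K" "b \<in> K"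
    and x: "x \<in> B" "x \<noteq> 0" and g: "rot i + (x + rot (- i)) \<in> K"
  shows "k dvd i"
proof -
  obtain j where "om (rpow j x)" using eq_0_if_not_om x by blast
  then show ?thesis using K x(1) g
  proof (induction j arbitrary: K x i)
    case (0 K x i)
    obtain u where u: "rot (2 * u) + (x + rot (2 * (- u))) \<in> K" "k dvd i \<longleftrightarrow> k dvd u"
      using conj_letter_even[OF 0(2-4) 0(8)] .
    let ?g = "(rot (2 * u) + (x + rot (2 * (- u)))) + b"
    have g: "?g \<in> K" by (rule sgp_add[OF 0(2) u(1) 0(6)])
    have na: "\<not> active ?g" using 0 by (simp add: inactive_B)
    have "sec False ?g = rot (- u) + (aT + (rot u + aT))"
      using 0 by (simp add: inactive_B sec_False_B)
    also have "\<dots> = rot (- (2 * u))" by (simp add: a_eq)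
    finally have "k dvd - (2 * u)" using rot_if_sec_False[OF 0(2-5) g na] by blast
    then show ?case using u odd_dvd_two_mult[OF \<open>odd k\<close>] by simp
  next
    case (Suc j K x i)
    obtain u where u: "rot (2 * u) + (x + rot (2 * (- u))) \<in> K" "k dvd i \<longleftrightarrow> k dvd u"
      using conj_letter_even[OF Suc(3-5) Suc(9)] .
    have "rot u + (sec True x + rot (- u)) \<in> sec1 K"
      using sec1I[OF u(1)] Suc by (simp add: inactive_B)
    then have "k dvd u" using Suc.prems B_in_sec1[of b K]
      by (intro Suc.IH[of "sec True x" "sec1 K"]) (simp_all add: rpow_Suc sgp_sec1 rot_in_sec1 Div_sec1 rho_B)
    then show ?case using u by simp
  qed
qed

text \<open>The descent of \<open>conj_letter\<close> without the factor \<open>b\<close>: the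
  conjugate of \<open>a\<close> reached at the end is a reflection.\<close>

lemma reflection_from_letter:
  assumes K: "sgp K" "odd k" "rot k \<in> K"
    and x: "x \<in> B" "x \<noteq> 0" and g: "rot i + (x + rot (- i)) \<in> K"
  obtains j s where "rot s + b \<in> secn j K"
proof -
  obtain j where "om (rpow j x)" using eq_0_if_not_om x by blast
  then have "\<exists>j s. rot s + b \<in> secn j K" using K x(1) g
  proof (induction j arbitrary: K x i)
    case (0 K x i)
    obtain u where u: "rot (2 * u) + (x + rot (2 * (- u))) \<in> K"
      using conj_letter_even[OF 0(2-4) 0(6)] .
    let ?g = "rot (2 * u) + (x + rot (2 * (- u)))"
    have na: "\<not> active ?g" using 0 by (auto simp: inactive_B)
    obtain e where e: "e \<in> D 1" "\<And>g. g \<in> K \<Longrightarrow> \<not> active g \<Longrightarrow> - e + (sec False g + e) \<in> sec1 K"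
      using conj_sec_False_in_sec1[OF 0(2-4)] by blast
    have "sec False ?g = rot (- u) + (aT + rot u)"
      using 0 by (simp add: inactive_B sec_False_B)
    also have "\<dots> = rot (1 - 2 * u) + b" by (simp add: a_eq)
    finally have "- e + (rot (1 - 2 * u) + b + e) \<in> sec1 K" using e(2)[OF u na] by (simp only:)
    with conj_D1_rot_b[OF e(1), of "1 - 2 * u"] obtain s where "rot s + b \<in> sec1 K" by metis
    then have "rot s + b \<in> secn 1 K" by (simp add: secn_def)
    then show ?case by blast
  next
    case (Suc j K x i)
    obtain u where u: "rot (2 * u) + (x + rot (2 * (- u))) \<in> K"
      using conj_letter_even[OF Suc(3-5) Suc(7)] .
    have "rot u + (sec True x + rot (- u)) \<in> sec1 K"
      using sec1I[OF u(1)] Suc by (simp add: inactive_B)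
    then have "\<exists>j s. rot s + b \<in> secn j (sec1 K)" using Suc.prems
      by (intro Suc.IH[of "sec True x" "sec1 K"]) (simp_all add: rpow_Suc sgp_sec1 rot_in_sec1 rho_B)
    then show ?case by (metis secn_Suc)
  qed
  then show ?thesis using that by blast
qed

text \<open>Up to multiplication by elements of \<^term>\<open>D 1\<close> on both sides, the two sections of an element
  of \<open>K\<close> both lie in \<^term>\<open>sec1 K\<close>, so an element can be contracted to a single letter while its
  class is kept outside \<open>Y\<close>.\<close>

lemma contract_to_letter:
  assumes "sgp K" "odd k" "rot k \<in> K" "valid w" "d \<in> D 1" "d' \<in> D 1" "d + (ev aT w + d') \<in> K"
    and "Y \<subseteq> B" "\<And>x y. x \<in> Y \<Longrightarrow> y \<in> Y \<Longrightarrow> x + y \<in> Y" "b \<in> Y" "vec (ev aT w) \<notin> Y"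
  shows "\<exists>j x i i'. x \<in> B \<and> x \<notin> rpow j ` Y \<and> rot i + (x + rot i') \<in> secn j K"
  using assms
proof (induction "nV w" arbitrary: w K d d' Y rule: less_induct)
  case less
  let ?h = "ev aT w"
  have hG: "?h \<in> G" using less.prems(4) by (rule ev_in_gen)
  obtain d2 where d2: "d2 \<in> D 1" "d2 + (?h + d') \<in> K" "\<not> active (d2 + (?h + d'))"
  proof (cases "active (d + (?h + d'))")
    case True
    have "rot k + d \<in> D 1" using less.prems(5) by (intro sgp_add[OF sgp_D] rot_in_D1)
    moreover have "rot k + (d + (?h + d')) \<in> K" by (rule sgp_add[OF less.prems(1,3,7)])
    ultimately show ?thesis using that[of "rot k + d"] True less.prems(2) by simp
  qed (use that less.prems in blast)
  let ?Y = "sec True ` Y"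
  have Yadd: "x + y \<in> ?Y" if "x \<in> ?Y" "y \<in> ?Y" for x y
  proof -
    from that obtain x' y' where "x' \<in> Y" "x = sec True x'" "y' \<in> Y" "y = sec True y'" by auto
    then show ?thesis using less.prems(8,9) by (intro image_eqI[of _ _ "x' + y'"]) (auto simp: inactive_B)
  qed
  have YB: "?Y \<subseteq> B" using less.prems(8) rho_B by auto
  have bY: "b \<in> ?Y" using less.prems(10) by (metis image_eqI rho_b)
  have "sec True (vec ?h) \<notin> ?Y"
    using less.prems(8,11) vec_in_B[OF hG] inj_sec_True_B by (auto dest: inj_onD)
  \<comment> \<open>The classes of the two sections add up to the rho-image of the class, which is
    outside \<open>?Y\<close> by injectivity. As \<open>?Y\<close> is closed under addition, one of
    them is outside too.\<close>
  then obtain c where c: "vec (sec c ?h) \<notin> ?Y"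
    using Yadd vec_sec_sum[OF hG] by metis
  define c' where "c' = (c \<noteq> active d')"
  define e1 where "e1 = sec (c \<noteq> active ?h) d2"
  define e2 where "e2 = sec c' d'"
  have e: "e1 \<in> D 1" "e2 \<in> D 1" unfolding e1_def e2_def by (intro sec_in_D1 d2(1) less.prems(6))+
  have s: "sec c' (d2 + (?h + d')) = e1 + (sec c ?h + e2)"
    unfolding c'_def e1_def e2_def by (cases c; cases "active d'"; cases "active ?h") simp_all
  obtain f1 f2 where f: "f1 \<in> D 1" "f2 \<in> D 1" "f1 + (sec c ?h + f2) \<in> sec1 K"
  proof (cases c')
    case True
    then have "sec True (d2 + (?h + d')) = e1 + (sec c ?h + e2)" using s by (simp only:)
    then have "e1 + (sec c ?h + e2) \<in> sec1 K" using sec1I[OF d2(2,3)] by (simp only:)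
    then show ?thesis using that e by blast
  next
    case False
    obtain e where e': "e \<in> D 1" "\<And>g. g \<in> K \<Longrightarrow> \<not> active g \<Longrightarrow> - e + (sec False g + e) \<in> sec1 K"
      using conj_sec_False_in_sec1[OF less.prems(1-3)] by blast
    have "sec False (d2 + (?h + d')) = e1 + (sec c ?h + e2)" using s False by (simp only:)
    then have "- e + ((e1 + (sec c ?h + e2)) + e) \<in> sec1 K" using e'(2)[OF d2(2,3)] by (simp only:)
    then show ?thesis using that[of "- e + e1" "e2 + e"] e e'
      by (simp add: sgp_add[OF sgp_D] sgp_minus[OF sgp_D])
  qed
  have sw: "sec c ?h = ev aT (wsec c w)" using sec_ev_a less.prems(4) by blast
  have vw: "valid (wsec c w)" using valid_wsec less.prems(4) by blast
  show ?case
  proof (cases "nA (wsec c w) = 0")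
    case True
    define x where "x = sec c ?h"
    have x: "x \<in> B" "x \<notin> ?Y" using ev_in_B[OF vw True] sw c by (simp_all add: x_def)
    obtain i i' y where y: "y = x \<or> y = x + b" "f1 + x + f2 = rot i + y + rot i'"
      using D1_letter_normal_form[OF f(1,2) x(1)] .
    have "y \<in> B" using x y add_B by auto
    \<comment> \<open>Passing from \<open>x\<close> to \<open>x + b\<close> cannot lead into the
      image of \<open>Y\<close>, which contains \<open>b\<close>.\<close>
    moreover have "y \<notin> rpow 1 ` Y"
    proof
      assume "y \<in> rpow 1 ` Y"
      then have "y \<in> ?Y" by (simp add: rpow_def)
      then have "y + b \<in> ?Y" using Yadd bY by blast
      then show False using x y \<open>y \<in> ?Y\<close> by auto
    qed
    moreover have "rot i + (y + rot i') \<in> secn 1 K" using f(3) y(2) by (simp add: x_def secn_def)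
    ultimately show ?thesis by blast
  next
    case False
    then have "nV (wsec c w) < nV w" using nV_nA_wsec[of c w] by simp
    then have "\<exists>j x i i'. x \<in> B \<and> x \<notin> rpow j ` ?Y \<and> rot i + (x + rot i') \<in> secn j (sec1 K)"
    proof (rule less.hyps[OF _ _ less.prems(2) _ vw f(1,2)])
      show "sgp (sec1 K)" "rot k \<in> sec1 K" using less.prems by (simp_all add: sgp_sec1 rot_in_sec1)
      show "f1 + (ev aT (wsec c w) + f2) \<in> sec1 K" using f sw by simp
      show "vec (ev aT (wsec c w)) \<notin> ?Y" using c sw by simp
    qed (use YB Yadd bY in auto)
    moreover have "rpow j ` ?Y = rpow (Suc j) ` Y" for j by (auto simp: rpow_Suc)
    ultimately show ?thesis by (metis secn_Suc)
  qed
qed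

text \<open>The derivation of a member records how it was reached, so that its properties can be
  carried back to \<open>M\<close> step by step.\<close>

inductive Fam :: "taut set \<Rightarrow> taut set \<Rightarrow> bool" for M where
  base: "Fam M M"
| sec: "Fam M K \<Longrightarrow> Fam M (sec1 K)"
| conj: "Fam M K \<Longrightarrow> g \<in> G \<Longrightarrow> Fam M (conjs g K)"

lemma Fam_dense: "Fam M K \<Longrightarrow> dense M \<Longrightarrow> dense K"
  by (induction rule: Fam.induct) (simp_all add: dense_sec1 dense_conjs)

lemma Fam_secn: "Fam M K \<Longrightarrow> Fam M (secn j K)"
  by (induction j) (simp_all add: secn_Suc' Fam.sec)

lemma word_in_b_in_D: "(\<And>x. Some x \<in> set w \<Longrightarrow> x = b) \<Longrightarrow> ev aT w \<in> D 1"
proof (induction w)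
  case (Cons l w)
  have "ev aT w \<in> D 1" by (rule Cons.IH) (rule Cons.prems, simp)
  moreover have "(case l of None \<Rightarrow> aT | Some x \<Rightarrow> x) \<in> D 1"
  proof (cases l)
    case (Some x)
    then have "x = b" by (intro Cons.prems) simp
    then show ?thesis using Some b_in_D by simp
  qed (simp add: a_in_D1)
  ultimately show ?case by (simp add: sgp_add[OF sgp_D])
qed (simp add: sgp_0[OF sgp_D])

text \<open>Class \<open>b\<close> reproduces itself: for an active element of this class, the
  section of the square has class rho of \<open>b\<close>, which is \<open>b\<close>, and is active
  because omega of \<open>b\<close> is nonzero. A shortest word then has no letters but
  \<open>b\<close>, hence lies in \<open>D 1\<close>, and its class makes it an odd
  rotation.\<close>

lemma ex_rot_in_Fam:
  assumes M: "dense M"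
  obtains K k where "Fam M K" "odd k" "0 < k" "rot k \<in> K"
proof -
  define C where "C = {g \<in> G. active g \<and> vec g = b \<and> (\<exists>K. Fam M K \<and> g \<in> K)}"
  obtain w x where w: "valid w" "ev aT w \<in> C" "Some x \<in> set w"
    "\<And>x j. Some x \<in> set w \<Longrightarrow> om (rpow j x)"
  proof (rule minimal_letters[of C])
    obtain g where "g \<in> M" "active g" "vec g = b" using M b_B unfolding dense_def by metis
    moreover have "M \<subseteq> G" using M by (simp add: dense_def)
    ultimately show "C \<noteq> {}" using Fam.base by (auto simp: C_def)
    show "- h + g + h \<in> C" if g: "g \<in> C" and h: "h \<in> G" for g h
    proof -
      obtain K where K: "Fam M K" "g \<in> K" using g by (auto simp: C_def)
      have "- h + g + h \<in> conjs (- h) K" using K by (simp add: mem_conjs)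
      moreover have "Fam M (conjs (- h) K)" using K h by (intro Fam.conj G_minus)
      moreover have "vec (- h + g + h) = b" using vec_conj[OF G_minus[OF h], of g] g by (simp add: C_def)
      moreover have "- h + g + h \<in> G" using g h by (intro G_add G_minus) (auto simp: C_def)
      ultimately show ?thesis using g unfolding C_def by auto
    qed
    show "x \<notin> C" if "x \<in> B" for x using that inactive_B by (auto simp: C_def)
    show "aT \<notin> C" using b_neq_0 by (auto simp: C_def)
    show "sec False g + sec True g \<in> C" if g: "g \<in> C" "active g" for g
    proof -
      obtain K where K: "Fam M K" "g \<in> K" using g by (auto simp: C_def)
      have gG: "g \<in> G" "vec g = b" using g by (auto simp: C_def)
      have "sgp K" using Fam_dense[OF K(1) M] by (simp add: dense_def)
      then have "sec True (g + g) \<in> sec1 K" using K by (intro sec1I sgp_add) auto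
      then have "sec False g + sec True g \<in> sec1 K" using g by simp
      moreover have "vec (sec False g + sec True g) = b"
        using vec_sec_sum[OF gG(1)] gG by (simp add: vec_add sec_in_G)
      moreover have "active (sec False g + sec True g)"
      proof -
        obtain y0 y1 where y: "y0 \<in> B" "y1 \<in> B" "y0 + y1 = vec g"
          "active (sec False g) = om y1" "active (sec True g) = om y0"
          using sec_class[OF gG(1)] by metis
        have "om (y0 + y1)" using y(3) gG om_b by simp
        then show ?thesis using y om_add[OF y(1,2)] by auto
      qed
      ultimately show ?thesis using K gG G_add sec_in_G Fam.sec unfolding C_def by blast
    qed
  qed (use that in \<open>auto simp: C_def\<close>)
  have "x = b" if "Some x \<in> set w" for x
    using not_om_ex[of x] w that by (auto simp: valid_def)
  then have "ev aT w \<in> D 1" by (rule word_in_b_in_D)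
  then obtain i where i: "odd i" "ev aT w = rot i"
  proof (cases rule: D_cases)
    case (2 i)
    then have "odd i" using w(2) by (simp add: C_def)
    then have "vec (ev aT w) = 0" using 2 by (simp add: vec_add vec_rot)
    then show ?thesis using w(2) b_neq_0 by (simp add: C_def)
  qed (use w(2) that in \<open>auto simp: C_def\<close>)
  then obtain K where K: "Fam M K" "rot i \<in> K" using w(2) by (auto simp: C_def)
  have "sgp K" using Fam_dense[OF K(1) M] by (simp add: dense_def)
  then have "rot \<bar>i\<bar> \<in> K" using K sgp_minus[of K "rot i"] by (cases "0 \<le> i") auto
  moreover have "odd \<bar>i\<bar>" using i(1) by simp
  moreover have "0 < \<bar>i\<bar>" using i(1) by (cases "i = 0") auto
  ultimately show ?thesis using that K by blast
qed

end

context sunic_big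
begin

text \<open>Sections shorten the word until a single letter of \<open>B\<close> between rotations is
  left; \<open>rot_letter_rot\<close> and \<open>conj_letter\<close> place it in \<open>H k\<close>.
  The way back is \<open>in_H_if_sections_in_H\<close>.\<close>

lemma subset_H_if_Div:
  assumes "sgp K" "odd k" "H k \<subseteq> K" "K \<subseteq> G" "Div k K" "valid w" "d \<in> D 1" "d' \<in> D 1"
    and "d + (ev aT w + d') \<in> K"
  shows "d + (ev aT w + d') \<in> H k"
  using assms
proof (induction "nV w" arbitrary: w K d d' rule: less_induct)
  case less
  let ?h = "ev aT w"
  have hG: "?h \<in> G" using less.prems(6) by (rule ev_in_gen)
  have rk: "rot k \<in> K" using less.prems(3) rot_in_H[of k k] by auto
  have bK: "b \<in> K" using less.prems(3) B_subset_H b_B by blast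
  have sk: "sref k \<in> K" using less.prems(3) sref_in_H by blast
  \<comment> \<open>The left factor \<open>d2\<close> is kept free so that \<open>sref k\<close> can
    be multiplied to it in the active case.\<close>
  have shift: "g \<in> H k" if g: "g \<in> K" "\<not> active g" "d2 \<in> D 1" "g = d2 + (?h + d')" for g d2
  proof (rule ccontr)
    assume "g \<notin> H k"
    moreover have "g \<in> G" using g less.prems(4) by auto
    ultimately obtain c' where c': "if c' then sec True g \<notin> H k
        else - kap k False + sec False g + kap k False \<notin> H k"
      using in_H_if_sections_in_H[OF less.prems(2)] g(2) by (metis (full_types))
    define c where "c = (c' \<noteq> active d')"
    define e1 where "e1 = sec (c \<noteq> active ?h) d2"
    define e2 where "e2 = sec c' d'"
    have e: "e1 \<in> D 1" "e2 \<in> D 1" unfolding e1_def e2_def by (intro sec_in_D1 g less.prems(8))+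
    have s: "sec c' g = e1 + (sec c ?h + e2)"
      unfolding c_def e1_def e2_def g(4) by (cases c'; cases "active d'"; cases "active ?h") simp_all
    have kapD: "kap k False \<in> D 1" by (simp add: kap_def rot_in_D1)
    obtain f1 f2 where f: "f1 \<in> D 1" "f2 \<in> D 1" "f1 + (sec c ?h + f2) \<in> sec1 K"
      "f1 + (sec c ?h + f2) \<notin> H k"
    proof (cases c')
      case True
      then show ?thesis using that[OF e] sec1I[OF g(1,2)] s c' by simp
    next
      case False
      have "- kap k False + sec False g + kap k False \<in> sec1 K"
        using sec0_in_sec1[OF less.prems(1) sk _ g(1,2)] less.prems(2)
        by (simp add: sec_sref) (simp add: kap_def)
      then show ?thesis using that[of "- kap k False + e1" "e2 + kap k False"] e kapD s c' False
        by (simp add: sgp_add[OF sgp_D] sgp_minus[OF sgp_D])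
    qed
    have sw: "sec c ?h = ev aT (wsec c w)" using sec_ev_a less.prems(6) by blast
    have vw: "valid (wsec c w)" using valid_wsec less.prems(6) by blast
    have K1: "sgp (sec1 K)" "rot k \<in> sec1 K" "Div k (sec1 K)" "b \<in> sec1 K"
      using less.prems rk B_in_sec1[OF b_B bK] by (simp_all add: sgp_sec1 rot_in_sec1 Div_sec1)
    have HK1: "H k \<subseteq> sec1 K" using sec1_mono[OF less.prems(3)] sec1_H[OF less.prems(2)] by simp
    show False
    proof (cases "nA (wsec c w) = 0")
      case False
      then have "nV (wsec c w) < nV w" using nV_nA_wsec[of c w] by simp
      from less.hyps[OF this K1(1) less.prems(2) HK1 sec1_subset_G[OF less.prems(4)] K1(3) vw f(1,2)]
      show False using f sw by simp
    next
      case True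
      define x where "x = sec c ?h"
      have x: "x \<in> B" using ev_in_B[OF vw True] sw by (simp add: x_def)
      obtain i i' y where y: "y = x \<or> y = x + b" "f1 + x + f2 = rot i + y + rot i'"
        using D1_letter_normal_form[OF f(1,2) x(1)] .
      have yB: "y \<in> B" using x y add_B by auto
      have in1: "rot i + (y + rot i') \<in> sec1 K" and notH: "rot i + (y + rot i') \<notin> H k"
        using f(3,4) y(2) by (simp_all add: x_def)
      show False
      proof (cases "y = b")
        case True
        then have eq: "rot i + (y + rot i') = rot (i - i') + b" by simp
        then have "rot (i - i') \<in> sec1 K" using in1 sgp_add_right[OF K1(1,4)] by simp
        then have "k dvd i - i'" using DivD K1(3) by blast
        then have "rot (i - i') + b \<in> H k"
          using sgp_add[OF sgp_H rot_in_H] B_subset_H b_B by blast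
        then show False using notH eq by simp
      next
        case False
        have ii: "k dvd i + i'" using rot_letter_rot[OF K1(1) less.prems(2) K1(2,3) yB False in1] .
        have "rot (- (i + i')) \<in> H k" using ii by (metis dvd_minus_iff rot_in_H)
        then have "rot i + (y + rot i') + rot (- (i + i')) \<in> sec1 K" using in1 HK1 sgp_add[OF K1(1)] by blast
        then have in2: "rot i + (y + rot (- i)) \<in> sec1 K" by simp
        have "rot i + (y + rot (- i)) \<in> H k"
        proof (cases "y = 0")
          case True
          then show ?thesis using sgp_0[OF sgp_H] by simp
        next
          case False
          then have "k dvd i" using conj_letter[OF K1(1) less.prems(2) K1(2,3,4) yB _ in2] by simp
          then show ?thesis using yB B_subset_H
            by (intro sgp_add[OF sgp_H] rot_in_H) auto
        qed
        then have "rot i + (y + rot (- i)) + rot (i + i') \<in> H k" by (rule sgp_add[OF sgp_H _ rot_in_H[OF ii]])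
        then show False using notH by simp
      qed
    qed
  qed
  show ?case
  proof (cases "active (d + (?h + d'))")
    case False
    then show ?thesis using shift[OF less.prems(9) _ less.prems(7)] by simp
  next
    case True
    have "sref k + d \<in> D 1" using less.prems(7)
      by (intro sgp_add[OF sgp_D]) (simp_all add: sref_def rot_b_in_D)
    moreover have "sref k + (d + (?h + d')) \<in> K" by (rule sgp_add[OF less.prems(1) sk less.prems(9)])
    moreover have "\<not> active (sref k + (d + (?h + d')))"
      using True less.prems(2) active_add[of "sref k" "d + (?h + d')"] active_sref[of k] by blast
    moreover have "sref k + (d + (?h + d')) = (sref k + d) + (?h + d')" by (rule taut_assoc[symmetric])
    ultimately have "sref k + (d + (?h + d')) \<in> H k" using shift by blast
    then show ?thesis using sgp_add_left[OF sgp_H sref_in_H] by blast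
  qed
qed

lemma eq_H_if_Div:
  assumes "sgp K" "odd k" "H k \<subseteq> K" "K \<subseteq> G" "Div k K"
  shows "K = H k"
proof
  show "K \<subseteq> H k"
  proof
    fix g assume "g \<in> K"
    then have "g \<in> G" using assms by auto
    then obtain w where "valid w" "g = ev aT w" by (auto simp: gen_def)
    then show "g \<in> H k"
      using subset_H_if_Div[OF assms, of w 0 0] sgp_0[OF sgp_D] \<open>g \<in> K\<close> by simp
  qed
qed (rule assms)

text \<open>For the least odd \<open>k\<close> with \<open>rot k\<close> in some member of the
  family, pass to members that contain first \<open>b\<close> as well and then all of
  \<open>B\<close>.\<close>

theorem dense_Fam_H:
  assumes M: "dense M"
  obtains k where "odd k" "0 < k" "Fam M (H k)"
proof -
  define Q where "Q n \<longleftrightarrow> odd n \<and> 0 < n \<and> (\<exists>K. Fam M K \<and> rot (int n) \<in> K)" for n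
  obtain K1 k1 where "Fam M K1" "odd k1" "0 < k1" "rot k1 \<in> K1" using ex_rot_in_Fam[OF M] .
  then have "Q (nat k1)" by (auto simp: Q_def even_nat_iff)
  define n where "n = (LEAST n. Q n)"
  define k where "k = int n"
  have Qn: "Q n" unfolding n_def using \<open>Q (nat k1)\<close> by (rule LeastI)
  have min: "n \<le> i" if "Q i" for i unfolding n_def using that by (rule Least_le)
  have k: "odd k" "0 < k" using Qn by (auto simp: Q_def k_def)
  have sg: "sgp K" "K \<subseteq> G" "dense K" if "Fam M K" for K
    using Fam_dense[OF that M] by (auto simp: dense_def)
  \<comment> \<open>The greatest common divisor of \<open>k\<close> and \<open>s\<close> is again
    odd and its rotation lies in \<open>K\<close>, so minimality forces it to be
    \<open>k\<close>.\<close>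
  have dv: "k dvd s" if K: "Fam M K" "rot k \<in> K" "rot s \<in> K" for K s
  proof -
    obtain u v where uv: "u * k + v * s = gcd k s" using bezout_int by blast
    have "rot (k * u) + rot (s * v) \<in> K" 
      by (rule sgp_add[OF sg(1)[OF K(1)] rot_in_sgp[OF sg(1)[OF K(1)] K(2)] rot_in_sgp[OF sg(1)[OF K(1)] K(3)]])
    then have "rot (gcd k s) \<in> K" using uv by (simp add: mult.commute)
    moreover have "odd (gcd k s)" "0 < gcd k s" using k by auto
    ultimately have "Q (nat (gcd k s))" using K by (auto simp: Q_def even_nat_iff)
    then have "n \<le> nat (gcd k s)" by (rule min)
    then have "k \<le> gcd k s" by (simp add: k_def le_nat_iff)
    moreover have "gcd k s \<le> k" using k by (simp add: zdvd_imp_le)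
    ultimately show ?thesis by (metis antisym gcd_dvd2)
  qed
  have Div: "Div k K" if K: "Fam M K" "rot k \<in> K" for K
    unfolding Div_def using dv[OF Fam_secn[OF K(1)]] rot_in_secn[OF sg(1)[OF K(1)] K(2)] by blast
  obtain K0 where K0: "Fam M K0" "rot k \<in> K0" using Qn by (auto simp: Q_def k_def)
  have letter: "\<exists>j x i. x \<in> B \<and> x \<notin> rpow j ` Y \<and> rot i + (x + rot (- i)) \<in> secn j K"
    if K: "Fam M K" "rot k \<in> K" and Y: "Y \<subseteq> B" "\<And>x y. x \<in> Y \<Longrightarrow> y \<in> Y \<Longrightarrow> x + y \<in> Y" "b \<in> Y"
      "Y \<noteq> B" for K Y
  proof -
    obtain x0 where x0: "x0 \<in> B" "x0 \<notin> Y" using Y by blast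
    obtain h where h: "h \<in> K" "vec h = x0" using sg(3)[OF K(1)] x0 unfolding dense_def by metis
    then have "h \<in> G" using sg(2)[OF K(1)] by auto
    then obtain w where w: "valid w" "h = ev aT w" by (auto simp: gen_def)
    have "\<exists>j x i i'. x \<in> B \<and> x \<notin> rpow j ` Y \<and> rot i + (x + rot i') \<in> secn j K"
      using contract_to_letter[OF sg(1)[OF K(1)] k(1) K(2) w(1) sgp_0[OF sgp_D] sgp_0[OF sgp_D] _ Y(1,2,3)]
        h w x0 by simp
    then obtain j x i i' where x: "x \<in> B" "x \<notin> rpow j ` Y" "rot i + (x + rot i') \<in> secn j K" by blast
    have rb: "rpow j b = b" by (induction j) (simp_all add: rpow_Suc)
    have "x \<noteq> b" using x(2) Y(3) rb by force
    have Kj: "Fam M (secn j K)" "rot k \<in> secn j K"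
      using Fam_secn[OF K(1)] rot_in_secn[OF sg(1)[OF K(1)] K(2)] by auto
    then have "k dvd i + i'"
      using rot_letter_rot[OF sg(1)[OF Kj(1)] k(1) Kj(2) Div[OF Kj] x(1) \<open>x \<noteq> b\<close> x(3)] by simp
    then have "rot (- (i + i')) \<in> secn j K" using rot_in_sgp[OF sg(1)[OF Kj(1)] Kj(2)]
      by (metis dvdE dvd_minus_iff)
    then have "rot i + (x + rot i') + rot (- (i + i')) \<in> secn j K" using sgp_add[OF sg(1)[OF Kj(1)] x(3)] by blast
    then show ?thesis using x by (intro exI[of _ j] exI[of _ x] exI[of _ i]) simp
  qed
  obtain K2 where K2: "Fam M K2" "rot k \<in> K2" "b \<in> K2"
  proof -
    \<comment> \<open>The kernel element \<open>c\<close> shows that \<open>{0, b}\<close> is a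
      proper subset of \<open>B\<close>, so \<open>letter\<close> yields a letter outside it, which
      becomes a reflection.\<close>
    obtain c where c: "c \<in> B" "c \<noteq> 0" "\<not> om c" using ker_om by blast
    have ne: "{0, b} \<noteq> B" using c om_b by auto
    have cl: "x + y \<in> {0, b}" if "x \<in> {0, b}" "y \<in> {0, b}" for x y using that by auto
    have sub: "{0, b} \<subseteq> B" "b \<in> {0, b}" by simp_all
    obtain j x i where x: "x \<in> B" "x \<notin> rpow j ` {0, b}" "rot i + (x + rot (- i)) \<in> secn j K0"
      using letter[OF K0 sub(1) cl sub(2) ne] by blast
    have Kj: "Fam M (secn j K0)" "rot k \<in> secn j K0"
      using Fam_secn[OF K0(1)] rot_in_secn[OF sg(1)[OF K0(1)] K0(2)] by auto
    have "x \<noteq> 0" using x(2) by auto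
    then obtain j' s where s: "rot s + b \<in> secn j' (secn j K0)"
      using reflection_from_letter[OF sg(1)[OF Kj(1)] k(1) Kj(2) x(1) _ x(3)] by blast
    define L where "L = secn j' (secn j K0)"
    have L: "Fam M L" "rot k \<in> L" "rot s + b \<in> L"
      using Fam_secn[OF Kj(1)] rot_in_secn[OF sg(1)[OF Kj(1)] Kj(2)] s by (auto simp: L_def)
    \<comment> \<open>A reflection with even index \<open>2 * u\<close> is conjugate to
      \<open>b\<close> by \<open>rot u\<close>; multiples of \<open>k\<close> make the index
      even.\<close>
    obtain e where "even (s + k * e)" using even_shift[OF k(1)] by metis
    then obtain u where u: "s + k * e = 2 * u" by (elim evenE)
    have "rot (k * e) + (rot s + b) \<in> L" 
      by (rule sgp_add[OF sg(1)[OF L(1)] rot_in_sgp[OF sg(1)[OF L(1)] L(2)] L(3)])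
    then have u2: "rot (2 * u) + b \<in> L" using u by (simp add: add.commute)
    have "b \<in> conjs (rot (- u)) L" using u2 by (simp add: mem_conjs)
    moreover have "rot k \<in> conjs (rot (- u)) L" using L by (simp add: mem_conjs)
    ultimately show ?thesis using that Fam.conj[OF L(1), of "rot (- u)"] by simp
  qed
  \<comment> \<open>The elements of \<open>B\<close> whose rho-iterates eventually enter the section
    subgroups. A letter found outside this set would enter them as well.\<close>
  define Y where "Y = {x \<in> B. \<exists>j. rpow j x \<in> secn j K2}"
  have up: "rpow j' x \<in> secn j' K2" if "x \<in> B" "rpow j x \<in> secn j K2" "j \<le> j'" for x j j'
    using that(3)
  proof (induction rule: dec_induct)
    case (step i)
    then show ?case using B_in_sec1[of "rpow i x" "secn i K2"] that(1) by (simp add: rpow_Suc' secn_Suc')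
  qed (use that in simp)
  have Kj: "Fam M (secn j K2)" "rot k \<in> secn j K2" "sgp (secn j K2)" for j
    using Fam_secn[OF K2(1)] rot_in_secn[OF sg(1)[OF K2(1)] K2(2)] by auto
  have bK: "b \<in> secn j K2" for j
    by (induction j) (use K2 B_in_sec1[OF b_B] in \<open>simp_all add: secn_Suc'\<close>)
  have "Y = B"
  proof (rule ccontr)
    assume "Y \<noteq> B"
    moreover have "x + y \<in> Y" if "x \<in> Y" "y \<in> Y" for x y
    proof -
      from that obtain i j where x: "x \<in> B" "rpow i x \<in> secn i K2" and y: "y \<in> B" "rpow j y \<in> secn j K2"
        by (auto simp: Y_def)
      have "rpow (max i j) (x + y) \<in> secn (max i j) K2"
        using up[OF x, of "max i j"] up[OF y, of "max i j"] sgp_add[OF Kj(3)] x y by (simp add: rpow_add)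
      then show ?thesis using x y add_B by (auto simp: Y_def)
    qed
    moreover have "b \<in> Y" using K2 unfolding Y_def by (auto intro!: exI[of _ 0])
    moreover have "Y \<subseteq> B" by (auto simp: Y_def)
    ultimately obtain j x i where x: "x \<in> B" "x \<notin> rpow j ` Y" "rot i + (x + rot (- i)) \<in> secn j K2"
      using letter[OF K2(1,2), of Y] by blast
    have "0 \<in> Y" using sgp_0[OF sg(1)[OF K2(1)]] by (auto simp: Y_def intro!: exI[of _ 0])
    then have "x \<noteq> 0" using x(2) by (metis image_eqI rpow_zero)
    then have "k dvd i"
      using conj_letter[OF Kj(3) k(1) Kj(2) Div[OF Kj(1,2)] bK x(1) _ x(3)] by simp
    then have r: "rot i \<in> secn j K2" using rot_in_sgp[OF Kj(3,2)] by (elim dvdE) simp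
    have "- rot i + (rot i + (x + rot (- i))) + rot i \<in> secn j K2"
      by (rule sgp_add[OF Kj(3) sgp_add[OF Kj(3) sgp_minus[OF Kj(3) r] x(3)] r])
    then have "x \<in> secn j K2" by simp
    moreover obtain y where "y \<in> B" "x = rpow j y" using x(1) rpow_image_B by blast
    ultimately show False using x(2) by (auto simp: Y_def)
  qed
  then have "\<forall>x\<in>B. \<exists>j. rpow j x \<in> secn j K2" by (auto simp: Y_def)
  \<comment> \<open>Entering is permanent (\<open>up\<close>) and \<open>B\<close> is finite, so one
    depth \<open>J\<close> serves all its elements, and rho permutes \<open>B\<close>.\<close>
  then obtain jj where jj: "\<And>x. x \<in> B \<Longrightarrow> rpow (jj x) x \<in> secn (jj x) K2" by metis
  define J where "J = Max (jj ` B)"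
  have "rpow J x \<in> secn J K2" if "x \<in> B" for x
    using up[OF that jj[OF that], of J] that finite_B by (simp add: J_def)
  then have "rpow J ` B \<subseteq> secn J K2" by (rule image_subsetI)
  then have "B \<subseteq> secn J K2" by (simp only: rpow_image_B)
  then have "H k \<subseteq> secn J K2" using H_subset Kj by blast
  then have "secn J K2 = H k"
    using eq_H_if_Div[OF Kj(3) k(1) _ _ Div[OF Kj(1,2)]] sg(2)[OF Kj(1)] by blast
  then show ?thesis using that k Kj(1)[of J] by simp
qed

end

section \<open>Normal subgroups\<close>

primrec moves :: "nat \<Rightarrow> taut \<Rightarrow> bool" where
  "moves 0 g = active g"
| "moves (Suc n) g = (\<exists>c. moves n (sec c g))"

lemma ex_moves:
  assumes "g \<noteq> 0"
  obtains n where "moves n g"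
proof -
  have "\<exists>n. moves n g"
  proof (rule ccontr)
    assume n: "\<nexists>n. moves n g"
    have "g = 0"
    proof (rule taut_eq_0I[where X = "{g. \<forall>n. \<not> moves n g}"])
      fix h c assume h: "h \<in> {g. \<forall>n. \<not> moves n g}"
      show "\<not> active h" using h moves.simps(1) by blast
      show "sec c h \<in> {g. \<forall>n. \<not> moves n g}" using h moves.simps(2) by blast
    qed (use n in blast)
    then show False using assms by blast
  qed
  then show ?thesis using that by blast
qed

definition comm :: "taut \<Rightarrow> taut \<Rightarrow> taut" where "comm x y = x + y + - x + - y"

lemma minus_comm: "- comm x y = comm y x" by (simp add: comm_def)

lemma comm_pr: "comm (pr u v) (pr u' v') = pr (comm u u') (comm v v')"
  by (simp add: comm_def pr_add minus_pr)

context sunic_group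
begin

definition nsg :: "taut set \<Rightarrow> bool" where
  "nsg Q \<longleftrightarrow> sgp Q \<and> Q \<subseteq> G \<and> (\<forall>g\<in>G. \<forall>q\<in>Q. g + q + - g \<in> Q)"

lemma nsg_sgp: "nsg Q \<Longrightarrow> sgp Q" and nsg_G: "nsg Q \<Longrightarrow> q \<in> Q \<Longrightarrow> q \<in> G"
  and nsg_conj: "nsg Q \<Longrightarrow> g \<in> G \<Longrightarrow> q \<in> Q \<Longrightarrow> g + q + - g \<in> Q"
  by (auto simp: nsg_def)

lemma nsg_conj': "nsg Q \<Longrightarrow> g \<in> G \<Longrightarrow> q \<in> Q \<Longrightarrow> - g + (q + g) \<in> Q"
  using nsg_conj[OF _ G_minus, of Q g q] by simp

lemma nsg_conj_iff: "nsg Q \<Longrightarrow> g \<in> G \<Longrightarrow> g + q + - g \<in> Q \<longleftrightarrow> q \<in> Q"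
  using nsg_conj[of Q g q] nsg_conj'[of Q g "g + q + - g"] by auto

lemma nsgI:
  assumes "sgp Q" "Q \<subseteq> G" "\<And>g q. g \<in> G \<Longrightarrow> q \<in> Q \<Longrightarrow> g + q + - g \<in> Q"
  shows "nsg Q"
  using assms by (simp add: nsg_def)

lemma nsg_comm:
  assumes "nsg Q" "q \<in> Q" "g \<in> G"
  shows "comm q g \<in> Q" "comm g q \<in> Q"
proof -
  have "q + (g + - q + - g) \<in> Q"
    by (rule sgp_add[OF nsg_sgp[OF assms(1)] assms(2) nsg_conj[OF assms(1,3) sgp_minus[OF nsg_sgp[OF assms(1)] assms(2)]]])
  then show "comm q g \<in> Q" by (simp add: comm_def)
  have "(g + q + - g) + - q \<in> Q"
    by (rule sgp_add[OF nsg_sgp[OF assms(1)] nsg_conj[OF assms(1,3,2)] sgp_minus[OF nsg_sgp[OF assms(1)] assms(2)]])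
  then show "comm g q \<in> Q" by (simp add: comm_def)
qed

text \<open>Index at most 2: any two elements outside \<open>Q\<close> lie in the same
  coset.\<close>

definition idx2 :: "taut set \<Rightarrow> taut set \<Rightarrow> bool" where
  "idx2 Q P \<longleftrightarrow> Q \<subseteq> P \<and> (\<forall>x\<in>P - Q. \<forall>y\<in>P - Q. x + - y \<in> Q)"

lemma idx2_add_iff:
  assumes "sgp P" "sgp Q" "idx2 Q P" "x \<in> P" "y \<in> P"
  shows "x + y \<in> Q \<longleftrightarrow> (x \<in> Q \<longleftrightarrow> y \<in> Q)"
proof (cases "x \<in> Q")
  case True
  then show ?thesis using sgp_add_left[OF assms(2)] by simp
next
  case x: False
  show ?thesis
  proof (cases "y \<in> Q")
    case True
    then show ?thesis using sgp_add_right[OF assms(2)] x by simp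
  next
    case False
    then have "- y \<in> P - Q" using assms sgp_minus sgp_minus_iff by auto
    then have "x + - (- y) \<in> Q" using assms(3,4) x unfolding idx2_def by blast
    then show ?thesis using x False by simp
  qed
qed

text \<open>By \<open>idx2_add_iff\<close>, non-membership is a homomorphism to the group of order
  2, hence depends on the class of \<open>g\<close> only.\<close>

lemma idx2_class:
  assumes "sgp S" "S \<subseteq> G" "idx2 S G" "g \<in> G"
  shows "g \<in> S \<longleftrightarrow> vec g + (if active g then aT else 0) \<in> S"
  using assms(4)
proof (induction rule: gen_induct)
  case (s g)
  note p = idx2_add_iff[OF sgp_G assms(1,3)]
  have "vec g \<in> G" using s vec_in_B G_B by auto
  then have "vec g + aT \<in> S \<longleftrightarrow> (vec g \<in> S \<longleftrightarrow> aT \<in> S)" "aT + g \<in> S \<longleftrightarrow> (aT \<in> S \<longleftrightarrow> g \<in> S)"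
    using p s G_a by auto
  moreover have "vec (aT + g) = vec g" using s vec_in_B by (simp add: vec_add G_a)
  ultimately show ?case using s by (cases "active g") auto
next
  case (B x g)
  note p = idx2_add_iff[OF sgp_G assms(1,3)]
  have "vec g + (if active g then aT else 0) \<in> G"
    using B vec_in_B G_B G_a G_0 by (auto intro!: G_add)
  then have "x + (vec g + (if active g then aT else 0)) \<in> S \<longleftrightarrow>
      (x \<in> S \<longleftrightarrow> vec g + (if active g then aT else 0) \<in> S)"
    "x + g \<in> S \<longleftrightarrow> (x \<in> S \<longleftrightarrow> g \<in> S)"
    using p B G_B by auto
  moreover have "vec (x + g) = x + vec g" "active (x + g) = active g"
    using B by (auto simp: vec_add G_B inactive_B)
  ultimately show ?case using B by simp
qed simp

lemma idx2_dense:
  assumes "sgp S" "S \<subseteq> G" "idx2 S G" "dense M" "M \<subseteq> S"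
  shows "S = G"
proof
  show "G \<subseteq> S"
  proof
    fix g assume g: "g \<in> G"
    then obtain m where m: "m \<in> M" "active m = active g" "vec m = vec g"
      using assms(4) vec_in_B unfolding dense_def by metis
    then have "m \<in> S" "m \<in> G" using assms by auto
    then show "g \<in> S" using idx2_class[OF assms(1-3) g] idx2_class[OF assms(1-3), of m] m by simp
  qed
qed (rule assms)

text \<open>These are the normal subgroups of 2-power index.\<close>

inductive cof :: "taut set \<Rightarrow> bool" where
  top: "cof G"
| step: "cof P \<Longrightarrow> nsg Q \<Longrightarrow> idx2 Q P \<Longrightarrow> cof Q"

lemma nsg_G_self: "nsg G"
  by (rule nsgI) (auto simp: sgp_G intro!: G_add G_minus)

lemma cof_nsg: "cof Q \<Longrightarrow> nsg Q"
  by (cases rule: cof.cases) (auto simp: nsg_G_self)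

text \<open>If \<open>G\<close> is the product of \<open>M\<close> and \<open>P\<close>, and
  \<open>Q\<close> has index at most 2 in \<open>P\<close>, then the product of \<open>M\<close> and
  \<open>Q\<close> is a subgroup of index at most 2 in \<open>G\<close> which contains a dense
  subgroup.\<close>

lemma cof_dense_decomp:
  assumes "cof Q" "dense M" "g \<in> G"
  shows "\<exists>m\<in>M. \<exists>q\<in>Q. g = m + q"
  using assms(1,3)
proof (induction arbitrary: g rule: cof.induct)
  case top
  then show ?case using sgp_0[of M] assms(2) unfolding dense_def by (metis add_0_left)
next
  case (step P Q)
  have M: "sgp M" "M \<subseteq> G" using assms(2) by (auto simp: dense_def)
  note Q = nsg_sgp[OF step.hyps(2)]
  define S where "S = {m + q | m q. m \<in> M \<and> q \<in> Q}"
  have SI: "m + q \<in> S" if "m \<in> M" "q \<in> Q" for m q using that by (auto simp: S_def)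
  have "S = G"
  proof (rule idx2_dense)
    show "sgp S"
    proof (rule sgpI)
      show "0 \<in> S" using SI[OF sgp_0[OF M(1)] sgp_0[OF Q]] by simp
      show "g + h \<in> S" if "g \<in> S" "h \<in> S" for g h
      proof -
        from that obtain m q m' q' where g: "m \<in> M" "q \<in> Q" "g = m + q" "m' \<in> M" "q' \<in> Q" "h = m' + q'"
          by (auto simp: S_def)
        have "- m' + (q + m') + q' \<in> Q"
          by (rule sgp_add[OF Q nsg_conj'[OF step.hyps(2) subsetD[OF M(2) g(4)] g(2)] g(5)])
        moreover have "g + h = (m + m') + (- m' + (q + m') + q')" using g by simp
        ultimately show ?thesis using SI sgp_add[OF M(1)] g by metis
      qed
      show "- g \<in> S" if "g \<in> S" for g
      proof -
        from that obtain m q where g: "m \<in> M" "q \<in> Q" "g = m + q" by (auto simp: S_def)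
        have "m + - q + - m \<in> Q"
          by (rule nsg_conj[OF step.hyps(2) subsetD[OF M(2) g(1)] sgp_minus[OF Q g(2)]])
        moreover have "- g = - m + (m + - q + - m)" using g by simp
        ultimately show ?thesis using SI sgp_minus[OF M(1)] g by metis
      qed
    qed
    show "S \<subseteq> G" using M nsg_G[OF step.hyps(2)] by (auto simp: S_def intro!: G_add)
    show "M \<subseteq> S" using SI[OF _ sgp_0[OF Q]] by force
    show "idx2 S G"
      unfolding idx2_def
    proof (intro conjI ballI)
      fix x y assume x: "x \<in> G - S" and y: "y \<in> G - S"
      obtain m p where m: "m \<in> M" "p \<in> P" "x = m + p" using step.IH x by blast
      obtain m' p' where m': "m' \<in> M" "p' \<in> P" "y = m' + p'" using step.IH y by blast
      have "p \<notin> Q" "p' \<notin> Q" using x y m m' SI by auto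
      then have "p + - p' \<in> Q" using step.hyps(3) m m' unfolding idx2_def by blast
      then have "m' + (p + - p') + - m' \<in> Q" using m' M nsg_conj[OF step.hyps(2)] by blast
      from SI[OF sgp_add[OF M(1) m(1) sgp_minus[OF M(1) m'(1)]] this]
      show "x + - y \<in> S" using m m' by simp
    qed fact
  qed (rule assms(2))
  then have "g \<in> S" using step.prems by simp
  then show ?case unfolding S_def by blast
qed

lemma dense_eq_G: "cof Q \<Longrightarrow> dense M \<Longrightarrow> Q \<subseteq> M \<Longrightarrow> M = G"
proof
  assume Q: "cof Q" "dense M" "Q \<subseteq> M"
  show "G \<subseteq> M"
  proof
    fix g assume "g \<in> G"
    then obtain m q where "m \<in> M" "q \<in> Q" "g = m + q" using cof_dense_decomp Q by blast
    then show "g \<in> M" using Q by (auto simp: dense_def intro: sgp_add)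
  qed
qed (simp add: dense_def)

definition lift :: "taut set \<Rightarrow> taut set" where
  "lift Q = {g \<in> G. \<not> active g \<and> sec False g \<in> Q \<and> sec True g \<in> Q}"

lemma sec_conj:
  "\<not> active q \<Longrightarrow> sec c (g + q + - g) = sec (c \<noteq> active g) g + sec (c \<noteq> active g) q + - sec (c \<noteq> active g) g"
  by (cases c; cases "active g") simp_all

lemma nsg_lift: "nsg Q \<Longrightarrow> nsg (lift Q)"
proof (rule nsgI)
  assume Q: "nsg Q"
  show "sgp (lift Q)"
    by (rule sgpI) (auto simp: lift_def G_0 G_add G_minus sgp_0[OF nsg_sgp[OF Q]] sgp_add[OF nsg_sgp[OF Q]] sgp_minus[OF nsg_sgp[OF Q]])
  show "lift Q \<subseteq> G" by (auto simp: lift_def)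
  show "g + q + - g \<in> lift Q" if "g \<in> G" "q \<in> lift Q" for g q
  proof -
    have "sec c q \<in> Q" for c using that by (cases c) (auto simp: lift_def)
    then have "sec c (g + q + - g) \<in> Q" for c
      using that nsg_conj[OF Q sec_in_G[OF that(1)]] by (subst sec_conj) (auto simp: lift_def)
    then show ?thesis using that unfolding lift_def by (auto simp: G_add G_minus simp del: sec_add)
  qed
qed

lemma cof_lift: "cof Q \<Longrightarrow> cof (lift Q)"
proof (induction rule: cof.induct)
  case top
  show ?case
    by (rule cof.step[OF cof.top nsg_lift[OF nsg_G_self]])
      (auto simp: idx2_def lift_def sec_in_G G_add G_minus)
next
  case (step P Q)
  have sP: "sgp P" and sQ: "sgp Q" and nP: "nsg P"
    using step nsg_sgp cof_nsg by auto
  note par = idx2_add_iff[OF sP sQ step.hyps(3)]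
  have QP: "Q \<subseteq> P" using step.hyps(3) by (simp add: idx2_def)
  \<comment> \<open>The elements whose two sections agree modulo \<open>Q\<close> form a normal
    subgroup between \<open>lift Q\<close> and \<open>lift P\<close>, with index at most 2 on either
    side.\<close>
  define R where "R = {g \<in> lift P. sec False g \<in> Q \<longleftrightarrow> sec True g \<in> Q}"
  have nR: "nsg R"
  proof (rule nsgI)
    note s = nsg_sgp[OF nsg_lift[OF nP]]
    show "sgp R"
    proof (rule sgpI)
      show "0 \<in> R" using sgp_0[OF s] by (simp add: R_def)
      show "g + h \<in> R" if "g \<in> R" "h \<in> R" for g h
        using that sgp_add[OF s, of g h] by (auto simp: R_def lift_def par)
      show "- g \<in> R" if "g \<in> R" for g
        using that sgp_minus[OF s, of g] by (auto simp: R_def lift_def sgp_minus_iff[OF sQ])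
    qed
    show "R \<subseteq> G" by (auto simp: R_def lift_def)
    show "g + q + - g \<in> R" if "g \<in> G" "q \<in> R" for g q
    proof -
      have na: "\<not> active q" using that by (auto simp: R_def lift_def)
      define x where "x = g + q + - g"
      have e: "sec c x \<in> Q \<longleftrightarrow> sec (c \<noteq> active g) q \<in> Q" for c
        unfolding x_def sec_conj[OF na] by (rule nsg_conj_iff[OF step.hyps(2) sec_in_G[OF that(1)]])
      have "x \<in> lift P" unfolding x_def using that by (intro nsg_conj[OF nsg_lift[OF nP]]) (simp_all add: R_def)
      moreover have "sec False q \<in> Q \<longleftrightarrow> sec True q \<in> Q" using that(2) by (simp add: R_def)
      then have "sec False x \<in> Q \<longleftrightarrow> sec True x \<in> Q"
        using e[of False] e[of True] by (cases "active g") simp_all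
      ultimately show ?thesis unfolding R_def x_def by blast
    qed
  qed
  have "idx2 R (lift P)"
    unfolding idx2_def
  proof (intro conjI ballI)
    fix x y assume x: "x \<in> lift P - R" "y \<in> lift P - R"
    then have "x + - y \<in> lift P"
      by (auto intro: sgp_add[OF nsg_sgp[OF nsg_lift[OF nP]]] sgp_minus[OF nsg_sgp[OF nsg_lift[OF nP]]])
    then show "x + - y \<in> R"
      using x by (auto simp: R_def lift_def par sgp_minus[OF sP] sgp_minus_iff[OF sQ])
  qed (auto simp: R_def)
  with cof.step[OF step.IH nR] have "cof R" .
  moreover have "idx2 (lift Q) R"
    unfolding idx2_def
  proof (intro conjI ballI)
    fix x y assume x: "x \<in> R - lift Q" "y \<in> R - lift Q"
    then have "x + - y \<in> R" by (auto intro: sgp_add[OF nsg_sgp[OF nR]] sgp_minus[OF nsg_sgp[OF nR]])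
    moreover have "sec False x \<notin> Q" "sec False y \<notin> Q" using x by (auto simp: R_def lift_def)
    ultimately show "x + - y \<in> lift Q"
      using x by (auto simp: R_def lift_def par sgp_minus[OF sP] sgp_minus_iff[OF sQ])
  qed (use QP in \<open>auto simp: R_def lift_def\<close>)
  ultimately show ?case using cof.step nsg_lift[OF step.hyps(2)] by blast
qed

definition G0 :: "taut set" where "G0 = {g \<in> G. \<not> active g \<and> vec g = 0}"

text \<open>The kernel of the abelianization is cut out by the homomorphisms \<open>al j\<close>,
  each an index step of at most 2; finitely many suffice because \<open>B\<close> is finite.\<close>

lemma cof_G0: "cof G0"
proof -
  define Q where "Q i = {g \<in> G. \<forall>j<i. \<not> al j g}" for i
  have n: "nsg (Q i)" for i
    by (rule nsgI) (auto simp: Q_def G_0 G_add G_minus intro!: sgpI)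
  have "cof (Q i)" for i
  proof (induction i)
    case 0
    then show ?case using cof.top by (simp add: Q_def)
  next
    case (Suc i)
    show ?case by (rule cof.step[OF Suc n]) (auto simp: idx2_def Q_def less_Suc_eq G_add G_minus)
  qed
  moreover have "\<exists>i. Q i = G0"
  proof -
    have "\<forall>x\<in>B. \<exists>j. x \<noteq> 0 \<longrightarrow> om (rpow j x)" using eq_0_if_not_om by blast
    then obtain jj where jj: "\<And>x. x \<in> B \<Longrightarrow> x \<noteq> 0 \<Longrightarrow> om (rpow (jj x) x)" by metis
    \<comment> \<open>One successor because \<open>om (rpow j x)\<close> is read on level
      \<open>Suc j\<close>, level 0 being \<open>active\<close>; the other because
      \<open>Q J\<close> uses levels strictly below \<open>J\<close>.\<close>
    define J where "J = Suc (Suc (Max (jj ` B)))"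
    have "g \<in> Q J \<longleftrightarrow> g \<in> G0" for g
    proof
      assume g: "g \<in> Q J"
      then have gG: "g \<in> G" and na: "\<not> active g"
        and al: "\<And>j. j < J \<Longrightarrow> \<not> al j g" by (auto simp: Q_def J_def dest: spec[of _ 0])
      have "vec g = 0"
      proof (rule ccontr)
        assume "vec g \<noteq> 0"
        then have o: "om (rpow (jj (vec g)) (vec g))" using jj vec_in_B gG by blast
        have "jj (vec g) \<le> Max (jj ` B)" using finite_B vec_in_B gG by simp
        then have "\<not> al (Suc (jj (vec g))) g" using al by (simp add: J_def)
        then show False using o vec_props[OF gG] al_B by blast
      qed
      then show "g \<in> G0" using gG na by (simp add: G0_def)
    next
      assume g: "g \<in> G0"
      then have "\<not> al (Suc j) g" for j using vec_props[of g] al_0[of "Suc j"] by (auto simp: G0_def)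
      moreover have "\<not> al 0 g" using g by (simp add: G0_def)
      ultimately have "\<not> al j g" for j by (cases j) auto
      then show "g \<in> Q J" using g by (auto simp: Q_def G0_def)
    qed
    then show ?thesis by blast
  qed
  ultimately show ?thesis by metis
qed

text \<open>The elements of \<open>R\<close> acting on the right subtree only, read there; for
  \<open>sec1\<close> the left section is arbitrary.\<close>

definition sect :: "taut set \<Rightarrow> taut set" where "sect R = {h. pr 0 h \<in> R}"

lemma conj_a_pr [simp]: "aT + (pr u v + aT) = pr v u"
  by (rule taut_eqI) simp_all

lemma pr_swap_in_nsg: "nsg R \<Longrightarrow> pr u v \<in> R \<longleftrightarrow> pr v u \<in> R"
  using nsg_conj[of R aT "pr u v"] nsg_conj[of R aT "pr v u"] G_a by auto

lemma lift_subset_if: "nsg R \<Longrightarrow> Q \<subseteq> sect R \<Longrightarrow> lift Q \<subseteq> R"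
proof
  fix g assume R: "nsg R" "Q \<subseteq> sect R" and g: "g \<in> lift Q"
  then have "pr 0 (sec False g) \<in> R" "pr 0 (sec True g) \<in> R" by (auto simp: lift_def sect_def)
  then have "pr (sec False g) 0 + pr 0 (sec True g) \<in> R"
    using pr_swap_in_nsg[OF R(1)] sgp_add[OF nsg_sgp[OF R(1)]] by blast
  then show "g \<in> R" using g pr_eta[of g] by (simp add: lift_def pr_add)
qed

definition liftn :: "nat \<Rightarrow> taut set \<Rightarrow> taut set" where "liftn k = (lift ^^ k)"

lemma liftn_0 [simp]: "liftn 0 Q = Q" and liftn_Suc: "liftn (Suc k) Q = lift (liftn k Q)"
  by (simp_all add: liftn_def)

lemma lift_mono: "Q \<subseteq> R \<Longrightarrow> lift Q \<subseteq> lift R" by (auto simp: lift_def)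

lemma cof_liftn: "cof Q \<Longrightarrow> cof (liftn k Q)"
  by (induction k) (simp_all add: liftn_Suc cof_lift)

end

section \<open>The branching subgroup\<close>

context sunic_big
begin

lemma G_lift_True:
  assumes "g \<in> G"
  obtains h where "h \<in> G" "\<not> active h" "sec True h = g"
  using H_lift_True[of 1 g] assms H_1 by auto

lemma pr_conj:
  "\<not> active h \<Longrightarrow> h + pr u v + - h =
    pr (sec False h + u + - sec False h) (sec True h + v + - sec True h)"
  by (intro taut_eqI[of "_ + _"]) simp_all

lemma nsg_sect: "nsg R \<Longrightarrow> nsg (sect R)"
proof (rule nsgI)
  assume R: "nsg R"
  note s = nsg_sgp[OF R]
  show "sgp (sect R)"
  proof (rule sgpI)
    show "0 \<in> sect R" using sgp_0[OF s] by (simp add: sect_def)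
    show "g + h \<in> sect R" if "g \<in> sect R" "h \<in> sect R" for g h
      using sgp_add[OF s, of "pr 0 g" "pr 0 h"] that by (simp add: sect_def pr_add)
    show "- g \<in> sect R" if "g \<in> sect R" for g
      using sgp_minus[OF s, of "pr 0 g"] that by (simp add: sect_def minus_pr)
  qed
  show "sect R \<subseteq> G"
  proof
    fix h assume "h \<in> sect R"
    then have "sec True (pr 0 h) \<in> G" using nsg_G[OF R] by (intro sec_in_G) (auto simp: sect_def)
    then show "h \<in> G" by simp
  qed
  show "g + q + - g \<in> sect R" if g: "g \<in> G" and q: "q \<in> sect R" for g q
  proof -
    obtain h where h: "h \<in> G" "\<not> active h" "sec True h = g" using G_lift_True[OF g] .
    have "h + pr 0 q + - h \<in> R" using q by (intro nsg_conj[OF R h(1)]) (simp add: sect_def)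
    then show ?thesis using pr_conj[OF h(2), of 0 q] h(3) by (simp add: sect_def)
  qed
qed

lemma nsg_sec1: "nsg R \<Longrightarrow> nsg (sec1 R)"
proof (rule nsgI)
  assume R: "nsg R"
  show "sgp (sec1 R)" using nsg_sgp[OF R] by (rule sgp_sec1)
  show "sec1 R \<subseteq> G" using nsg_G[OF R] by (intro sec1_subset_G) auto
  show "g + q + - g \<in> sec1 R" if g: "g \<in> G" and q: "q \<in> sec1 R" for g q
  proof -
    obtain h where h: "h \<in> G" "\<not> active h" "sec True h = g" using G_lift_True[OF g] .
    obtain r where r: "r \<in> R" "\<not> active r" "q = sec True r" using q by (auto simp: sec1_def)
    have "h + r + - h \<in> R" using nsg_conj[OF R h(1) r(1)] .
    then have "sec True (h + r + - h) \<in> sec1 R" using h r by (intro sec1I) auto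
    then show ?thesis using h r by simp
  qed
qed

text \<open>Both orders of the commutator are listed to make the generating set closed under
  inversion.\<close>

definition N :: "taut set" where "N = ncl G (comm aT ` P \<union> (\<lambda>d. comm d aT) ` P)"

lemma N_subset: "nsg R \<Longrightarrow> (\<And>d. d \<in> P \<Longrightarrow> comm aT d \<in> R) \<Longrightarrow> N \<subseteq> R"
  unfolding N_def
proof (rule ncl_subset)
  assume R: "nsg R" and c: "\<And>d. d \<in> P \<Longrightarrow> comm aT d \<in> R"
  show "sgp R" using R by (rule nsg_sgp)
  fix x g assume x: "x \<in> comm aT ` P \<union> (\<lambda>d. comm d aT) ` P" and g: "g \<in> G"
  have "comm d aT \<in> R" if "d \<in> P" for d
    using sgp_minus[OF nsg_sgp[OF R] c[OF that]] by (simp add: minus_comm)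
  then have "x \<in> R" using x c by auto
  then show "g + x + - g \<in> R" using nsg_conj[OF R g] by blast
qed

lemma comm_aT_in_N: "d \<in> P \<Longrightarrow> comm aT d \<in> N" "d \<in> P \<Longrightarrow> comm d aT \<in> N"
  unfolding N_def by (auto intro: ncl_base[OF G_0])

lemma nsg_G0: "nsg G0" using cof_nsg cof_G0 by blast

lemma N_subset_G0: "N \<subseteq> G0"
proof (rule N_subset[OF nsg_G0])
  fix d assume "d \<in> P"
  then have d: "d \<in> B" "d \<in> G" using P_B G_B by auto
  then have "vec (comm aT d) = 0" using invol_B by (simp add: comm_def vec_add G_a G_add)
  moreover have "comm aT d \<in> G" using d by (simp add: comm_def G_add G_a)
  ultimately show "comm aT d \<in> G0" using d by (simp add: G0_def comm_def inactive_B)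
qed

lemma N_subset_G: "N \<subseteq> G" using N_subset_G0 by (auto simp: G0_def)

lemma nsg_N: "nsg N"
proof (rule nsgI)
  show "sgp N" unfolding N_def by (rule sgp_ncl) (auto simp: minus_comm)
  show "g + q + - g \<in> N" if "g \<in> G" "q \<in> N" for g q
    using that unfolding N_def by (intro ncl_conj[OF sgp_G])
qed (rule N_subset_G)

text \<open>Modulo \<open>N\<close>, an element of \<open>P\<close> commutes with \<open>a\<close>
  by definition and with \<open>B\<close> because \<open>B\<close> is abelian. As \<open>p\<close>
  is its own inverse, the element is a commutator.\<close>

lemma G_centralises_P_mod_N:
  assumes "g \<in> G" "p \<in> P"
  shows "p + (- g + (p + g)) \<in> N"
  using assms
proof (induction arbitrary: p rule: gen_induct)
  case zero
  then show ?case using sgp_0[OF nsg_sgp[OF nsg_N]] P_B by (simp add: invol_B)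
next
  case (s g)
  have pB: "p \<in> B" using s P_B by simp
  have "- g + (comm p aT + g) \<in> N"
    using nsg_conj'[OF nsg_N s.hyps comm_aT_in_N(2)[OF s.prems]] .
  then have "(p + (- g + (p + g))) + (- g + (comm p aT + g)) \<in> N"
    using sgp_add[OF nsg_sgp[OF nsg_N] s.IH[OF s.prems]] by blast
  then show ?case using pB by (simp add: comm_def)
next
  case (B x g)
  have pB: "p \<in> B" using B P_B by simp
  have "- x + (p + x) = p" using B pB add_comm_B[of p x] by simp
  then have "- (x + g) + (p + (x + g)) = - g + (p + g)" using B by (metis taut_assoc taut_minus_add)
  then show ?case using B.IH[OF B.prems] by simp
qed

text \<open>The factorisation \<open>ab = u d\<close> of \<open>rot_4_in_Np\<close> is reused.
  Modulo \<open>N\<close>, \<open>d\<close> is an involution commuting with \<open>u\<close>, so the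
  square of \<open>ab\<close> is that of \<open>u\<close>, whose own square is trivial.\<close>

lemma rot_4_in_N: "rot (4 * j) \<in> N"
proof -
  obtain d where d: "d \<in> P" "om d" by (rule ex_P_om)
  define e where "e = d + b"
  have dB: "d \<in> B" using d P_B by simp
  then have e: "e \<in> Ker" "e \<in> B" using d by (auto simp: e_def Ker_def add_B om_add om_b)
  define u where "u = aT + e"
  define r where "r = sec True e"
  have rr: "r + r = 0" using e by (simp add: r_def rho_B invol_B)
  have "aT + (e + aT) = pr r 0" using Ker_pr[OF e(1)] by (metis conj_a_pr r_def)
  then have "u + u = pr r 0 + e" by (simp add: u_def flip: taut_assoc)
  also have "\<dots> = pr r r" using Ker_pr[OF e(1)] by (metis add.right_neutral add_0_left pr_add r_def)
  finally have uu: "u + u = pr r r" .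
  then have u4: "(u + u) + (u + u) = 0" using rr by (simp add: pr_add)
  have uG: "u \<in> G" using e G_B G_a G_add by (simp add: u_def)
  have "e + d = b" using dB add_comm_B[OF b_B dB] by (simp add: e_def)
  then have r1: "rot 1 = u + d" by (simp add: u_def rot_1)
  define n where "n = - u + (d + u) + d"
  have nN: "n \<in> N"
  proof -
    have "- (d + (- u + (d + u))) \<in> N"
      by (rule sgp_minus[OF nsg_sgp[OF nsg_N] G_centralises_P_mod_N[OF uG d(1)]])
    moreover have "- (d + (- u + (d + u))) = - u + (d + u) + d" using dB by simp
    ultimately show ?thesis by (simp only: n_def)
  qed
  have r2: "rot 2 = (u + u) + n"
  proof -
    have "rot 2 = rot 1 + rot 1" by simp
    then show ?thesis unfolding r1 by (simp add: n_def)
  qed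
  have "rot 4 = rot 2 + rot 2" by simp
  also have "\<dots> = ((u + u) + (u + u)) + ((- (u + u) + (n + (u + u))) + n)" unfolding r2 by simp
  also have "\<dots> = (- (u + u) + (n + (u + u))) + n" unfolding u4 by simp
  also have "\<dots> \<in> N"
    by (rule sgp_add[OF nsg_sgp[OF nsg_N] nsg_conj'[OF nsg_N G_add[OF uG uG] nN] nN])
  finally show ?thesis using rot_in_sgp[OF nsg_sgp[OF nsg_N]] by blast
qed

lemma D_P_N_decomp:
  assumes "g \<in> G"
  shows "\<exists>d\<in>D 1. \<exists>p\<in>P. \<exists>n\<in>N. g = d + (p + n)"
  using assms
proof (induction rule: gen_induct)
  case zero
  then show ?case using sgp_0[OF sgp_D] zero_P sgp_0[OF nsg_sgp[OF nsg_N]] by (metis add_0_left)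
next
  case (s g)
  then show ?case using sgp_add[OF sgp_D a_in_D1] by (metis taut_assoc)
next
  case (B x g)
  then obtain d p n where d: "d \<in> D 1" "p \<in> P" "n \<in> N" "g = d + (p + n)" by blast
  have *: "\<exists>d\<in>D 1. \<exists>p'\<in>P. \<exists>n'\<in>N. q + (e + (p + n)) = d + (p' + n')" if q: "q \<in> P" and e: "e \<in> D 1" for q e
  proof -
    have eG: "e \<in> G" using e D_subset_G by auto
    have qB: "q \<in> B" and pG: "p \<in> G" using q d P_B G_B by auto
    define n1 where "n1 = q + (- e + (q + e))"
    have n1: "n1 \<in> N" unfolding n1_def by (rule G_centralises_P_mod_N[OF eG q])
    have "- p + (n1 + p) + n \<in> N"
      by (rule sgp_add[OF nsg_sgp[OF nsg_N] nsg_conj'[OF nsg_N pG n1] d(3)])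
    moreover have "q + (e + (p + n)) = e + ((q + p) + (- p + (n1 + p) + n))"
      using qB by (simp add: n1_def)
    ultimately show ?thesis using e P_add[OF q d(2)] by blast
  qed
  from P_cases[OF B(1)] show ?case
  proof
    assume "x + b \<in> P"
    moreover have "b + d \<in> D 1" using d b_in_D by (intro sgp_add[OF sgp_D]) auto
    moreover have "x + g = (x + b) + ((b + d) + (p + n))" using d by simp
    ultimately show ?thesis using * by metis
  qed (use * d in auto)
qed

text \<open>An element of \<open>G0\<close> is an even rotation modulo \<open>N\<close>: its
  component in \<open>P\<close> must cancel the class of its dihedral component, which is 0 or
  \<open>b\<close>, and \<open>b\<close> is not in \<open>P\<close>. Since \<open>rot 4\<close> lies
  in \<open>N\<close>, two cosets remain.\<close>

lemma cof_N: "cof N"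
proof (rule cof.step[OF cof_G0 nsg_N])
  have form: "\<exists>i n. n \<in> N \<and> g = rot (2 * i) + n" if g: "g \<in> G0" for g
  proof -
    have gG: "g \<in> G" "\<not> active g" "vec g = 0" using g by (auto simp: G0_def)
    obtain d p n where d: "d \<in> D 1" "p \<in> P" "n \<in> N" "g = d + (p + n)" using D_P_N_decomp[OF gG(1)] by blast
    have n0: "n \<in> G" "\<not> active n" "vec n = 0" using d(3) N_subset_G0 by (auto simp: G0_def)
    have p0: "p \<in> B" "p \<in> G" using d P_B G_B by auto
    have "d \<in> G" using d D_subset_G by auto
    then have v: "vec d + p = 0" using gG(3) d(4) n0 p0 by (simp add: vec_add G_add)
    have "\<not> active d" using gG d n0 p0 by (simp add: inactive_B)
    with d(1) show ?thesis
    proof (cases rule: D_cases)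
      case (1 i)
      then have "even i" using \<open>\<not> active d\<close> by simp
      then have "p = 0" using v 1 by (simp add: vec_rot)
      then show ?thesis using 1 d \<open>even i\<close> by (elim evenE) auto
    next
      case (2 i)
      then have "even i" using \<open>\<not> active d\<close> by simp
      then have "b + p = 0" using v 2 by (simp add: vec_rot vec_add)
      then have "p = b" using p0 by (metis add.right_neutral b_B cancel_B)
      then show ?thesis using b_notin_P d by simp
    qed
  qed
  show "idx2 N G0"
    unfolding idx2_def
  proof (intro conjI ballI N_subset_G0)
    fix x y assume x: "x \<in> G0 - N" and y: "y \<in> G0 - N"
    obtain i n where i: "n \<in> N" "x = rot (2 * i) + n" using form x by blast
    obtain j m where j: "m \<in> N" "y = rot (2 * j) + m" using form y by blast
    note s = nsg_sgp[OF nsg_N]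
    have odd: "odd l" if "rot (2 * l) + q \<notin> N" "q \<in> N" for l q
    proof
      assume "even l"
      then obtain l' where "2 * l = 4 * l'" by (elim evenE) simp
      then show False using that sgp_add[OF s] rot_4_in_N by metis
    qed
    have "odd i" "odd j" using odd x y i j by auto
    then obtain i' j' where "i = 2 * i' + 1" "j = 2 * j' + 1" by (elim oddE)
    then have l: "2 * i - 2 * j = 4 * (i' - j')" by simp
    define l where "l = i' - j'"
    have "rot (2 * j) + (n + - m) + - rot (2 * j) \<in> N"
      by (rule nsg_conj[OF nsg_N rot_in_G sgp_add[OF s i(1) sgp_minus[OF s j(1)]]])
    then have "rot (4 * l) + (rot (2 * j) + (n + - m) + - rot (2 * j)) \<in> N"
      by (rule sgp_add[OF s rot_4_in_N])
    moreover have "rot (4 * l) + (rot (2 * j) + (n + - m) + - rot (2 * j)) = x + - y"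
      using i j unfolding l_def l[symmetric] by simp
    ultimately show "x + - y \<in> N" by simp
  qed
qed

text \<open>With \<open>d\<close> in \<open>P\<close> such that \<open>om d\<close>, and \<open>c\<close> in the kernel of \<open>om\<close>, the commutator of
  \<open>comm d aT\<close> with \<open>c\<close> is trivial on the left subtree, and on the right subtree it is conjugate to the
  generator of \<open>N\<close> belonging to the image of \<open>c\<close>.\<close>

lemma comm_comm:
  assumes d: "d \<in> P" "om d" and c: "c \<in> Ker"
  shows "comm (comm d aT) c = pr 0 (sec True d + comm aT (sec True c) + - sec True d)"
proof -
  have dB: "d \<in> B" and cB: "c \<in> B" using d c P_B Ker_B by auto
  define x where "x = sec True d"
  define y where "y = sec True c"
  have xy: "x \<in> B" "y \<in> B" using dB cB rho_B by (auto simp: x_def y_def)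
  have 1: "comm d aT = pr (aT + x) (x + aT)"
    using dB d(2) by (intro taut_eqI[of "comm _ _"]) (simp_all add: comm_def inactive_B sec_False_B x_def)
  have "comm (comm d aT) c = comm (pr (aT + x) (x + aT)) (pr 0 y)"
    using Ker_pr[OF c] 1 by (simp add: y_def)
  also have "\<dots> = pr (comm (aT + x) 0) (comm (x + aT) y)" by (rule comm_pr)
  also have "comm (aT + x) 0 = 0" by (simp add: comm_def)
  also have "comm (x + aT) y = x + comm aT y + - x"
    using xy add_comm_B[of x y] by (simp add: comm_def)
  finally show ?thesis by (simp add: x_def y_def)
qed

text \<open>\<open>comm_comm\<close> exhibits conjugates of the generators of \<open>N\<close> in
  \<open>sect R\<close>; the conjugation is absorbed by normality.\<close>

lemma N_subset_sect:
  assumes R: "nsg R" and c: "\<And>c n. c \<in> Ker \<Longrightarrow> n \<in> N \<Longrightarrow> comm n c \<in> R"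
  shows "N \<subseteq> sect R"
proof (rule N_subset[OF nsg_sect[OF R]])
  fix p assume "p \<in> P"
  then obtain c0 where c0: "c0 \<in> Ker" "p = sec True c0" by (auto simp: P_def)
  obtain d where d: "d \<in> P" "om d" by (rule ex_P_om)
  have "pr 0 (sec True d + comm aT p + - sec True d) \<in> R"
    using c[OF c0(1) comm_aT_in_N(2)[OF d(1)]] comm_comm[OF d c0(1)] c0(2) by simp
  then have "sec True d + comm aT p + - sec True d \<in> sect R" by (simp add: sect_def)
  moreover have "sec True d \<in> G" using d P_B rho_B G_B by auto
  ultimately show "comm aT p \<in> sect R" using nsg_conj_iff[OF nsg_sect[OF R]] by blast
qed

lemma N_subset_sect_N: "N \<subseteq> sect N"
  using nsg_comm(1)[OF nsg_N] Ker_B G_B by (intro N_subset_sect[OF nsg_N]) blast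

lemma lift_N_subset: "lift N \<subseteq> N"
  using lift_subset_if[OF nsg_N N_subset_sect_N] .

lemma liftn_N_subset: "liftn k N \<subseteq> N"
proof (induction k)
  case (Suc k)
  then show ?case using lift_mono[OF Suc] lift_N_subset by (auto simp: liftn_Suc)
qed simp

lemma pr_in_liftn_Suc: "x \<in> liftn k N \<Longrightarrow> pr 0 x \<in> liftn (Suc k) N"
proof -
  assume x: "x \<in> liftn k N"
  have "pr 0 x \<in> N" using x liftn_N_subset N_subset_sect_N by (auto simp: sect_def)
  then have "pr 0 x \<in> G" using N_subset_G by auto
  moreover have "0 \<in> liftn k N" using cof_nsg[OF cof_liftn[OF cof_N]] nsg_sgp sgp_0 by blast
  ultimately show ?thesis using x by (simp add: liftn_Suc lift_def)
qed

text \<open>The centraliser of \<open>N\<close> modulo \<open>R\<close>.\<close>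

definition Cen :: "taut set \<Rightarrow> taut set" where
  "Cen R = {x \<in> G. \<forall>n\<in>N. comm x n \<in> R}"

lemma nsg_Cen: "nsg R \<Longrightarrow> nsg (Cen R)"
proof (rule nsgI)
  assume R: "nsg R"
  note s = nsg_sgp[OF R]
  show "sgp (Cen R)"
  proof (rule sgpI)
    show "0 \<in> Cen R" using sgp_0[OF s] by (simp add: Cen_def comm_def G_0)
    show "x + y \<in> Cen R" if "x \<in> Cen R" "y \<in> Cen R" for x y
    proof -
      have "comm (x + y) n \<in> R" if "n \<in> N" for n
      proof -
        have "(x + comm y n + - x) + comm x n \<in> R"
          using \<open>x \<in> Cen R\<close> \<open>y \<in> Cen R\<close> that by (intro sgp_add[OF s nsg_conj[OF R]]) (auto simp: Cen_def)
        then show ?thesis by (simp add: comm_def)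
      qed
      then show ?thesis using that by (auto simp: Cen_def G_add)
    qed
    show "- x \<in> Cen R" if "x \<in> Cen R" for x
    proof -
      have "comm (- x) n \<in> R" if "n \<in> N" for n
      proof -
        have "- x + (- comm x n + x) \<in> R"
          using \<open>x \<in> Cen R\<close> that by (intro nsg_conj'[OF R] sgp_minus[OF s]) (auto simp: Cen_def)
        then show ?thesis by (simp add: comm_def)
      qed
      then show ?thesis using that by (auto simp: Cen_def G_minus)
    qed
  qed
  show "Cen R \<subseteq> G" by (auto simp: Cen_def)
  show "g + x + - g \<in> Cen R" if "g \<in> G" "x \<in> Cen R" for g x
  proof -
    have "comm (g + x + - g) n \<in> R" if "n \<in> N" for n
    proof -
      have "- g + (n + g) \<in> N" using nsg_conj'[OF nsg_N \<open>g \<in> G\<close> that] .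
      then have "g + comm x (- g + (n + g)) + - g \<in> R"
        using \<open>x \<in> Cen R\<close> by (intro nsg_conj[OF R \<open>g \<in> G\<close>]) (auto simp: Cen_def)
      then show ?thesis by (simp add: comm_def)
    qed
    then show ?thesis using that unfolding Cen_def by (auto intro!: G_add G_minus)
  qed
qed

text \<open>\<open>N\<close> contains its own copy on the right subtree, so commutators with this
  copy can be read there. For the left section, conjugate by \<open>a\<close>.\<close>

lemma sec_in_Cen:
  assumes R: "nsg R" and x: "x \<in> Cen R" "\<not> active x"
  shows "sec c x \<in> Cen (sect R)"
proof -
  have T: "sec True x \<in> Cen (sect R)" if x: "x \<in> Cen R" "\<not> active x" for x
  proof -
    have "comm (sec True x) n \<in> sect R" if n: "n \<in> N" for n
    proof -
      have "pr 0 n \<in> N" using n N_subset_sect_N by (auto simp: sect_def)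
      then have "comm x (pr 0 n) \<in> R" using x by (auto simp: Cen_def)
      moreover have "comm x (pr 0 n) = pr 0 (comm (sec True x) n)"
        using comm_pr[of "sec False x" "sec True x" 0 n] pr_eta[OF x(2)] by (simp add: comm_def)
      ultimately show ?thesis by (simp add: sect_def)
    qed
    then show ?thesis using x by (auto simp: Cen_def sec_in_G)
  qed
  show ?thesis
  proof (cases c)
    case True
    then show ?thesis using T[OF x] by simp
  next
    case False
    have "aT + x + - aT \<in> Cen R" using nsg_conj[OF nsg_Cen[OF R] G_a x(1)] .
    from T[OF this] show ?thesis using x False by simp
  qed
qed

text \<open>By assumption \<open>N\<close> is central modulo \<open>R\<close>. Passing to sections
  enlarges the centraliser: it contains all \<open>comm aT x\<close> with \<open>x\<close> in
  \<open>B\<close> after one level, \<open>P\<close> and \<open>ab\<close> after two, and all of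
  \<open>B\<close> after three. Then \<open>N_subset_sect\<close> applies and costs the fourth
  level.\<close>

lemma N_subset_sect4:
  assumes R: "nsg R" and N: "\<And>x y. x \<in> N \<Longrightarrow> y \<in> N \<Longrightarrow> comm x y \<in> R"
  shows "N \<subseteq> sect (sect (sect (sect R)))"
proof -
  let ?R1 = "sect R" let ?R2 = "sect ?R1" let ?R3 = "sect ?R2"
  have R1: "nsg ?R1" and R2: "nsg ?R2" and R3: "nsg ?R3" using R nsg_sect by auto
  note n1 = nsg_Cen[OF R1] and n2 = nsg_Cen[OF R2] and n3 = nsg_Cen[OF R3]
  note s1 = nsg_sgp[OF n1] and s2 = nsg_sgp[OF n2] and s3 = nsg_sgp[OF n3]
  have NC: "N \<subseteq> Cen R" using N N_subset_G by (auto simp: Cen_def)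
  obtain d where d: "d \<in> P" "om d" by (rule ex_P_om)
  have dB: "d \<in> B" using d P_B by simp
  define r where "r = sec True d"
  have rB: "r \<in> B" using dB rho_B by (simp add: r_def)
  have z: "r + aT \<in> Cen ?R1"
  proof -
    have "comm d aT \<in> Cen R" using NC comm_aT_in_N d by auto
    from sec_in_Cen[OF R this, of True] show ?thesis using dB d
      by (simp add: comm_def inactive_B sec_False_B r_def)
  qed
  have e1: "comm aT x \<in> Cen ?R1" if x: "x \<in> B" for x
  proof -
    have "comm (r + aT) x \<in> Cen ?R1" using nsg_comm(1)[OF n1 z G_B[OF x]] .
    moreover have "comm (r + aT) x = r + comm aT x + - r"
      using rB x add_comm_B[of r x] by (simp add: comm_def)
    ultimately show ?thesis using nsg_conj_iff[OF n1 G_B[OF rB]] by simp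
  qed
  have e2: "sec False x + sec True x \<in> Cen ?R2" if x: "x \<in> B" for x
    using sec_in_Cen[OF R1 e1[OF x], of True] x by (simp add: comm_def inactive_B)
  have P2: "p \<in> Cen ?R2" if "p \<in> P" for p
  proof -
    obtain c where "c \<in> Ker" "p = sec True c" using \<open>p \<in> P\<close> by (auto simp: P_def)
    then show ?thesis using e2[OF Ker_B, of c] by (simp add: Ker_def sec_False_B)
  qed
  have a3: "aT \<in> Cen ?R3"
    using sec_in_Cen[OF R2 P2[OF d(1)], of False] dB d by (simp add: inactive_B sec_False_B)
  have b3: "b \<in> Cen ?R3"
  proof -
    have "rot 1 \<in> Cen ?R2" using e2[OF b_B] by (simp add: rot_1)
    then have "rot 2 \<in> Cen ?R2" using rot_in_sgp[OF s2, of 1 2] by simp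
    then have "rot 1 \<in> Cen ?R3" using sec_in_Cen[OF R2, of "rot 2" True] sec_rot_even(1)[of 1] by simp
    then have "aT + rot 1 \<in> Cen ?R3" using sgp_add[OF s3 a3] by blast
    then show ?thesis by (simp add: rot_1)
  qed
  have B3: "B \<subseteq> Cen ?R3"
  proof
    fix x assume "x \<in> B"
    then obtain y where y: "y \<in> B" "x = sec True y" using sec_True_image_B by blast
    have P3: "sec True p \<in> Cen ?R3" if "p \<in> P" for p
      using sec_in_Cen[OF R2 P2[OF that]] P_B that inactive_B by blast
    from P_cases[OF y(1)] show "x \<in> Cen ?R3"
    proof
      assume "y + b \<in> P"
      from P3[OF this] have "x + b \<in> Cen ?R3" using y by simp
      then show ?thesis using sgp_add_right[OF s3 b3] by blast
    qed (use P3 y in simp)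
  qed
  show ?thesis
  proof (rule N_subset_sect[OF R3])
    fix c n assume c: "c \<in> Ker" and n: "n \<in> N"
    have "comm c n \<in> ?R3" using B3 Ker_B[OF c] n by (auto simp: Cen_def)
    then have "- comm c n \<in> ?R3" by (rule sgp_minus[OF nsg_sgp[OF R3]])
    then show "comm n c \<in> ?R3" by (simp add: minus_comm)
  qed
qed

lemma liftn_subset_if_comm:
  assumes "nsg R" "\<And>x y. x \<in> liftn k N \<Longrightarrow> y \<in> liftn k N \<Longrightarrow> comm x y \<in> R"
  shows "liftn (k + 4) N \<subseteq> R"
  using assms
proof (induction k arbitrary: R)
  case 0
  let ?R1 = "sect R" let ?R2 = "sect ?R1" let ?R3 = "sect ?R2"
  have R: "nsg R" "nsg ?R1" "nsg ?R2" "nsg ?R3" using 0 nsg_sect by auto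
  have "N \<subseteq> sect ?R3" using N_subset_sect4[OF R(1)] 0 by simp
  then have "lift (lift (lift (lift N))) \<subseteq> R"
    using lift_subset_if[OF R(1) lift_subset_if[OF R(2) lift_subset_if[OF R(3) lift_subset_if[OF R(4)]]]] by blast
  then show ?case by (simp add: eval_nat_numeral liftn_Suc)
next
  case (Suc k)
  have "liftn (k + 4) N \<subseteq> sect R"
  proof (rule Suc.IH[OF nsg_sect[OF Suc.prems(1)]])
    fix x y assume "x \<in> liftn k N" "y \<in> liftn k N"
    then have "comm (pr 0 x) (pr 0 y) \<in> R" using Suc.prems(2) pr_in_liftn_Suc by blast
    then show "comm x y \<in> sect R" by (simp add: comm_pr sect_def, simp add: comm_def)
  qed
  from lift_subset_if[OF Suc.prems(1) this] show ?case by (simp only: add_Suc liftn_Suc)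
qed

lemma comm_liftn_if_pr:
  assumes R: "nsg R" and c: "\<And>x y. x \<in> liftn k N \<Longrightarrow> y \<in> liftn k N \<Longrightarrow> pr 0 (comm x y) \<in> R"
    and xy: "x \<in> liftn (Suc k) N" "y \<in> liftn (Suc k) N"
  shows "comm x y \<in> R"
proof -
  have "pr 0 (comm (sec c x) (sec c y)) \<in> R" for c
    using c xy by (cases c) (auto simp: liftn_Suc lift_def)
  then have "pr (comm (sec False x) (sec False y)) 0 + pr 0 (comm (sec True x) (sec True y)) \<in> R"
    using pr_swap_in_nsg[OF R] sgp_add[OF nsg_sgp[OF R]] by blast
  moreover have "comm x y = pr (comm (sec False x) (sec False y)) (comm (sec True x) (sec True y))"
    using pr_eta[of x] pr_eta[of y] xy comm_pr by (metis (no_types, lifting) liftn_Suc lift_def mem_Collect_eq)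
  ultimately show ?thesis by (simp add: pr_add)
qed

text \<open>If \<open>r\<close> is active, two commutators with elements acting on one subtree only
  produce \<open>pr 0 (comm x y)\<close>. Otherwise the induction hypothesis for
  \<open>sec1 R\<close> puts some \<open>liftn (k + 4) N\<close> into \<open>sec1 R\<close>, and
  commutators with \<open>pr 0 y\<close> remove the unknown left sections.\<close>

lemma comm_in_if_moves:
  assumes "nsg R" "r \<in> R" "moves n r"
  shows "\<exists>k. \<forall>x\<in>liftn k N. \<forall>y\<in>liftn k N. comm x y \<in> R"
  using assms
proof (induction n arbitrary: R r)
  have act: "\<exists>k. \<forall>x\<in>liftn k N. \<forall>y\<in>liftn k N. comm x y \<in> R"
    if R: "nsg R" and r: "r \<in> R" "active r" for R r
  proof -
    have "pr 0 (comm x y) \<in> R" if x: "x \<in> N" and y: "y \<in> N" for x y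
    proof -
      \<comment> \<open>Conjugation by \<open>r\<close> moves the copy of \<open>- x\<close> to the
        left subtree, so the commutator with \<open>r\<close> has right section
        \<open>x\<close>.\<close>
      have p: "pr 0 (- x) \<in> G" "pr 0 y \<in> G"
        using x y sgp_minus[OF nsg_sgp[OF nsg_N]] N_subset_sect_N N_subset_G by (auto simp: sect_def)
      have "comm (comm r (pr 0 (- x))) (pr 0 y) \<in> R"
        using nsg_comm(1)[OF R nsg_comm(1)[OF R r(1) p(1)] p(2)] .
      moreover have "comm r (pr 0 (- x)) = pr (sec True r + - x + - sec True r) x"
        using r(2) by (intro taut_eqI[of "comm _ _"]) (simp_all add: comm_def)
      ultimately show ?thesis by (simp add: comm_pr) (simp add: comm_def)
    qed
    then have "\<forall>x\<in>liftn (Suc 0) N. \<forall>y\<in>liftn (Suc 0) N. comm x y \<in> R"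
      using comm_liftn_if_pr[OF R, of 0] by simp
    then show ?thesis by blast
  qed
  {
    case 0
    then show ?case using act by simp
  next
    case (Suc n R r)
    show ?case
    proof (cases "active r")
      case True
      then show ?thesis using act Suc.prems by blast
    next
      case False
      from Suc.prems(3) obtain c where c: "moves n (sec c r)" by auto
      obtain r' where r': "r' \<in> R" "\<not> active r'" "moves n (sec True r')"
      proof (cases c)
        case True
        then show ?thesis using that c False Suc.prems by auto
      next
        case cF: False
        have "aT + r + - aT \<in> R" using nsg_conj[OF Suc.prems(1) G_a Suc.prems(2)] .
        then show ?thesis using that[of "aT + r + - aT"] c cF False by simp
      qed
      have "sec True r' \<in> sec1 R" using r' sec1I by blast
      from Suc.IH[OF nsg_sec1[OF Suc.prems(1)] this r'(3)] obtain k
        where k: "\<forall>x\<in>liftn k N. \<forall>y\<in>liftn k N. comm x y \<in> sec1 R" by blast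
      then have sub: "liftn (k + 4) N \<subseteq> sec1 R"
        by (intro liftn_subset_if_comm[OF nsg_sec1[OF Suc.prems(1)]]) auto
      have "pr 0 (comm x y) \<in> R" if x: "x \<in> liftn (k + 4) N" and y: "y \<in> liftn (k + 4) N" for x y
      proof -
        obtain q where q: "q \<in> R" "\<not> active q" "x = sec True q" using sub x by (auto simp: sec1_def)
        have "pr 0 y \<in> G" using y liftn_N_subset N_subset_sect_N N_subset_G by (auto simp: sect_def)
        then have "comm q (pr 0 y) \<in> R" using nsg_comm(1)[OF Suc.prems(1) q(1)] by blast
        moreover have "comm q (pr 0 y) = pr 0 (comm x y)"
          using comm_pr[of "sec False q" "sec True q" 0 y] pr_eta[OF q(2)] q(3) by (simp add: comm_def)
        ultimately show ?thesis by simp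
      qed
      then have "\<forall>x\<in>liftn (Suc (k + 4)) N. \<forall>y\<in>liftn (Suc (k + 4)) N. comm x y \<in> R"
        using comm_liftn_if_pr[OF Suc.prems(1)] by blast
      then show ?thesis by blast
    qed
  }
qed

lemma liftn_N_subset_nsg:
  assumes "nsg R" "r \<in> R" "r \<noteq> 0"
  obtains k where "liftn k N \<subseteq> R"
proof -
  obtain n where "moves n r" using ex_moves[OF assms(3)] .
  then obtain k where "\<forall>x\<in>liftn k N. \<forall>y\<in>liftn k N. comm x y \<in> R"
    using comm_in_if_moves[OF assms(1,2)] by blast
  then have "liftn (k + 4) N \<subseteq> R" by (intro liftn_subset_if_comm[OF assms(1)]) auto
  then show ?thesis using that by blast
qed

section \<open>Dense subgroups all of whose sections are \<open>G\<close>\<close>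

text \<open>If \<open>M\<close> contained no nontrivial element acting on the left subtree only, then the left
  section would be a function of the right one, and \<open>G\<close> would have too many classes.\<close>

lemma ex_pr_in_dense:
  assumes M: "dense M" and s: "sec1 M = G"
  obtains r where "r \<noteq> 0" "pr r 0 \<in> M"
proof -
  have "\<exists>r. r \<noteq> 0 \<and> pr r 0 \<in> M"
  proof (rule ccontr)
    assume "\<nexists>r. r \<noteq> 0 \<and> pr r 0 \<in> M"
    then have triv: "r = 0" if "pr r 0 \<in> M" for r using that by blast
    have sM: "sgp M" and MG: "M \<subseteq> G" using M by (auto simp: dense_def)
    have "\<forall>g\<in>G. \<exists>h. h \<in> M \<and> \<not> active h \<and> sec True h = g"
    proof
      fix g assume "g \<in> G"
      then have "g \<in> sec1 M" using s by simp
      then show "\<exists>h. h \<in> M \<and> \<not> active h \<and> sec True h = g" unfolding sec1_def by blast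
    qed
    then obtain th where th: "\<And>g. g \<in> G \<Longrightarrow> th g \<in> M" "\<And>g. g \<in> G \<Longrightarrow> \<not> active (th g)"
      "\<And>g. g \<in> G \<Longrightarrow> sec True (th g) = g" by metis
    have uniq: "th g = h" if "g \<in> G" "h \<in> M" "\<not> active h" "sec True h = g" for g h
    proof -
      have "th g + - h = pr (sec False (th g) + - sec False h) 0"
        using that th[OF that(1)] by (intro taut_eqI[of "_ + _"]) simp_all
      moreover have "th g + - h \<in> M" using that th(1) by (simp add: sgp_add[OF sM] sgp_minus[OF sM])
      ultimately have "th g + - h = 0" using triv by (metis pr_0_0)
      then show ?thesis by (metis add_uminus_conv_diff right_minus_eq)
    qed
    \<comment> \<open>The class of the left section as a function of the right one. It is a
      homomorphism into an abelian group, so it depends on the class of \<open>g\<close> only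
      (\<open>cls\<close>).\<close>
    define ph where "ph g = vec (sec False (th g))" for g
    have thG: "sec False (th g) \<in> G" if "g \<in> G" for g using th(1)[OF that] MG sec_in_G by auto
    have add: "ph (g + h) = ph g + ph h" if "g \<in> G" "h \<in> G" for g h
    proof -
      have "th (g + h) = th g + th h"
        using that th by (intro uniq G_add sgp_add[OF sM]) auto
      then show ?thesis using that th(2)[of h] thG by (simp add: ph_def vec_add)
    qed
    have phB: "ph g \<in> B" if "g \<in> G" for g using thG[OF that] vec_in_B by (simp add: ph_def)
    have ph0: "ph 0 = 0" using add[OF G_0 G_0] phB[OF G_0] by (metis add.right_neutral add_left_cancel)
    have cls: "ph g = ph (vec g) + (if active g then ph aT else 0)" if "g \<in> G" for g
      using that
    proof (induction rule: gen_induct)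
      case zero
      then show ?case by simp
    next
      case (s g)
      have "vec (aT + g) = vec g" using s vec_in_B by (simp add: vec_add G_a)
      moreover have "ph aT + (ph (vec g) + ph aT) = ph (vec g)" "ph aT + ph (vec g) = ph (vec g) + ph aT"
        using add_comm_B[of "ph (vec g)" "ph aT"] phB[OF G_a] phB[OF G_B[OF vec_in_B[OF s(1)]]]
        by (auto simp: invol_B)
      ultimately show ?case using s add[OF G_a s(1)] by simp
    next
      case (B x g)
      have "vec (x + g) = x + vec g" "active (x + g) = active g"
        using B by (auto simp: vec_add G_B inactive_B)
      then show ?case using B add[OF G_B[OF B(1)] B(2)] add[OF G_B[OF B(1)] G_B[OF vec_in_B[OF B(2)]]] by simp
    qed
    \<comment> \<open>On elements with \<open>vec g = 0\<close> the map \<open>ph\<close> takes at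
      most two values. Yet \<open>dense_pairs\<close> realises every class on the left with trivial
      \<open>vec\<close> on the right, and \<open>B\<close> has more than two elements.\<close>
    have "x \<in> {0, ph aT}" if x: "x \<in> B" for x
    proof -
      obtain y where y: "y \<in> B" "x = sec True y" using x sec_True_image_B by blast
      obtain h where h: "h \<in> M" "\<not> active h" "vec (sec False h) = sec True y" "vec (sec True h) = sec True 0"
        using dense_pairs[OF M y(1) zero_B] by metis
      define g where "g = sec True h"
      have gG: "g \<in> G" using h MG sec_in_G by (auto simp: g_def)
      have "ph g = x" using uniq[OF gG h(1,2)] h y by (simp add: ph_def g_def)
      moreover have "vec g = 0" using h by (simp add: g_def)
      ultimately show ?thesis using cls[OF gG] ph0 by (auto split: if_splits)
    qed
    moreover obtain c where "c \<in> B" "c \<noteq> 0" "\<not> om c" using ker_om by blast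
    moreover have "b \<noteq> c" using \<open>\<not> om c\<close> om_b by auto
    ultimately show False using b_B b_neq_0 by (metis insertE singletonD)
  qed
  then show ?thesis using that by blast
qed

lemma eq_G_if_sec1:
  assumes M: "dense M" and s: "sec1 M = G"
  shows "M = G"
proof -
  have sM: "sgp M" and MG: "M \<subseteq> G" using M by (auto simp: dense_def)
  obtain t where t: "t \<in> M" "active t" using M zero_B unfolding dense_def by metis
  have tG: "t \<in> G" using t MG by auto
  define R where "R = {r. pr r 0 \<in> M}"
  have R: "nsg R"
  proof (rule nsgI)
    show "sgp R"
    proof (rule sgpI)
      show "0 \<in> R" using sgp_0[OF sM] by (simp add: R_def)
      show "g + h \<in> R" if "g \<in> R" "h \<in> R" for g h
        using sgp_add[OF sM, of "pr g 0" "pr h 0"] that by (simp add: R_def pr_add)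
      show "- g \<in> R" if "g \<in> R" for g
        using sgp_minus[OF sM, of "pr g 0"] that by (simp add: R_def minus_pr)
    qed
    show "R \<subseteq> G"
    proof
      fix r assume "r \<in> R"
      then have "sec False (pr r 0) \<in> G" using MG by (intro sec_in_G) (auto simp: R_def)
      then show "r \<in> G" by simp
    qed
    show "g + r + - g \<in> R" if g: "g \<in> G" and r: "r \<in> R" for g r
    proof -
      \<comment> \<open>Only right sections can be prescribed. Conjugating by the active
        \<open>t\<close> turns the right section into a left one, and the prescribed value makes the
        latter equal to \<open>g\<close>.\<close>
      have "- sec True t + g + sec True t \<in> sec1 M"
        unfolding s using g tG by (intro G_add G_minus sec_in_G)
      then obtain h where h: "h \<in> M" "\<not> active h" "sec True h = - sec True t + g + sec True t"
        by (auto simp: sec1_def)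
      define h' where "h' = t + h + - t"
      have h': "h' \<in> M" "\<not> active h'" "sec False h' = g"
        using h t sgp_add[OF sM] sgp_minus[OF sM] by (auto simp: h'_def)
      have "h' + pr r 0 + - h' \<in> M"
        using r h' by (intro sgp_add[OF sM] sgp_minus[OF sM]) (simp_all add: R_def)
      then show ?thesis using pr_conj[OF h'(2), of r 0] h'(3) by (simp add: R_def)
    qed
  qed
  obtain r where "r \<noteq> 0" "pr r 0 \<in> M" using ex_pr_in_dense[OF assms] .
  then obtain k where k: "liftn k N \<subseteq> R" using liftn_N_subset_nsg[OF R, of r] by (auto simp: R_def)
  have "liftn (Suc k) N \<subseteq> M"
  proof
    fix g assume g: "g \<in> liftn (Suc k) N"
    then have g': "\<not> active g" "sec False g \<in> R" "sec True g \<in> R" using k by (auto simp: liftn_Suc lift_def)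
    let ?s = "sec False t"
    have "- ?s + (sec True g + ?s) \<in> R" using nsg_conj'[OF R sec_in_G[OF tG] g'(3)] .
    then have "t + pr (- ?s + (sec True g + ?s)) 0 + - t \<in> M"
      using t by (intro sgp_add[OF sM] sgp_minus[OF sM]) (simp_all add: R_def)
    moreover have "t + pr (- ?s + (sec True g + ?s)) 0 + - t = pr 0 (sec True g)"
      using t by (intro taut_eqI[of "_ + _"]) simp_all
    ultimately have "pr (sec False g) 0 + pr 0 (sec True g) \<in> M"
      using g'(2) sgp_add[OF sM] by (simp add: R_def)
    then show "g \<in> M" using pr_eta[OF g'(1)] by (simp add: pr_add)
  qed
  then show ?thesis using dense_eq_G[OF cof_liftn[OF cof_N] M] by blast
qed

end

section \<open>Maximal subgroups\<close>

context sunic_group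
begin

definition maxi :: "taut set \<Rightarrow> bool" where
  "maxi M \<longleftrightarrow> sgp M \<and> M \<subseteq> G \<and> M \<noteq> G \<and> (\<forall>K. sgp K \<longrightarrow> K \<subseteq> G \<longrightarrow> M \<subseteq> K \<longrightarrow> K = M \<or> K = G)"

lemma conjs_G: "g \<in> G \<Longrightarrow> conjs g G = G"
  by (rule conjs_self[OF sgp_G])

lemma maxi_conjs:
  assumes M: "maxi M" and g: "g \<in> G"
  shows "maxi (conjs g M)"
  unfolding maxi_def
proof (intro conjI allI impI)
  have m: "sgp M" "M \<subseteq> G" "M \<noteq> G" using M by (auto simp: maxi_def)
  show "sgp (conjs g M)" using m by (simp add: sgp_conjs)
  show "conjs g M \<subseteq> G" using conjs_mono[OF m(2), of g] conjs_G[OF g] by simp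
  show "conjs g M \<noteq> G"
  proof
    assume "conjs g M = G"
    then have "conjs (- g) (conjs g M) = conjs (- g) G" by simp
    then show False using m(3) conjs_G[OF G_minus[OF g]] by (simp add: conjs_conjs)
  qed
  fix K assume K: "sgp K" "K \<subseteq> G" "conjs g M \<subseteq> K"
  have "conjs (- g) K \<subseteq> G" using conjs_mono[OF K(2), of "- g"] conjs_G[OF G_minus[OF g]] by simp
  moreover have "M \<subseteq> conjs (- g) K" using K(3) by (simp add: conjs_subset_iff)
  ultimately have "conjs (- g) K = M \<or> conjs (- g) K = G"
    using M sgp_conjs[OF K(1)] by (simp add: maxi_def)
  then have "conjs g (conjs (- g) K) = conjs g M \<or> conjs g (conjs (- g) K) = conjs g G" by auto
  then show "K = conjs g M \<or> K = G" using conjs_G[OF g] by (simp add: conjs_conjs)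
qed

lemma maxi_idx2: "sgp M \<Longrightarrow> M \<subseteq> G \<Longrightarrow> M \<noteq> G \<Longrightarrow> idx2 M G \<Longrightarrow> maxi M"
  unfolding maxi_def
proof (intro conjI allI impI)
  fix K assume M: "sgp M" "M \<subseteq> G" "M \<noteq> G" "idx2 M G" and K: "sgp K" "K \<subseteq> G" "M \<subseteq> K"
  show "K = M \<or> K = G"
  proof (cases "K \<subseteq> M")
    case False
    then obtain y where y: "y \<in> K" "y \<notin> M" by blast
    have "x \<in> K" if "x \<in> G" for x
    proof (cases "x \<in> M")
      case False
      then have "x + - y \<in> K" using M(4) y K that unfolding idx2_def by blast
      then show ?thesis using sgp_add_right[OF K(1) sgp_minus[OF K(1) y(1)]] by simp
    qed (use K in auto)
    then show ?thesis using K by auto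
  qed (use K in auto)
qed

text \<open>A maximal subgroup that is not dense contains all elements of trivial class.\<close>

lemma idx2_if_not_dense:
  assumes M: "maxi M" and nd: "\<not> dense M"
  shows "idx2 M G"
proof -
  have m: "sgp M" "M \<subseteq> G" using M by (auto simp: maxi_def)
  have mG: "g \<in> G" if "g \<in> M" for g using that m by auto
  \<comment> \<open>The product of \<open>M\<close> with the kernel of the abelianization. It is
    proper since \<open>M\<close> is not dense, so it equals \<open>M\<close> by maximality.\<close>
  define S where "S = {g \<in> G. \<exists>m\<in>M. active m = active g \<and> vec m = vec g}"
  have SS: "sgp S"
  proof (rule sgpI)
    show "0 \<in> S" using sgp_0[OF m(1)] by (auto simp: S_def G_0 intro!: bexI[of _ 0])
    show "g + h \<in> S" if "g \<in> S" "h \<in> S" for g h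
    proof -
      from that obtain k l where k: "k \<in> M" "active k = active g" "vec k = vec g"
        "l \<in> M" "active l = active h" "vec l = vec h" by (auto simp: S_def)
      have "k + l \<in> M" "active (k + l) = active (g + h)" "vec (k + l) = vec (g + h)"
        using k that mG by (auto simp: S_def vec_add sgp_add[OF m(1)])
      moreover have "g + h \<in> G" using that by (intro G_add) (simp_all add: S_def)
      ultimately show ?thesis unfolding S_def by blast
    qed
    show "- g \<in> S" if "g \<in> S" for g
    proof -
      from that obtain k where k: "k \<in> M" "active k = active g" "vec k = vec g" by (auto simp: S_def)
      have "- k \<in> M" "active (- k) = active (- g)" "vec (- k) = vec (- g)"
        using k that mG by (auto simp: S_def vec_minus sgp_minus[OF m(1)])
      moreover have "- g \<in> G" using that by (intro G_minus) (simp add: S_def)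
      ultimately show ?thesis unfolding S_def by blast
    qed
  qed
  have MS: "M \<subseteq> S" using m by (auto simp: S_def)
  have "S \<noteq> G"
  proof
    assume "S = G"
    have "dense M"
      unfolding dense_def
    proof (intro conjI allI ballI m)
      fix e x assume x: "x \<in> B"
      obtain g where "g \<in> G" "active g = e" "vec g = x" using dense_G x unfolding dense_def by metis
      then show "\<exists>g\<in>M. active g = e \<and> vec g = x" using \<open>S = G\<close> by (auto simp: S_def)
    qed
    then show False using nd by simp
  qed
  then have "S = M" using M SS MS unfolding maxi_def S_def by blast
  then have sat: "g \<in> M" if "g \<in> G" "k \<in> M" "active k = active g" "vec k = vec g" for g k
    using that by (auto simp: S_def)
  show ?thesis
    unfolding idx2_def
  proof (intro conjI ballI m(2))
    fix x y assume x: "x \<in> G - M" and y: "y \<in> G - M"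
    then have yG: "y \<in> G" and yB: "vec y \<in> B" by (auto simp: vec_in_B)
    \<comment> \<open>The union of \<open>M\<close> and the coset of \<open>y\<close>; it is a
      subgroup since membership in \<open>M\<close> depends only on the class, in an elementary
      abelian 2-group. Maximality makes it \<open>G\<close>.\<close>
    define T where "T = {g \<in> G. g \<in> M \<or> g + - y \<in> M}"
    have T1: "g + y \<in> T" if "g \<in> M" for g using that mG yG by (auto simp: T_def intro!: G_add)
    have cl: "active (g + - y) = (active g \<noteq> active y)" "vec (g + - y) = vec g + vec y" if "g \<in> G" for g
      using that yG by (simp_all add: vec_add vec_minus G_minus)
    have yy: "vec y + vec y = 0" "vec y + (vec y + z) = z" for z using yB by (simp_all add: invol_B)
    have "sgp T"
    proof (rule sgpI)
      show "0 \<in> T" using sgp_0[OF m(1)] by (simp add: T_def G_0)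
      fix g assume g: "g \<in> T"
      then have gG: "g \<in> G" by (simp add: T_def)
      have c: "g + vec y \<in> B \<Longrightarrow> True" by simp
      show "- g \<in> T"
      proof (cases "g \<in> M")
        case True
        then show ?thesis using sgp_minus[OF m(1)] gG by (simp add: T_def G_minus)
      next
        case False
        then have gy: "g + - y \<in> M" using g by (simp add: T_def)
        have "- g + - y \<in> M"
          using gG yG by (intro sat[OF _ gy]) (auto simp: cl G_add G_minus vec_minus)
        then show ?thesis using gG by (simp add: T_def G_minus)
      qed
      fix h assume h: "h \<in> T"
      then have hG: "h \<in> G" by (simp add: T_def)
      have com: "vec h + vec y = vec y + vec h" using hG yB vec_in_B add_comm_B by simp
      have ghG: "g + h \<in> G" using gG hG by (rule G_add)
      show "g + h \<in> T"
      proof (cases "g \<in> M")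
        case gM: True
        show ?thesis
        proof (cases "h \<in> M")
          case True
          then show ?thesis using gM ghG sgp_add[OF m(1)] by (simp add: T_def)
        next
          case False
          then have "h + - y \<in> M" using h by (simp add: T_def)
          then have "g + (h + - y) \<in> M" using gM sgp_add[OF m(1)] by blast
          then show ?thesis using ghG by (simp add: T_def)
        qed
      next
        case gM: False
        then have gy: "g + - y \<in> M" using g by (simp add: T_def)
        show ?thesis
        proof (cases "h \<in> M")
          case True
          then have k: "(g + - y) + h \<in> M" using gy sgp_add[OF m(1)] by blast
          have "(g + h) + - y \<in> M"
          proof (rule sat[OF _ k])
            show "(g + h) + - y \<in> G" by (rule G_add[OF ghG G_minus[OF yG]])
            show "active (g + - y + h) = active (g + h + - y)" by auto
            show "vec (g + - y + h) = vec (g + h + - y)"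
              using gG hG yG com by (simp add: vec_add G_add G_minus vec_minus)
          qed
          then show ?thesis using ghG by (simp add: T_def)
        next
          case False
          then have hy: "h + - y \<in> M" using h by (simp add: T_def)
          have k: "(g + - y) + (h + - y) \<in> M" using gy hy sgp_add[OF m(1)] by blast
          have "g + h \<in> M"
          proof (rule sat[OF ghG k])
            show "active (g + - y + (h + - y)) = active (g + h)" by auto
            show "vec (g + - y + (h + - y)) = vec (g + h)"
              using gG hG yG com yy by (simp add: vec_add G_add G_minus vec_minus)
          qed
          then show ?thesis using ghG by (simp add: T_def)
        qed
      qed
    qed
    moreover have "T \<subseteq> G" "M \<subseteq> T" using mG by (auto simp: T_def)
    moreover have "y \<in> T" "y \<notin> M" using T1[OF sgp_0[OF m(1)]] y by auto
    ultimately have "T = G" using M unfolding maxi_def by blast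
    then show "x + - y \<in> M" using x by (auto simp: T_def)
  qed
qed

definition infidx :: "taut set \<Rightarrow> bool" where
  "infidx M \<longleftrightarrow> (\<exists>c :: nat \<Rightarrow> taut. (\<forall>n. c n \<in> G) \<and> (\<forall>i j. i < j \<longrightarrow> c i + - c j \<notin> M))"

lemma infidx_conjs: "infidx M \<Longrightarrow> g \<in> G \<Longrightarrow> infidx (conjs g M)"
proof -
  assume "infidx M" and g: "g \<in> G"
  then obtain c :: "nat \<Rightarrow> taut" where c: "\<And>n. c n \<in> G" "\<And>i j. i < j \<Longrightarrow> c i + - c j \<notin> M"
    unfolding infidx_def by blast
  define c' where "c' n = g + c n + - g" for n
  have "c' n \<in> G" for n unfolding c'_def using c g by (intro G_add G_minus)
  moreover have "c' i + - c' j \<notin> conjs g M" if "i < j" for i j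
    using c(2)[OF that] by (simp add: c'_def mem_conjs)
  ultimately show ?thesis unfolding infidx_def by blast
qed

lemma countable_G: "countable G"
proof -
  have "G \<subseteq> ev aT ` lists (insert None (Some ` B))"
  proof
    fix g assume "g \<in> G"
    then obtain w where w: "valid w" "g = ev aT w" by (auto simp: gen_def)
    have "l \<in> insert None (Some ` B)" if "l \<in> set w" for l
    proof (cases l)
      case (Some x)
      then have "x \<in> B" using that w(1) by (simp add: valid_def)
      then show ?thesis using Some by simp
    qed simp
    then show "g \<in> ev aT ` lists (insert None (Some ` B))" using w by blast
  qed
  moreover have "countable (insert None (Some ` B))" using finite_B by (simp add: countable_finite)
  then have "countable (ev aT ` lists (insert None (Some ` B)))" by (intro countable_image countable_lists)
  ultimately show ?thesis using countable_subset by blast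
qed

end

context sunic_b
begin

lemma secn_H: "odd k \<Longrightarrow> secn j (H k) = H k"
  by (induction j) (simp_all add: secn_Suc sec1_H)

lemma Div_H: "odd k \<Longrightarrow> Div k (H k)"
  by (simp add: Div_def secn_H rot_in_H_iff)

lemma secn_mono: "K \<subseteq> L \<Longrightarrow> secn j K \<subseteq> secn j L"
  by (induction j) (simp_all add: secn_Suc' sec1_mono)

end

context sunic_big
begin

lemma Fam_eq_G: "Fam M K \<Longrightarrow> dense M \<Longrightarrow> K = G \<Longrightarrow> M = G"
proof (induction rule: Fam.induct)
  case (sec K)
  then show ?case using eq_G_if_sec1[OF Fam_dense] by blast
next
  case (conj K g)
  have "conjs (- g) (conjs g K) = conjs (- g) G" using conj.prems by simp
  then have "K = G" using conjs_G[OF G_minus[OF conj.hyps(2)]] by (simp add: conjs_conjs)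
  then show ?case using conj by blast
qed

lemma Fam_subset_conjs_H:
  "Fam M K \<Longrightarrow> dense M \<Longrightarrow> odd k \<Longrightarrow> g \<in> G \<Longrightarrow> K \<subseteq> conjs g (H k) \<Longrightarrow>
    \<exists>g'\<in>G. M \<subseteq> conjs g' (H k)"
proof (induction arbitrary: g rule: Fam.induct)
  case (sec K)
  obtain g' where "g' \<in> G" "K \<subseteq> conjs g' (H k)"
    using subset_conjs_H_if_sec1[OF Fam_dense[OF sec.hyps sec.prems(1)] sec.prems(2-4)] .
  then show ?case using sec.IH sec.prems by blast
next
  case (conj K h)
  have "K \<subseteq> conjs (- h + g) (H k)" using conj.prems(4) by (simp add: conjs_subset_iff conjs_conjs)
  then show ?case using conj.IH[of "- h + g"] conj.prems conj.hyps by (simp add: G_add G_minus)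
qed blast

lemma secn_eq_G: "dense K \<Longrightarrow> secn j K = G \<Longrightarrow> K = G"
  using Fam_eq_G[OF Fam_secn[OF Fam.base]] by blast

text \<open>Either all rotations in the iterated sections of \<open>K\<close> have index divisible
  by \<open>q\<close>, and then \<open>K\<close> is \<open>H q\<close>; or Bezout gives
  \<open>rot 1\<close> in a section subgroup, which is then \<open>G\<close>, and so is
  \<open>K\<close>.\<close>

lemma maxi_H:
  assumes q: "prime q" "odd q"
  shows "maxi (H (int q))"
  unfolding maxi_def
proof (intro conjI allI impI)
  let ?q = "int q"
  have oq: "odd ?q" using q by simp
  show "sgp (H ?q)" "H ?q \<subseteq> G" by (simp_all add: sgp_H H_subset_G)
  have "\<not> is_unit ?q" using q by (simp add: prime_nat_iff)
  then show "H ?q \<noteq> G" using H_neq_G oq by blast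
  fix K assume K: "sgp K" "K \<subseteq> G" "H ?q \<subseteq> K"
  show "K = H ?q \<or> K = G"
  proof (cases "Div ?q K")
    case True
    then show ?thesis using eq_H_if_Div[OF K(1) oq K(3,2)] by simp
  next
    case False
    then obtain j s where s: "rot s \<in> secn j K" "\<not> ?q dvd s" by (auto simp: Div_def)
    have HK: "H ?q \<subseteq> secn j K" using secn_mono[OF K(3), of j] secn_H[OF oq] by simp
    have sK: "sgp (secn j K)" using rot_in_secn[of K 0 j] K(1) sgp_0 by simp
    have "coprime ?q s" using q s(2) by (simp add: prime_imp_coprime)
    then obtain u v where uv: "u * ?q + v * s = 1" using bezout_int[of ?q s] by (metis coprime_iff_gcd_eq_1)
    have "rot ?q \<in> secn j K" using HK rot_in_H[of ?q ?q] by auto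
    then have "rot (?q * u) + rot (s * v) \<in> secn j K"
      using s(1) by (intro sgp_add[OF sK] rot_in_sgp[OF sK])
    then have "rot 1 \<in> secn j K" using uv by (simp add: mult.commute)
    moreover have "B \<subseteq> secn j K" using HK B_subset_H by blast
    ultimately have "G \<subseteq> secn j K" using H_subset[OF sK] H_1 by blast
    then have "secn j K = G" using secn_subset_G[OF K(2)] by blast
    moreover have "dense K" using dense_mono[OF dense_H[OF oq] K(3,1,2)] .
    ultimately show ?thesis using secn_eq_G by blast
  qed
qed

text \<open>A prime divisor \<open>q\<close> of \<open>k\<close> gives a maximal \<open>H q\<close>
  containing \<open>H k\<close>, and \<open>k = 1\<close> would give \<open>M = G\<close>.\<close>

lemma maxi_dense:
  assumes M: "maxi M" "dense M"
  obtains g q where "g \<in> G" "prime q" "odd (q :: nat)" "M = conjs g (H (int q))"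
proof -
  obtain k where k: "odd k" "0 < k" "Fam M (H k)" using dense_Fam_H[OF M(2)] .
  have "k \<noteq> 1" using Fam_eq_G[OF k(3) M(2)] M(1) H_1 by (auto simp: maxi_def)
  obtain g where g: "g \<in> G" "M \<subseteq> conjs g (H k)"
    using Fam_subset_conjs_H[OF k(3) M(2) k(1) G_0] by auto
  have "nat k \<noteq> 1" using k(2) \<open>k \<noteq> 1\<close> by auto
  then obtain q where q: "prime q" "q dvd nat k" using prime_factor_nat by blast
  then have qk: "int q dvd k" using k(2) by (simp add: int_dvd_int_iff[symmetric])
  then have oq: "odd q" using k(1) by (metis dvd_trans even_of_nat)
  have "M \<subseteq> conjs g (H (int q))" using g(2) conjs_mono[OF H_mono[OF qk], of g] by blast
  moreover have "maxi (conjs g (H (int q)))" using maxi_conjs[OF maxi_H[OF q(1) oq] g(1)] .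
  ultimately have "M = conjs g (H (int q))" using M(1) unfolding maxi_def by blast
  then show ?thesis using that g q oq by blast
qed

text \<open>The cosets of \<open>g\<close>, of a lift of \<open>g\<close>, of a lift of this lift, and so on, are
  pairwise distinct when \<open>g\<close> is an element outside \<open>H(k)\<close> acting on the left subtree only.\<close>

lemma infidx_H:
  assumes k: "odd k" "\<not> is_unit k"
  shows "infidx (H k)"
proof -
  obtain d where d: "d \<in> B" "d \<noteq> 0" "\<not> om d" using ker_om by blast
  define g where "g = aT + (d + aT)"
  have gG: "g \<in> G" "\<not> active g" using d by (auto simp: g_def G_add G_a G_B inactive_B)
  have g0: "sec True g = 0" using d by (simp add: g_def inactive_B sec_False_B)
  have gH: "g \<notin> H k"
  proof
    assume "g \<in> H k"
    \<comment> \<open>As \<open>b\<close> commutes with \<open>d\<close>, conjugation of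
      \<open>d\<close> by \<open>a\<close> and by \<open>ab\<close> agree;
      \<open>conj_letter\<close> then makes \<open>k\<close> a unit.\<close>
    moreover have "g = rot 1 + (d + rot (- 1))"
    proof -
      have "rot (- 1) = - rot 1" by simp
      also have "\<dots> = b + aT" by (simp only: rot_1 taut_minus_add minus_a minus_B[OF b_B])
      finally have r: "rot (- 1) = b + aT" .
      have "b + (d + (b + z)) = d + z" for z
        using add_comm_B[OF b_B d(1)] d(1) by (metis cancel_B b_B taut_assoc)
      then show ?thesis unfolding r by (simp add: g_def rot_1)
    qed
    ultimately have "rot 1 + (d + rot (- 1)) \<in> H k" by simp
    from conj_letter[OF sgp_H k(1) rot_in_H[OF dvd_refl] Div_H[OF k(1)] subsetD[OF B_subset_H b_B] d(1,2) this]
    show False using k(2) by simp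
  qed
  have "\<forall>u\<in>G. \<exists>h. h \<in> G \<and> \<not> active h \<and> sec True h = u" using G_lift_True by metis
  then obtain L where L: "\<And>u. u \<in> G \<Longrightarrow> L u \<in> G" "\<And>u. u \<in> G \<Longrightarrow> \<not> active (L u)"
    "\<And>u. u \<in> G \<Longrightarrow> sec True (L u) = u" by metis
  define c where "c n = (L ^^ n) g" for n
  have c0: "c 0 = g" by (simp add: c_def)
  have cG: "c n \<in> G" for n by (induction n) (simp_all add: c_def gG L)
  have ca: "\<not> active (c n)" for n using gG L cG by (cases n) (simp_all add: c_def)
  have cs: "sec True (c (Suc n)) = c n" for n using L(3)[OF cG[of n]] by (simp add: c_def)
  have sH: "sec True h \<in> H k" if "h \<in> H k" "\<not> active h" for h using sec_in_H(1)[OF k(1) that] .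
  have cH: "c n \<notin> H k" for n
  proof (induction n)
    case 0
    then show ?case using gH by (simp add: c_def)
  next
    case (Suc n)
    then show ?case using sH[of "c (Suc n)"] ca cs by metis
  qed
  have "c i + - c (i + Suc p) \<notin> H k" for i p
  proof (induction i)
    case 0
    show ?case
    proof
      assume "c 0 + - c (0 + Suc p) \<in> H k"
      then have "sec True (c 0 + - c (0 + Suc p)) \<in> H k" using ca by (intro sH) auto
      moreover have "sec True (c 0 + - c (0 + Suc p)) = - c p"
        using ca[of "Suc p"] cs[of p] g0 c0 by simp
      ultimately have "- c p \<in> H k" by simp
      then show False using cH sgp_minus_iff[OF sgp_H] by blast
    qed
  next
    case (Suc i)
    show ?case
    proof
      assume "c (Suc i) + - c (Suc i + Suc p) \<in> H k"
      then have "sec True (c (Suc i) + - c (Suc i + Suc p)) \<in> H k" using ca by (intro sH) auto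
      then have "c i + - c (i + Suc p) \<in> H k" using ca cs by simp
      then show False using Suc by simp
    qed
  qed
  then have "c i + - c j \<notin> H k" if "i < j" for i j
    using that less_imp_Suc_add by (metis add_Suc_right)
  then show ?thesis using cG unfolding infidx_def by blast
qed

lemma idx2_or_conjs_H:
  assumes "maxi M"
  shows "idx2 M G \<or> (\<exists>g q. g \<in> G \<and> prime q \<and> odd (q :: nat) \<and> M = conjs g (H (int q)))"
  using maxi_dense[OF assms] idx2_if_not_dense[OF assms] by metis

lemma maxi_conjs_H:
  assumes "g \<in> G" "prime q" "odd (q :: nat)"
  shows "maxi (conjs g (H (int q)))" "infidx (conjs g (H (int q)))"
proof -
  show "maxi (conjs g (H (int q)))" using maxi_conjs[OF maxi_H] assms by blast
  have "\<not> is_unit (int q)" using assms by (simp add: prime_nat_iff)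
  then show "infidx (conjs g (H (int q)))" using infidx_conjs[OF infidx_H] assms by simp
qed

lemma H_inj:
  assumes "prime q" "odd (q :: nat)" "prime q'" "odd (q' :: nat)" "H (int q) = H (int q')"
  shows "q = q'"
proof -
  have "rot (int q) \<in> H (int q')" using assms rot_in_H[of "int q" "int q"] by simp
  then have "q' dvd q" using assms rot_in_H_iff[of "int q'"] by simp
  then show ?thesis using assms by (metis primes_dvd_imp_eq)
qed

end

section \<open>The group of a polynomial\<close>

declare add_bit_eq_xor [simp del] mult_bit_eq_and [simp del]

definition beta :: "bit poly \<Rightarrow> (nat \<Rightarrow> bit) \<Rightarrow> taut" where "beta f x = Abs_taut (B_act f x)"

lemma Rep_beta: "Rep_taut (beta f x) = B_act f x"
  by (simp add: beta_def Abs_taut_inverse B_act_in_Aut_T)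

lemma Rep_aT: "Rep_taut aT = a_aut" by (rule aT.rep_eq)

lemma Rep_0: "Rep_taut 0 = id" by (rule zero_taut.rep_eq)

lemma Rep_plus: "Rep_taut (g + h) = Rep_taut g \<circ> Rep_taut h" by (rule plus_taut.rep_eq)

lemma inj_Rep: "inj Rep_taut" by (simp add: inj_def Rep_taut_inject)

lemma active_beta: "\<not> active (beta f x)"
  by (simp add: active.rep_eq Rep_beta)

lemma Rep_sec_beta: "Rep_taut (sec c (beta f x)) = (if c then B_act f (rho f x) else A_act (omega f x))"
  by (cases c) (simp_all add: sec.rep_eq Rep_beta)

lemma sec_beta: "sec True (beta f x) = beta f (rho f x)"
  "sec False (beta f x) = (if omega f x = 1 then aT else 0)"
  by (simp_all add: Rep_taut_inject[symmetric] Rep_sec_beta Rep_beta A_act_def Rep_aT Rep_0)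

lemma rho_plus: "rho f (\<lambda>i. x i + y i) = (\<lambda>i. rho f x i + rho f y i)"
  unfolding rho_def sum.distrib[symmetric] distrib_right by (rule refl)

lemma omega_plus: "omega f (\<lambda>i. x i + y i) = omega f x + omega f y"
  unfolding omega_def sum.distrib[symmetric] distrib_right by (rule refl)

lemma A_act_plus: "A_act (e + e') w = A_act e (A_act e' w)"
proof -
  have a: "a_aut (a_aut w) = w" for w by (cases w) auto
  show ?thesis by (cases e; cases e') (simp_all add: A_act_def a)
qed

lemma B_act_plus: "B_act f (\<lambda>i. x i + y i) w = B_act f x (B_act f y w)"
proof (induction w arbitrary: x y)
  case (Cons c w)
  then show ?case by (cases c) (simp_all add: omega_plus rho_plus A_act_plus)
qed simp

lemma beta_plus: "beta f (\<lambda>i. x i + y i) = beta f x + beta f y"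
  by (simp add: Rep_taut_inject[symmetric] Rep_beta Rep_plus fun_eq_iff B_act_plus)

lemma B_auts_eq: "B_auts f = Rep_taut ` beta f ` B_vecs f"
  by (simp add: B_auts_def image_image Rep_beta)

locale sunic_poly =
  fixes f :: "bit poly"
  assumes degree_pos: "0 < degree f" and coeff_0: "coeff f 0 \<noteq> 0"
begin

text \<open>The companion matrix of \<open>f\<close>: a shift, with the last coordinate fed back
  through the coefficients. Signs vanish over the field with two elements.\<close>

lemma rho_apply:
  assumes "j < degree f"
  shows "rho f x j = (if j = 0 then 0 else x (j - 1)) + x (degree f - 1) * coeff f j"
proof -
  obtain k where k: "degree f = Suc k" using degree_pos by (cases "degree f") auto
  have "(\<Sum>i<k. x i * rho_b f i j) = (\<Sum>i<k. if i + 1 = j then x i else 0)"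
    by (rule sum.cong) (auto simp: rho_b_def b_vec_def k)
  also have "\<dots> = (if j = 0 then 0 else x (j - 1))"
  proof (cases j)
    case (Suc i)
    then have "i < k" using assms k by simp
    then show ?thesis using Suc by (simp add: sum.delta)
  qed simp
  finally show ?thesis using assms unfolding rho_def k lessThan_Suc by (simp add: rho_b_def k add.commute)
qed

lemma vec_eq_0_if_rho:
  assumes x: "x \<in> B_vecs f" and r: "rho f x = (\<lambda>_. 0)"
  shows "x = (\<lambda>_. 0)"
proof -
  have last: "x (degree f - 1) = 0"
    using rho_apply[of 0 x] degree_pos r coeff_0 by (simp add: fun_eq_iff)
  have "x i = 0" for i
  proof (cases "i < degree f")
    case True
    show ?thesis
    proof (cases "Suc i < degree f")
      case t: True
      then show ?thesis using rho_apply[OF t, of x] last r by (simp add: fun_eq_iff)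
    next
      case False
      then have "i = degree f - 1" using True by simp
      then show ?thesis using last by simp
    qed
  qed (use x in \<open>simp add: B_vecs_def\<close>)
  then show ?thesis by (simp add: fun_eq_iff)
qed

text \<open>Omega reads the last coordinate. Once that is zero, rho is a mere shift and moves the
  next coordinate there.\<close>

lemma vec_eq_0_if_omega:
  assumes x: "x \<in> B_vecs f" and o: "\<And>j. omega f ((rho f ^^ j) x) = 0"
  shows "x = (\<lambda>_. 0)"
proof -
  have *: "i < degree f \<Longrightarrow> y (degree f - 1 - i) = 0" if "\<And>j. omega f ((rho f ^^ j) y) = 0" for i y
    using that
  proof (induction i arbitrary: y)
    case 0
    then show ?case using 0(2)[of 0] omega_eq[OF degree_pos] by simp
  next
    case (Suc i)
    have "omega f ((rho f ^^ j) (rho f y)) = 0" for j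
      using Suc.prems(2)[of "Suc j"] by (simp add: funpow_swap1)
    then have "rho f y (degree f - 1 - i) = 0" using Suc by simp
    moreover have "y (degree f - 1) = 0" using Suc.prems(2)[of 0] omega_eq[OF degree_pos] by simp
    ultimately show ?case using rho_apply[of "degree f - 1 - i" y] Suc.prems(1) by simp
  qed
  have "x i = 0" for i
  proof (cases "i < degree f")
    case True
    then show ?thesis using *[of x "degree f - 1 - i"] o by simp
  qed (use x in \<open>simp add: B_vecs_def\<close>)
  then show ?thesis by (simp add: fun_eq_iff)
qed

lemma zero_B_vecs: "(\<lambda>_. 0) \<in> B_vecs f"
  and plus_B_vecs: "x \<in> B_vecs f \<Longrightarrow> y \<in> B_vecs f \<Longrightarrow> (\<lambda>i. x i + y i) \<in> B_vecs f"
  and b_vec_B_vecs: "i < degree f \<Longrightarrow> b_vec i \<in> B_vecs f"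
  by (auto simp: B_vecs_def b_vec_def)

lemma beta_zero: "beta f (\<lambda>_. 0) = 0"
proof -
  have "beta f (\<lambda>_. 0) + 0 = beta f (\<lambda>_. 0) + beta f (\<lambda>_. 0)"
    using beta_plus[of f "\<lambda>_. 0" "\<lambda>_. 0"] by simp
  then show ?thesis unfolding add_left_cancel by (rule sym)
qed

lemma beta_double: "beta f x + beta f x = 0"
proof -
  have "x i + x i = 0" for i by (cases "x i") auto
  then show ?thesis using beta_plus[of f x x] beta_zero by simp
qed

lemma beta_eq_0:
  assumes "x \<in> B_vecs f" "beta f x = 0"
  shows "x = (\<lambda>_. 0)"
proof (rule vec_eq_0_if_omega[OF assms(1)])
  fix j
  have "beta f ((rho f ^^ j) x) = 0"
    by (induction j) (simp_all add: assms sec_beta(1)[symmetric])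
  then have "(if omega f ((rho f ^^ j) x) = 1 then aT else 0) = 0" by (metis sec_beta(2) sec_0)
  then show "omega f ((rho f ^^ j) x) = 0" by (cases "omega f ((rho f ^^ j) x)") auto
qed

lemma inj_beta: "inj_on (beta f) (B_vecs f)"
proof (rule inj_onI)
  fix x y assume xy: "x \<in> B_vecs f" "y \<in> B_vecs f" "beta f x = beta f y"
  have "(\<lambda>i. x i + y i) = (\<lambda>_. 0)"
    using xy beta_double by (intro beta_eq_0 plus_B_vecs) (simp_all add: beta_plus)
  then have "x i + y i = 0" for i by (simp add: fun_eq_iff)
  then have "x i = y i" for i by (cases "x i"; cases "y i"; metis add_0_right add_0_left zero_neq_one)
  then show "x = y" by (simp add: fun_eq_iff)
qed

lemma finite_B_vecs: "finite (B_vecs f)"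
proof -
  have "(UNIV :: bit set) = {0, 1}" using bit_not_zero_iff by auto
  then have "finite (UNIV :: bit set)" by (metis finite.emptyI finite.insertI)
  then have "finite {x :: nat \<Rightarrow> bit. \<forall>i. (i \<in> {..<degree f} \<longrightarrow> x i \<in> UNIV) \<and> (i \<notin> {..<degree f} \<longrightarrow> x i = 0)}"
    by (intro finite_set_of_finite_funs) auto
  then show ?thesis by (rule rev_finite_subset) (auto simp: B_vecs_def)
qed

sublocale sunic_group "beta f ` B_vecs f"
proof
  show "finite (beta f ` B_vecs f)" using finite_B_vecs by simp
  show "0 \<in> beta f ` B_vecs f" using beta_zero zero_B_vecs by (metis imageI)
  show "\<exists>x\<in>beta f ` B_vecs f. x \<noteq> 0"
  proof (intro bexI)
    show "beta f (b_vec 0) \<noteq> 0"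
    proof
      assume "beta f (b_vec 0) = 0"
      then have "b_vec 0 = (\<lambda>_. 0)" by (rule beta_eq_0[OF b_vec_B_vecs[OF degree_pos]])
      then have "b_vec 0 0 = 0" by (rule fun_cong)
      then show False by (simp add: b_vec_def)
    qed
    show "beta f (b_vec 0) \<in> beta f ` B_vecs f" using b_vec_B_vecs degree_pos by blast
  qed
  fix g assume "g \<in> beta f ` B_vecs f"
  then obtain x where x: "x \<in> B_vecs f" "g = beta f x" by blast
  show "g + g = 0" using beta_double x by simp
  show "\<not> active g" using x active_beta by simp
  show "sec True g \<in> beta f ` B_vecs f" using x sec_beta(1) rho_in_B_vecs by simp
  show "sec False g = 0 \<or> sec False g = aT" using x sec_beta(2)[of f x] by (simp split: if_splits)
  show "g = 0" if "sec True g = 0"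
  proof -
    have "rho f x = (\<lambda>_. 0)" using that x sec_beta(1)[of f x] beta_eq_0 rho_in_B_vecs by simp
    then have "x = (\<lambda>_. 0)" by (rule vec_eq_0_if_rho[OF x(1)])
    then show ?thesis using x(2) beta_zero by simp
  qed
  fix h assume "h \<in> beta f ` B_vecs f"
  then obtain y where y: "y \<in> B_vecs f" "h = beta f y" by blast
  show "g + h \<in> beta f ` B_vecs f" using x y beta_plus[of f x y] plus_B_vecs by (metis imageI)
qed

section \<open>Transfer to the group of permutations of the vertices\<close>

lemma one_Aut_T: "\<one>\<^bsub>Aut_T\<^esub> = Rep_taut 0"
  unfolding Aut_T_def Rep_0 by simp

lemma mult_Aut_T: "Rep_taut g \<otimes>\<^bsub>Aut_T\<^esub> Rep_taut h = Rep_taut (g + h)"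
  unfolding Aut_T_def Rep_plus by simp

lemma inv_Aut_T: "inv\<^bsub>Aut_T\<^esub> (Rep_taut g) = Rep_taut (- g)"
proof (rule group.inv_equality[OF group_Aut_T])
  show "Rep_taut (- g) \<otimes>\<^bsub>Aut_T\<^esub> Rep_taut g = \<one>\<^bsub>Aut_T\<^esub>"
    by (simp add: mult_Aut_T one_Aut_T)
qed (simp_all add: Aut_T_def Rep_taut)

lemma Rep_generators: "insert a_aut (B_auts f) = Rep_taut ` insert aT (beta f ` B_vecs f)"
  by (simp add: B_auts_eq Rep_aT)

lemma carrier_Sunic: "carrier (Sunic f) = Rep_taut ` G"
proof -
  let ?X = "insert a_aut (B_auts f)"
  have "h \<in> Rep_taut ` G" if "h \<in> generate Aut_T ?X" for h
    using that
  proof (induction rule: generate.induct)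
    case one
    show ?case unfolding one_Aut_T using G_0 by blast
  next
    case (incl h)
    then show ?case unfolding Rep_generators using G_a G_B by auto
  next
    case (inv h)
    then obtain g where g: "h = Rep_taut g" "g \<in> G" unfolding Rep_generators using G_a G_B by auto
    show ?case unfolding g(1) inv_Aut_T using g(2) G_minus by blast
  next
    case (eng h1 h2)
    then obtain g1 g2 where "g1 \<in> G" "h1 = Rep_taut g1" "g2 \<in> G" "h2 = Rep_taut g2" by blast
    then have "h1 \<otimes>\<^bsub>Aut_T\<^esub> h2 = Rep_taut (g1 + g2)" "g1 + g2 \<in> G"
      by (simp_all only: mult_Aut_T G_add)
    then show ?case by simp
  qed
  moreover have "Rep_taut g \<in> generate Aut_T ?X" if "g \<in> G" for g
    using that
  proof (induction rule: gen_induct)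
    case zero
    show ?case unfolding one_Aut_T[symmetric] by (rule generate.one)
  next
    case (s g)
    have "Rep_taut aT \<otimes>\<^bsub>Aut_T\<^esub> Rep_taut g \<in> generate Aut_T ?X"
      using s by (intro generate.eng[OF generate.incl]) (auto simp: Rep_aT)
    then show ?case by (simp only: mult_Aut_T)
  next
    case (B x g)
    have "Rep_taut x \<otimes>\<^bsub>Aut_T\<^esub> Rep_taut g \<in> generate Aut_T ?X"
      using B by (intro generate.eng[OF generate.incl]) (auto simp: B_auts_eq)
    then show ?case by (simp only: mult_Aut_T)
  qed
  ultimately show ?thesis by (auto simp: Sunic_def)
qed

lemma mult_Sunic: "Rep_taut g \<otimes>\<^bsub>Sunic f\<^esub> Rep_taut h = Rep_taut (g + h)"
  using mult_Aut_T by (simp add: Sunic_def)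

lemma one_Sunic: "\<one>\<^bsub>Sunic f\<^esub> = Rep_taut 0"
  using one_Aut_T by (simp add: Sunic_def)

lemma group_Sunic: "group (Sunic f)"
proof -
  have "insert a_aut (B_auts f) \<subseteq> carrier Aut_T"
    unfolding Rep_generators using Rep_taut by (auto simp: Aut_T_def)
  then have "subgroup (generate Aut_T (insert a_aut (B_auts f))) Aut_T"
    by (rule group.generate_is_subgroup[OF group_Aut_T])
  then show ?thesis unfolding Sunic_def by (rule subgroup.subgroup_is_group[OF _ group_Aut_T])
qed

lemma inv_Sunic: "g \<in> G \<Longrightarrow> inv\<^bsub>Sunic f\<^esub> (Rep_taut g) = Rep_taut (- g)"
  by (rule group.inv_equality[OF group_Sunic])
    (simp_all add: mult_Sunic one_Sunic carrier_Sunic G_minus)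

lemma pow_Sunic: "Rep_taut g [^]\<^bsub>Sunic f\<^esub> (n :: nat) = Rep_taut (zmul (int n) g)"
proof (induction n)
  case 0
  then show ?case using one_Sunic monoid.nat_pow_0[OF group.is_monoid[OF group_Sunic]] by simp
next
  case (Suc n)
  have "zmul (int (Suc n)) g = zmul (int n) g + g" using zmul_add[of "int n" 1 g] by (simp add: add.commute)
  then show ?case
    using Suc monoid.nat_pow_Suc[OF group.is_monoid[OF group_Sunic], of "Rep_taut g" n] mult_Sunic by simp
qed

lemma Rep_mem_iff: "Rep_taut g \<in> Rep_taut ` K \<longleftrightarrow> g \<in> K"
  using inj_Rep by (simp add: inj_image_mem_iff)

lemma subgroup_Sunic_iff: "subgroup (Rep_taut ` K) (Sunic f) \<longleftrightarrow> sgp K \<and> K \<subseteq> G"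
proof
  assume s: "subgroup (Rep_taut ` K) (Sunic f)"
  have KG: "K \<subseteq> G" using subgroup.subset[OF s] inj_Rep by (simp add: carrier_Sunic inj_image_subset_iff)
  moreover have "sgp K"
  proof (rule sgpI)
    show "0 \<in> K" using subgroup.one_closed[OF s] by (simp add: one_Sunic Rep_mem_iff)
    show "g + h \<in> K" if "g \<in> K" "h \<in> K" for g h
      using subgroup.m_closed[OF s, of "Rep_taut g" "Rep_taut h"] that by (simp add: mult_Sunic Rep_mem_iff)
    show "- g \<in> K" if "g \<in> K" for g
    proof -
      have "g \<in> G" using that KG by auto
      then show ?thesis
        using subgroup.m_inv_closed[OF s, of "Rep_taut g"] that by (simp add: inv_Sunic Rep_mem_iff)
    qed
  qed
  ultimately show "sgp K \<and> K \<subseteq> G" by simp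
next
  assume K: "sgp K \<and> K \<subseteq> G"
  show "subgroup (Rep_taut ` K) (Sunic f)"
  proof (rule group.subgroupI[OF group_Sunic])
    show "Rep_taut ` K \<subseteq> carrier (Sunic f)" using K by (auto simp: carrier_Sunic)
    show "Rep_taut ` K \<noteq> {}" using K sgp_0 by blast
    fix u assume "u \<in> Rep_taut ` K"
    then obtain g where g: "g \<in> K" "u = Rep_taut g" by blast
    have "g \<in> G" using g K by auto
    then show "inv\<^bsub>Sunic f\<^esub> u \<in> Rep_taut ` K" using g K by (simp add: inv_Sunic sgp_minus Rep_mem_iff)
    fix v assume "v \<in> Rep_taut ` K"
    then obtain h where "h \<in> K" "v = Rep_taut h" by blast
    then show "u \<otimes>\<^bsub>Sunic f\<^esub> v \<in> Rep_taut ` K" using g K by (simp add: mult_Sunic sgp_add Rep_mem_iff)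
  qed
qed

lemma subgroup_Sunic_cases:
  assumes "subgroup M (Sunic f)"
  obtains K where "M = Rep_taut ` K" "sgp K" "K \<subseteq> G"
proof -
  obtain K where "M = Rep_taut ` K"
    using subgroup.subset[OF assms] unfolding carrier_Sunic by (auto simp: subset_image_iff)
  then show ?thesis using that assms subgroup_Sunic_iff by blast
qed

lemma Rep_image_eq_iff: "Rep_taut ` K = Rep_taut ` L \<longleftrightarrow> K = L"
  using inj_Rep by (rule inj_image_eq_iff)

lemma maximal_Sunic_iff: "maximal_subgroup (Rep_taut ` M) (Sunic f) \<longleftrightarrow> maxi M"
proof
  assume m: "maximal_subgroup (Rep_taut ` M) (Sunic f)"
  then have "sgp M" "M \<subseteq> G" "M \<noteq> G"
    by (auto simp: maximal_subgroup_def subgroup_Sunic_iff carrier_Sunic)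
  moreover have "K = M \<or> K = G" if "sgp K" "K \<subseteq> G" "M \<subseteq> K" for K
  proof -
    have "subgroup (Rep_taut ` K) (Sunic f)" "Rep_taut ` M \<subseteq> Rep_taut ` K"
      using that subgroup_Sunic_iff by auto
    then have "Rep_taut ` K = Rep_taut ` M \<or> Rep_taut ` K = Rep_taut ` G"
      using m unfolding maximal_subgroup_def carrier_Sunic by blast
    then show ?thesis by (simp add: Rep_image_eq_iff)
  qed
  ultimately show "maxi M" by (simp add: maxi_def)
next
  assume m: "maxi M"
  show "maximal_subgroup (Rep_taut ` M) (Sunic f)"
    unfolding maximal_subgroup_def
  proof (intro conjI allI impI)
    show "subgroup (Rep_taut ` M) (Sunic f)" using m subgroup_Sunic_iff by (simp add: maxi_def)
    show "Rep_taut ` M \<noteq> carrier (Sunic f)" using m by (simp add: maxi_def carrier_Sunic Rep_image_eq_iff)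
    fix K assume K: "subgroup K (Sunic f)" "Rep_taut ` M \<subseteq> K"
    obtain L where L: "K = Rep_taut ` L" "sgp L" "L \<subseteq> G" using subgroup_Sunic_cases[OF K(1)] .
    have "M \<subseteq> L" using K(2) inj_Rep by (simp add: L inj_image_subset_iff)
    then have "L = M \<or> L = G" using m L unfolding maxi_def by blast
    then show "K = Rep_taut ` M \<or> K = carrier (Sunic f)" using L by (auto simp: carrier_Sunic)
  qed
qed

lemma maximal_Sunic_cases:
  assumes "maximal_subgroup M (Sunic f)"
  obtains K where "M = Rep_taut ` K" "maxi K"
proof -
  have "subgroup M (Sunic f)" using assms by (simp add: maximal_subgroup_def)
  then obtain K where "M = Rep_taut ` K" using subgroup_Sunic_cases by metis
  then show ?thesis using that assms maximal_Sunic_iff by blast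
qed

lemma conj_set_Sunic:
  assumes "g \<in> G"
  shows "conj_set (Sunic f) (Rep_taut g) (Rep_taut ` K) = Rep_taut ` conjs g K"
  using assms by (simp add: conj_set_def conjs_def image_image inv_Sunic mult_Sunic)

lemma r_coset_Sunic: "Rep_taut ` K #>\<^bsub>Sunic f\<^esub> Rep_taut g = Rep_taut ` ((\<lambda>k. k + g) ` K)"
  by (auto simp: r_coset_def mult_Sunic)

lemma rcosets_idx2:
  assumes K: "sgp K" "K \<subseteq> G" "idx2 K G" "K \<noteq> G"
  shows "finite (rcosets\<^bsub>Sunic f\<^esub> (Rep_taut ` K))" "card (rcosets\<^bsub>Sunic f\<^esub> (Rep_taut ` K)) = 2"
proof -
  have 1: "(\<lambda>k. k + g) ` K = K" if "g \<in> K" for g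
  proof
    show "(\<lambda>k. k + g) ` K \<subseteq> K" using that sgp_add[OF K(1)] by auto
    show "K \<subseteq> (\<lambda>k. k + g) ` K"
    proof
      fix x assume "x \<in> K"
      then have "x + - g \<in> K" using that by (simp add: sgp_add[OF K(1)] sgp_minus[OF K(1)])
      then have "(x + - g) + g \<in> (\<lambda>k. k + g) ` K" by (rule imageI)
      then show "x \<in> (\<lambda>k. k + g) ` K" by simp
    qed
  qed
  have 2: "(\<lambda>k. k + g) ` K = G - K" if "g \<in> G - K" for g
  proof
    show "(\<lambda>k. k + g) ` K \<subseteq> G - K" using that K sgp_add_left[OF K(1)] G_add by auto
    show "G - K \<subseteq> (\<lambda>k. k + g) ` K"
    proof
      fix x assume "x \<in> G - K"
      then have "x + - g \<in> K" using that K(3) unfolding idx2_def by blast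
      then have "(x + - g) + g \<in> (\<lambda>k. k + g) ` K" by (rule imageI)
      then show "x \<in> (\<lambda>k. k + g) ` K" by simp
    qed
  qed
  obtain y where y: "y \<in> G - K" using K by blast
  have "rcosets\<^bsub>Sunic f\<^esub> (Rep_taut ` K) = (\<lambda>g. Rep_taut ` ((\<lambda>k. k + g) ` K)) ` G"
    by (auto simp: RCOSETS_def carrier_Sunic r_coset_Sunic)
  also have "\<dots> = {Rep_taut ` K, Rep_taut ` (G - K)}"
  proof
    show "(\<lambda>g. Rep_taut ` ((\<lambda>k. k + g) ` K)) ` G \<subseteq> {Rep_taut ` K, Rep_taut ` (G - K)}"
    proof
      fix C assume "C \<in> (\<lambda>g. Rep_taut ` ((\<lambda>k. k + g) ` K)) ` G"
      then obtain g where "g \<in> G" "C = Rep_taut ` ((\<lambda>k. k + g) ` K)" by blast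
      then show "C \<in> {Rep_taut ` K, Rep_taut ` (G - K)}" using 1[of g] 2[of g] by (cases "g \<in> K") auto
    qed
    have "Rep_taut ` K = Rep_taut ` ((\<lambda>k. k + 0) ` K)" by simp
    moreover have "Rep_taut ` (G - K) = Rep_taut ` ((\<lambda>k. k + y) ` K)" using 2[OF y] by simp
    ultimately show "{Rep_taut ` K, Rep_taut ` (G - K)} \<subseteq> (\<lambda>g. Rep_taut ` ((\<lambda>k. k + g) ` K)) ` G"
      using y G_0 by blast
  qed
  finally have e: "rcosets\<^bsub>Sunic f\<^esub> (Rep_taut ` K) = {Rep_taut ` K, Rep_taut ` (G - K)}" .
  have "K \<noteq> G - K" using sgp_0[OF K(1)] by blast
  then have "Rep_taut ` K \<noteq> Rep_taut ` (G - K)" by (simp add: Rep_image_eq_iff)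
  then show "finite (rcosets\<^bsub>Sunic f\<^esub> (Rep_taut ` K))" "card (rcosets\<^bsub>Sunic f\<^esub> (Rep_taut ` K)) = 2"
    unfolding e by simp_all
qed

lemma rcosets_infidx:
  assumes K: "sgp K" "infidx K"
  shows "infinite (rcosets\<^bsub>Sunic f\<^esub> (Rep_taut ` K))"
proof -
  obtain c :: "nat \<Rightarrow> taut" where c: "\<And>n. c n \<in> G" "\<And>i j. i < j \<Longrightarrow> c i + - c j \<notin> K"
    using K(2) unfolding infidx_def by blast
  define C where "C n = Rep_taut ` ((\<lambda>k. k + c n) ` K)" for n
  have ne: "C i \<noteq> C j" if "i < j" for i j
  proof
    assume "C i = C j"
    then have "(\<lambda>k. k + c i) ` K = (\<lambda>k. k + c j) ` K" by (simp add: C_def Rep_image_eq_iff)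
    moreover have "0 + c i \<in> (\<lambda>k. k + c i) ` K" using sgp_0[OF K(1)] by (rule imageI)
    ultimately obtain k where "k \<in> K" "c i = k + c j" by auto
    then show False using c(2)[OF that] by simp
  qed
  then have "inj C" by (intro linorder_injI)
  then have "infinite (range C)" by (rule range_inj_infinite)
  moreover have "range C \<subseteq> rcosets\<^bsub>Sunic f\<^esub> (Rep_taut ` K)"
    using c(1) by (auto simp: RCOSETS_def carrier_Sunic r_coset_Sunic C_def)
  ultimately show ?thesis using infinite_super by blast
qed

section \<open>Counting the subgroups of index 2\<close>

definition coord :: "taut \<Rightarrow> nat \<Rightarrow> bit" where
  "coord g = inv_into (B_vecs f) (beta f) (vec g)"

lemma coord_beta: "x \<in> B_vecs f \<Longrightarrow> coord (beta f x) = x"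
  using inj_beta by (simp add: coord_def)

lemma coord_props:
  assumes "g \<in> G"
  shows "coord g \<in> B_vecs f" "beta f (coord g) = vec g"
  using vec_in_B[OF assms] by (auto simp: coord_def inv_into_into f_inv_into_f)

lemma coord_plus:
  assumes "g \<in> G" "h \<in> G"
  shows "coord (g + h) = (\<lambda>i. coord g i + coord h i)"
proof -
  have "vec (g + h) = beta f (\<lambda>i. coord g i + coord h i)"
    using assms by (simp add: vec_add beta_plus coord_props)
  moreover have "(\<lambda>i. coord g i + coord h i) \<in> B_vecs f" using assms by (intro plus_B_vecs coord_props)
  ultimately show ?thesis using inj_beta by (simp add: coord_def)
qed

definition gn :: "nat \<Rightarrow> taut" where
  "gn i = (if i = 0 then aT else beta f (b_vec (i - 1)))"

text \<open>A subgroup of index at most 2 is the kernel of a homomorphism to the group of order 2,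
  fixed by its values on generators.\<close>

lemma eq_if_same_generators:
  assumes M: "sgp M" "M \<subseteq> G" "idx2 M G" and L: "sgp L" "L \<subseteq> G" "idx2 L G"
    and e: "\<And>i. i \<le> degree f \<Longrightarrow> gn i \<in> M \<longleftrightarrow> gn i \<in> L"
  shows "M = L"
proof -
  have bG: "beta f x \<in> G" if "x \<in> B_vecs f" for x using that G_B by blast
  have be: "beta f x \<in> M \<longleftrightarrow> beta f x \<in> L" if "n \<le> degree f" "\<And>i. n \<le> i \<Longrightarrow> x i = 0" for n x
    using that
  proof (induction n arbitrary: x)
    case 0
    then have "x = (\<lambda>_. 0)" by (simp add: fun_eq_iff)
    then show ?case using sgp_0[OF M(1)] sgp_0[OF L(1)] by (simp add: beta_zero)
  next
    case (Suc n)
    show ?case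
    proof (cases "x n = 0")
      case True
      then have "x i = 0" if "n \<le> i" for i using that Suc.prems(2) by (cases "i = n") auto
      then show ?thesis using Suc by simp
    next
      case False
      define y where "y = (\<lambda>i. if i = n then 0 else x i)"
      have x: "x = (\<lambda>i. y i + b_vec n i)" using False by (auto simp: y_def b_vec_def fun_eq_iff)
      have yB: "y \<in> B_vecs f" using Suc.prems by (auto simp: y_def B_vecs_def)
      have nB: "b_vec n \<in> B_vecs f" using Suc.prems by (intro b_vec_B_vecs) simp
      have "y i = 0" if "n \<le> i" for i using that Suc.prems(2)[of i] by (simp add: y_def)
      then have "beta f y \<in> M \<longleftrightarrow> beta f y \<in> L" using Suc by simp
      moreover have "beta f (b_vec n) \<in> M \<longleftrightarrow> beta f (b_vec n) \<in> L"
        using e[of "Suc n"] Suc.prems(1) by (simp add: gn_def)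
      moreover have "beta f x = beta f y + beta f (b_vec n)" by (subst x) (rule beta_plus)
      ultimately show ?thesis
        using idx2_add_iff[OF sgp_G M(1,3) bG[OF yB] bG[OF nB]] idx2_add_iff[OF sgp_G L(1,3) bG[OF yB] bG[OF nB]]
        by simp
    qed
  qed
  have "g \<in> M \<longleftrightarrow> g \<in> L" if g: "g \<in> G" for g
  proof -
    have v: "vec g \<in> M \<longleftrightarrow> vec g \<in> L"
      using be[of "degree f" "coord g"] coord_props[OF g] by (simp add: B_vecs_def)
    have a: "aT \<in> M \<longleftrightarrow> aT \<in> L" using e[of 0] by (simp add: gn_def)
    have vG: "vec g \<in> G" using vec_in_B[OF g] G_B by blast
    show ?thesis
      using v a idx2_class[OF M g] idx2_class[OF L g]
        idx2_add_iff[OF sgp_G M(1,3) vG G_a] idx2_add_iff[OF sgp_G L(1,3) vG G_a]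
      by (cases "active g") simp_all
  qed
  then show ?thesis using M L by blast
qed

definition I2 :: "taut set set" where
  "I2 = {M. sgp M \<and> M \<subseteq> G \<and> idx2 M G \<and> M \<noteq> G}"

text \<open>The homomorphism to the field with two elements that is 1 on exactly those generators
  \<open>gn i\<close> with \<open>i\<close> in \<open>S\<close>.\<close>

definition chi :: "nat set \<Rightarrow> taut \<Rightarrow> bit" where
  "chi S g = (if 0 \<in> S \<and> active g then 1 else 0) + (\<Sum>i<degree f. if Suc i \<in> S then coord g i else 0)"

lemma chi_plus: "g \<in> G \<Longrightarrow> h \<in> G \<Longrightarrow> chi S (g + h) = chi S g + chi S h"
proof -
  assume g: "g \<in> G" "h \<in> G"
  have "(\<Sum>i<degree f. if Suc i \<in> S then coord (g + h) i else 0) =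
    (\<Sum>i<degree f. if Suc i \<in> S then coord g i else 0) + (\<Sum>i<degree f. if Suc i \<in> S then coord h i else 0)"
    unfolding sum.distrib[symmetric] by (rule sum.cong) (simp_all add: coord_plus g)
  then show ?thesis unfolding chi_def by (cases "active g"; cases "active h") simp_all
qed

lemma chi_gn: "i \<le> degree f \<Longrightarrow> chi S (gn i) = (if i \<in> S then 1 else 0)"
proof (cases i)
  case 0
  have "coord aT = (\<lambda>_. 0)" using coord_beta[OF zero_B_vecs] by (simp add: coord_def beta_zero)
  then show ?thesis using 0 by (simp add: chi_def gn_def cong: if_cong)
next
  case (Suc j)
  assume "i \<le> degree f"
  then have j: "j < degree f" using Suc by simp
  have "(\<Sum>i<degree f. if Suc i \<in> S then b_vec j i else 0) = (\<Sum>i<degree f. if i = j then (if Suc j \<in> S then 1 else 0) else 0)"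
    by (rule sum.cong) (auto simp: b_vec_def)
  also have "\<dots> = (if Suc j \<in> S then 1 else 0)" using j by (simp add: sum.delta)
  finally show ?thesis using Suc j by (simp add: chi_def gn_def coord_beta b_vec_B_vecs active_beta cong: if_cong)
qed

lemma gn_in_G: "i \<le> degree f \<Longrightarrow> gn i \<in> G"
  using G_a G_B b_vec_B_vecs by (auto simp: gn_def)

text \<open>The generators outside \<open>M\<close> determine \<open>M\<close>. Any nonempty subset
  of the \<open>m + 1\<close> generators occurs, and the empty one belongs to
  \<open>G\<close>.\<close>

lemma card_I2: "finite I2" "card I2 = 2 ^ (degree f + 1) - 1"
proof -
  define F where "F M = {i. i \<le> degree f \<and> gn i \<notin> M}" for M
  have Feq: "M = L" if "F M = F L" "sgp M" "M \<subseteq> G" "idx2 M G" "sgp L" "L \<subseteq> G" "idx2 L G" for M L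
    using that by (intro eq_if_same_generators) (auto simp: F_def)
  have GG: "idx2 G G" by (simp add: idx2_def)
  have "bij_betw F I2 (Pow {..degree f} - {{}})"
    unfolding bij_betw_def
  proof
    show "inj_on F I2" by (rule inj_onI, rule Feq) (simp_all add: I2_def)
    show "F ` I2 = Pow {..degree f} - {{}}"
    proof
      show "F ` I2 \<subseteq> Pow {..degree f} - {{}}"
      proof
        fix S assume "S \<in> F ` I2"
        then obtain M where M: "M \<in> I2" "S = F M" by blast
        have "F M \<noteq> {}"
        proof
          assume "F M = {}"
          moreover have "F G = {}" using gn_in_G by (auto simp: F_def)
          ultimately have "F M = F G" by simp
          then have "M = G" using M GG sgp_G by (intro Feq) (simp_all add: I2_def)
          then show False using M by (simp add: I2_def)
        qed
        then show "S \<in> Pow {..degree f} - {{}}" using M by (auto simp: F_def)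
      qed
      show "Pow {..degree f} - {{}} \<subseteq> F ` I2"
      proof
        fix S assume S: "S \<in> Pow {..degree f} - {{}}"
        define M where "M = {g \<in> G. chi S g = 0}"
        have c0: "chi S 0 = 0" using chi_plus[OF G_0 G_0] by (metis add.right_neutral add_left_cancel)
        have cm: "chi S (- g) = chi S g" if "g \<in> G" for g
          using chi_plus[OF that G_minus[OF that], of S] c0 by (cases "chi S g"; cases "chi S (- g)") auto
        have "sgp M" by (rule sgpI) (auto simp: M_def G_0 c0 chi_plus G_add G_minus cm)
        moreover have "idx2 M G" by (auto simp: idx2_def M_def chi_plus G_add G_minus cm)
        moreover have "F M = S" using S by (auto simp: F_def M_def chi_gn gn_in_G split: if_splits)
        moreover have "M \<noteq> G"
        proof
          assume "M = G"
          then have "F M = {}" using gn_in_G by (auto simp: F_def)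
          then show False using \<open>F M = S\<close> S by simp
        qed
        moreover have "M \<subseteq> G" by (auto simp: M_def)
        ultimately show "S \<in> F ` I2" by (auto simp: I2_def intro!: image_eqI[of _ _ M])
      qed
    qed
  qed
  then have "finite I2" "card I2 = card (Pow {..degree f} - {{}})"
    using bij_betw_finite bij_betw_same_card by (metis finite_Diff finite_Pow_iff finite_atMost, blast)
  then show "finite I2" "card I2 = 2 ^ (degree f + 1) - 1" by (simp_all add: card_Pow)
qed

lemma psi_eq_iff:
  assumes "x \<in> beta f ` B_vecs f"
  shows "psi (Rep_taut x) = (a_aut, Rep_taut x) \<longleftrightarrow> sec False x = aT \<and> sec True x = x"
proof -
  obtain y where y: "x = beta f y" using assms by blast
  have "psi (Rep_taut x) = (Rep_taut (sec False x), Rep_taut (sec True x))"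
    unfolding y by (simp add: Rep_beta psi_B_act Rep_sec_beta)
  then show ?thesis by (simp add: Rep_aT[symmetric] Rep_taut_inject)
qed

end

section \<open>Subgroups of infinite index\<close>

locale sunic_poly_b = sunic_poly f + sunic_b "beta f ` B_vecs f" b for f b
begin

text \<open>If omega has trivial kernel, \<open>B\<close> is \<open>{0, b}\<close>, so
  \<open>G\<close> is generated by the reflections \<open>a\<close> and \<open>b\<close> and equals
  \<open>D 1\<close>.\<close>

lemma Sunic_D_inf:
  assumes "\<not> (\<exists>x\<in>beta f ` B_vecs f. x \<noteq> 0 \<and> \<not> om x)"
  shows "Sunic f \<cong> D_inf"
proof -
  let ?B = "beta f ` B_vecs f"
  have cases_B: "x = 0 \<or> x = b" if x: "x \<in> ?B" for x
  proof (rule ccontr)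
    assume n: "\<not> (x = 0 \<or> x = b)"
    have "x + b \<noteq> 0" using n x by (metis add.right_neutral cancel_B)
    moreover have "om x" using n x assms by blast
    then have "\<not> om (x + b)" using x om_b by (simp add: om_add)
    moreover have "x + b \<in> ?B" using x add_B by simp
    ultimately show False using assms by blast
  qed
  have "?B \<subseteq> D 1"
  proof
    fix x assume "x \<in> ?B"
    then show "x \<in> D 1" using cases_B[of x] sgp_0[OF sgp_D, of 1] b_in_D[of 1] by fastforce
  qed
  then have GD: "G = D 1" using gen_subset[OF sgp_D a_in_D1] D_subset_G by blast
  define h :: "int \<times> bool \<Rightarrow> vertex \<Rightarrow> vertex" where
    "h = (\<lambda>(k, s). Rep_taut (rot k + (if s then b else 0)))"
  have "h \<in> iso D_inf (Sunic f)"
  proof (rule isoI)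
    show "h \<in> hom D_inf (Sunic f)"
    proof (rule homI)
      fix x y :: "int \<times> bool"
      obtain k s l t where xy: "x = (k, s)" "y = (l, t)" by (cases x; cases y)
      show "h x \<in> carrier (Sunic f)"
        unfolding carrier_Sunic h_def xy by (auto intro!: G_add)
      show "h (x \<otimes>\<^bsub>D_inf\<^esub> y) = h x \<otimes>\<^bsub>Sunic f\<^esub> h y"
        unfolding h_def xy by (cases s; cases t) (simp_all add: D_inf_def mult_Sunic)
    qed
    show "bij_betw h (carrier D_inf) (carrier (Sunic f))"
      unfolding bij_betw_def
    proof
      show "inj_on h (carrier D_inf)"
      proof (rule inj_onI)
        fix x y assume e: "h x = h y"
        obtain k s l t where xy: "x = (k, s)" "y = (l, t)" by (cases x; cases y)
        have e': "rot k + (if s then b else 0) = rot l + (if t then b else 0)"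
          using e by (simp add: h_def xy Rep_taut_inject)
        then show "x = y" by (cases s; cases t) (auto simp: xy dest: add_right_imp_eq)
      qed
      show "h ` carrier D_inf = carrier (Sunic f)"
      proof
        show "h ` carrier D_inf \<subseteq> carrier (Sunic f)"
          unfolding carrier_Sunic by (auto simp: h_def Rep_mem_iff intro!: G_add)
        show "carrier (Sunic f) \<subseteq> h ` carrier D_inf"
        proof
          fix u assume "u \<in> carrier (Sunic f)"
          then obtain g where g: "g \<in> D 1" "u = Rep_taut g" by (auto simp: carrier_Sunic GD)
          from g(1) show "u \<in> h ` carrier D_inf"
          proof (cases rule: D_cases)
            case (1 i)
            then have "u = h (i, False)" using g by (simp add: h_def)
            then show ?thesis by (simp add: D_inf_def)
          next
            case (2 i)
            then have "u = h (i, True)" using g by (simp add: h_def)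
            then show ?thesis by (simp add: D_inf_def)
          qed
        qed
      qed
    qed
  qed
  then have "D_inf \<cong> Sunic f" by (auto simp: is_iso_def)
  then show ?thesis using group.iso_sym[OF group_D_inf] by blast
qed

lemma unique_b:
  assumes "x \<in> beta f ` B_vecs f" "sec False x = aT" "sec True x = x"
  shows "x = b"
proof (rule ccontr)
  assume "x \<noteq> b"
  then obtain j where "\<not> om (rpow j x)" using not_om_ex assms by blast
  moreover have "rpow j x = x" by (induction j) (simp_all add: rpow_Suc assms)
  ultimately show False using assms by (simp add: om_def)
qed

lemma pow_ab: "(a_aut \<otimes>\<^bsub>Sunic f\<^esub> Rep_taut b) [^]\<^bsub>Sunic f\<^esub> (q :: nat) = Rep_taut (rot (int q))"
  unfolding Rep_aT[symmetric] mult_Sunic pow_Sunic rot_def ..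

lemma H_sub_gens: "H_sub f (Rep_taut b) q =
    generate (Sunic f) (Rep_taut ` insert (rot (int q)) (beta f ` B_vecs f))"
  by (simp add: H_sub_def pow_ab B_auts_eq)

lemma H_sub_eq: "H_sub f (Rep_taut b) q = Rep_taut ` H (int q)"
proof
  let ?X = "Rep_taut ` insert (rot (int q)) (beta f ` B_vecs f)"
  have X: "?X \<subseteq> carrier (Sunic f)" unfolding carrier_Sunic using G_B by auto
  show "H_sub f (Rep_taut b) q \<subseteq> Rep_taut ` H (int q)"
    unfolding H_sub_gens
  proof (rule group.generate_subgroup_incl[OF group_Sunic])
    show "?X \<subseteq> Rep_taut ` H (int q)" using rot_in_H[of "int q" "int q"] B_subset_H by auto
    show "subgroup (Rep_taut ` H (int q)) (Sunic f)" using subgroup_Sunic_iff sgp_H H_subset_G by blast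
  qed
  have "subgroup (generate (Sunic f) ?X) (Sunic f)" using group.generate_is_subgroup[OF group_Sunic X] .
  then obtain K where K: "generate (Sunic f) ?X = Rep_taut ` K" "sgp K" "K \<subseteq> G"
    by (rule subgroup_Sunic_cases)
  have "?X \<subseteq> Rep_taut ` K" unfolding K(1)[symmetric] by (auto intro: generate.incl)
  then have "insert (rot (int q)) (beta f ` B_vecs f) \<subseteq> K" using inj_Rep by (simp only: inj_image_subset_iff)
  then have "H (int q) \<subseteq> K" using K(2) by (intro H_subset) auto
  then show "Rep_taut ` H (int q) \<subseteq> H_sub f (Rep_taut b) q" unfolding H_sub_gens K(1) by blast
qed

end

locale sunic_poly_big = sunic_poly_b f b + sunic_big "beta f ` B_vecs f" b for f b
begin

lemma finite_rcosets_iff: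
  assumes "maxi K"
  shows "finite (rcosets\<^bsub>Sunic f\<^esub> (Rep_taut ` K)) \<longleftrightarrow> K \<in> I2"
proof
  have K: "sgp K" "K \<subseteq> G" "K \<noteq> G" using assms by (auto simp: maxi_def)
  show "K \<in> I2" if "finite (rcosets\<^bsub>Sunic f\<^esub> (Rep_taut ` K))"
    using idx2_or_conjs_H[OF assms]
  proof
    assume "\<exists>g q. g \<in> G \<and> prime q \<and> odd (q :: nat) \<and> K = conjs g (H (int q))"
    then have "infidx K" using maxi_conjs_H(2) by blast
    then show ?thesis using rcosets_infidx[OF K(1)] that by blast
  qed (use K in \<open>simp add: I2_def\<close>)
  show "finite (rcosets\<^bsub>Sunic f\<^esub> (Rep_taut ` K))" if "K \<in> I2"
    using that rcosets_idx2(1)[of K] by (auto simp: I2_def)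
qed

lemma finite_index_maximal:
  "{M. maximal_subgroup M (Sunic f) \<and> finite (rcosets\<^bsub>Sunic f\<^esub> M)} = (`) Rep_taut ` I2"
proof
  show "{M. maximal_subgroup M (Sunic f) \<and> finite (rcosets\<^bsub>Sunic f\<^esub> M)} \<subseteq> (`) Rep_taut ` I2"
  proof
    fix M assume M: "M \<in> {M. maximal_subgroup M (Sunic f) \<and> finite (rcosets\<^bsub>Sunic f\<^esub> M)}"
    then obtain K where "M = Rep_taut ` K" "maxi K" using maximal_Sunic_cases by blast
    then show "M \<in> (`) Rep_taut ` I2" using M finite_rcosets_iff by blast
  qed
  show "(`) Rep_taut ` I2 \<subseteq> {M. maximal_subgroup M (Sunic f) \<and> finite (rcosets\<^bsub>Sunic f\<^esub> M)}"
  proof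
    fix M assume "M \<in> (`) Rep_taut ` I2"
    then obtain K where K: "K \<in> I2" "M = Rep_taut ` K" by blast
    then have "maxi K" using maxi_idx2 by (simp add: I2_def)
    then show "M \<in> {M. maximal_subgroup M (Sunic f) \<and> finite (rcosets\<^bsub>Sunic f\<^esub> M)}"
      using K maximal_Sunic_iff finite_rcosets_iff by simp
  qed
qed

lemma infinite_index_maximal:
  "{M. maximal_subgroup M (Sunic f) \<and> infinite (rcosets\<^bsub>Sunic f\<^esub> M)} =
   {conj_set (Sunic f) g (H_sub f (Rep_taut b) q) | g q. g \<in> carrier (Sunic f) \<and> prime q \<and> odd q}"
proof
  show "{M. maximal_subgroup M (Sunic f) \<and> infinite (rcosets\<^bsub>Sunic f\<^esub> M)} \<subseteq>
    {conj_set (Sunic f) g (H_sub f (Rep_taut b) q) | g q. g \<in> carrier (Sunic f) \<and> prime q \<and> odd q}"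
  proof
    fix M assume M: "M \<in> {M. maximal_subgroup M (Sunic f) \<and> infinite (rcosets\<^bsub>Sunic f\<^esub> M)}"
    then obtain K where K: "M = Rep_taut ` K" "maxi K" using maximal_Sunic_cases by blast
    then have "K \<notin> I2" using M finite_rcosets_iff by blast
    then have "\<not> idx2 K G" using K by (auto simp: I2_def maxi_def)
    then obtain g q where q: "g \<in> G" "prime q" "odd (q :: nat)" "K = conjs g (H (int q))"
      using idx2_or_conjs_H[OF K(2)] by blast
    have "M = conj_set (Sunic f) (Rep_taut g) (H_sub f (Rep_taut b) q)"
      using K(1) q conj_set_Sunic[OF q(1)] by (simp add: H_sub_eq)
    moreover have "Rep_taut g \<in> carrier (Sunic f)" using q by (simp add: carrier_Sunic)
    ultimately show "M \<in> {conj_set (Sunic f) g (H_sub f (Rep_taut b) q) | g q.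
        g \<in> carrier (Sunic f) \<and> prime q \<and> odd q}" using q by blast
  qed
  show "{conj_set (Sunic f) g (H_sub f (Rep_taut b) q) | g q. g \<in> carrier (Sunic f) \<and> prime q \<and> odd q}
    \<subseteq> {M. maximal_subgroup M (Sunic f) \<and> infinite (rcosets\<^bsub>Sunic f\<^esub> M)}"
  proof
    fix M assume "M \<in> {conj_set (Sunic f) g (H_sub f (Rep_taut b) q) | g q.
        g \<in> carrier (Sunic f) \<and> prime q \<and> odd q}"
    then obtain u q where u: "u \<in> carrier (Sunic f)" "prime q" "odd (q :: nat)"
      "M = conj_set (Sunic f) u (H_sub f (Rep_taut b) q)" by blast
    then obtain g where g: "g \<in> G" "u = Rep_taut g" by (auto simp: carrier_Sunic)
    have M: "M = Rep_taut ` conjs g (H (int q))" using u(4) g conj_set_Sunic[OF g(1)] by (simp add: H_sub_eq)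
    have "maxi (conjs g (H (int q)))" "infidx (conjs g (H (int q)))" using maxi_conjs_H[OF g(1) u(2,3)] .
    then show "M \<in> {M. maximal_subgroup M (Sunic f) \<and> infinite (rcosets\<^bsub>Sunic f\<^esub> M)}"
      using M maximal_Sunic_iff rcosets_infidx by (simp add: maxi_def)
  qed
qed

lemma infinite_odd_primes: "infinite {q :: nat. prime q \<and> odd q}"
proof
  assume "finite {q :: nat. prime q \<and> odd q}"
  moreover have "{q :: nat. prime q} \<subseteq> insert 2 {q. prime q \<and> odd q}"
    using primes_dvd_imp_eq two_is_prime_nat by blast
  ultimately have "finite {q :: nat. prime q}" by (meson finite_insert finite_subset)
  then show False using primes_infinite by blast
qed

lemma infinite_maximal: "infinite {M. maximal_subgroup M (Sunic f)}"
proof -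
  have "inj_on (\<lambda>q. Rep_taut ` H (int q)) {q. prime q \<and> odd q}"
    by (rule inj_onI) (auto simp: Rep_image_eq_iff intro: H_inj)
  then have "infinite ((\<lambda>q. Rep_taut ` H (int q)) ` {q. prime q \<and> odd q})"
    using infinite_odd_primes finite_imageD by blast
  moreover have "(\<lambda>q. Rep_taut ` H (int q)) ` {q. prime q \<and> odd q} \<subseteq> {M. maximal_subgroup M (Sunic f)}"
    using maxi_H maximal_Sunic_iff by blast
  ultimately show ?thesis using infinite_super by blast
qed

lemma countable_maximal: "countable {M. maximal_subgroup M (Sunic f)}"
proof -
  have "{M. maximal_subgroup M (Sunic f)} \<subseteq>
    (`) Rep_taut ` I2 \<union> (\<lambda>(g, q). conj_set (Sunic f) g (H_sub f (Rep_taut b) q)) ` (carrier (Sunic f) \<times> UNIV)"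
  proof
    fix M assume M: "M \<in> {M. maximal_subgroup M (Sunic f)}"
    show "M \<in> (`) Rep_taut ` I2 \<union> (\<lambda>(g, q). conj_set (Sunic f) g (H_sub f (Rep_taut b) q)) ` (carrier (Sunic f) \<times> UNIV)"
    proof (cases "finite (rcosets\<^bsub>Sunic f\<^esub> M)")
      case True
      then show ?thesis using M finite_index_maximal by blast
    next
      case False
      then have "M \<in> {conj_set (Sunic f) g (H_sub f (Rep_taut b) q) | g q. g \<in> carrier (Sunic f) \<and> prime q \<and> odd q}"
        using M infinite_index_maximal by blast
      then show ?thesis by blast
    qed
  qed
  moreover have "countable (carrier (Sunic f))" unfolding carrier_Sunic using countable_G by (rule countable_image)
  then have "countable ((\<lambda>(g, q). conj_set (Sunic f) g (H_sub f (Rep_taut b) q)) ` (carrier (Sunic f) \<times> (UNIV :: nat set)))"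
    by (intro countable_image countable_SIGMA) auto
  moreover have "countable ((`) Rep_taut ` I2)" using card_I2(1) by (simp add: countable_finite)
  ultimately show ?thesis by (meson countable_Un countable_subset)
qed

end

theorem theorem1p1:
  fixes f :: "bit poly" and m :: nat
  assumes "m \<ge> 1" and "degree f = m" and "lead_coeff f = 1" and "coeff f 0 \<noteq> 0"
    and non_torsion:
      "\<exists>g\<in>carrier (Sunic f). \<forall>n::nat. n > 0 \<longrightarrow> g [^]\<^bsub>Sunic f\<^esub> n \<noteq> \<one>\<^bsub>Sunic f\<^esub>"
    and not_dihedral: "\<not> Sunic f \<cong> D_inf"
  shows "infinite {M. maximal_subgroup M (Sunic f)} \<and>
    countable {M. maximal_subgroup M (Sunic f)} \<and>
    finite {M. maximal_subgroup M (Sunic f) \<and> finite (rcosets\<^bsub>Sunic f\<^esub> M)} \<and>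
    (card {M. maximal_subgroup M (Sunic f) \<and> finite (rcosets\<^bsub>Sunic f\<^esub> M)} = 2 ^ (m + 1) - 1) \<and>
    (\<forall>M. maximal_subgroup M (Sunic f) \<and> finite (rcosets\<^bsub>Sunic f\<^esub> M) \<longrightarrow>
           card (rcosets\<^bsub>Sunic f\<^esub> M) = 2) \<and>
    (\<exists>!b. b \<in> B_auts f \<and> psi b = (a_aut, b)) \<and>
    (\<forall>b. b \<in> B_auts f \<and> psi b = (a_aut, b) \<longrightarrow>
           {M. maximal_subgroup M (Sunic f) \<and> infinite (rcosets\<^bsub>Sunic f\<^esub> M)} =
           {conj_set (Sunic f) g (H_sub f b q) | g q.
              g \<in> carrier (Sunic f) \<and> prime q \<and> odd q}) \<and>
    (\<forall>b q. b \<in> B_auts f \<and> psi b = (a_aut, b) \<and> prime q \<and> odd q \<longrightarrow>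
           (\<exists>S. finite S \<and> S \<subseteq> carrier (Sunic f) \<and> H_sub f b q = generate (Sunic f) S))"
proof -
  interpret p: sunic_poly f using assms(1,2,4) by unfold_locales auto
  obtain g where g: "g \<in> p.G" "\<And>n :: nat. n > 0 \<Longrightarrow> Rep_taut g [^]\<^bsub>Sunic f\<^esub> n \<noteq> \<one>\<^bsub>Sunic f\<^esub>"
    using non_torsion by (auto simp: p.carrier_Sunic)
  have "\<not> torsion g"
  proof
    assume "torsion g"
    then obtain i where "i > 0" "zmul i g = 0" by (auto simp: torsion_def)
    then have "Rep_taut g [^]\<^bsub>Sunic f\<^esub> nat i = \<one>\<^bsub>Sunic f\<^esub>" by (simp add: p.pow_Sunic p.one_Sunic)
    then show False using g(2)[of "nat i"] \<open>i > 0\<close> by simp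
  qed
  then obtain b where b: "b \<in> beta f ` B_vecs f" "om b" "sec True b = b"
    using p.fixed_element_if_not_torsion[OF g(1)] by blast
  interpret pb: sunic_poly_b f b using b by unfold_locales
  \<comment> \<open>A trivial kernel of omega would make the group dihedral.\<close>
  interpret pm: sunic_poly_big f b using pb.Sunic_D_inf not_dihedral by unfold_locales blast
  have uniq: "c = Rep_taut b" if "c \<in> B_auts f" "psi c = (a_aut, c)" for c
    using that pb.unique_b p.psi_eq_iff by (auto simp: B_auts_eq)
  have bb: "Rep_taut b \<in> B_auts f" "psi (Rep_taut b) = (a_aut, Rep_taut b)"
    using p.psi_eq_iff[OF b(1)] b by (auto simp: B_auts_eq)
  have c2: "card (rcosets\<^bsub>Sunic f\<^esub> M) = 2"
    if "maximal_subgroup M (Sunic f) \<and> finite (rcosets\<^bsub>Sunic f\<^esub> M)" for M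
  proof -
    have "M \<in> (`) Rep_taut ` p.I2" using that pm.finite_index_maximal by blast
    then obtain K where "M = Rep_taut ` K" "K \<in> p.I2" by blast
    then show ?thesis using p.rcosets_idx2(2)[of K] by (simp add: p.I2_def)
  qed
  have inj: "inj_on ((`) Rep_taut) p.I2" by (rule inj_onI) (simp add: p.Rep_image_eq_iff)
  have fin: "card ((`) Rep_taut ` p.I2) = 2 ^ (m + 1) - 1" "finite ((`) Rep_taut ` p.I2)"
    using p.card_I2 assms(2) by (simp_all add: card_image[OF inj])
  have fg: "\<exists>S. finite S \<and> S \<subseteq> carrier (Sunic f) \<and> H_sub f (Rep_taut b) q = generate (Sunic f) S" for q
    using p.finite_B p.G_B pb.rot_in_G unfolding pb.H_sub_gens p.carrier_Sunic
    by (intro exI[of _ "Rep_taut ` insert (pb.rot (int q)) (beta f ` B_vecs f)"]) auto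
  show ?thesis
  proof (intro conjI allI impI)
    show "\<exists>!b. b \<in> B_auts f \<and> psi b = (a_aut, b)" using bb uniq by metis
    fix c assume "c \<in> B_auts f \<and> psi c = (a_aut, c)"
    then have "c = Rep_taut b" using uniq by blast
    then show "{M. maximal_subgroup M (Sunic f) \<and> infinite (rcosets\<^bsub>Sunic f\<^esub> M)} =
           {conj_set (Sunic f) g (H_sub f c q) | g q. g \<in> carrier (Sunic f) \<and> prime q \<and> odd q}"
      using pm.infinite_index_maximal by (simp only:)
  next
    fix c and q :: nat assume "c \<in> B_auts f \<and> psi c = (a_aut, c) \<and> prime q \<and> odd q"
    then have "c = Rep_taut b" using uniq by blast
    then show "\<exists>S. finite S \<and> S \<subseteq> carrier (Sunic f) \<and> H_sub f c q = generate (Sunic f) S"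
      using fg by (simp only:)
  qed (use pm.infinite_maximal pm.countable_maximal c2 fin pm.finite_index_maximal in \<open>simp_all only: not_False_eq_True\<close>)
qed

end
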